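(* There is an isomorphism $$f:\mathbb P_Y(\mathcal U)\longrightarrow\mathrm{Bl}_{\sigma(\mathbb P(A))}\mathbb P(V)$$ commuting with the natural projections to $\mathbb P(V)$.
   Context: Work over $\mathbb C$; $\mathbb P(\cdot)$ is the space of one-dimensional subspaces (respectively line subbundles). Let $W$ be a $2$-dimensional vector space, $V=S^4W$ ($\dim V=5$), and let $A\cong S^2W$ be the unique $3$-dimensional $SL_2(W)$-subrepresentation of $\Lambda^2V^*\cong S^2W\oplus S^6W$; all non-zero forms in $A$ have rank $4$. Let $Y=\mathrm{Gr}(2,V)\cap \mathbb P(A^\perp)\subset\mathbb P(\Lambda^2V)$, a smooth Fano threefold, and let $\mathcal U\subset V\otimes\mathcal O_Y$ be the restriction of the rank $2$ tautological subbundle. The projection $\mathbb P_Y(\mathcal U)\to\mathbb P(V)$ is induced by $\mathcal U\subset V\otimes\mathcal O_Y$. The map $\sigma:\mathbb P(A)\to\mathbb P(V)$, $a\mapsto\ker a$ (equivalently $a\mapsto a\wedge a\in\Lambda^4V^*\cong V$), is a closed embedding whose image is a projected Veronese surface. *)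

theory Defs
  imports Complex_Main "HOL-Library.Function_Algebras"
begin

section \<open>Complex vector spaces\<close>

class complex_vector = ab_group_add +
  fixes scaleC :: "complex \<Rightarrow> 'a \<Rightarrow> 'a"  (infixr \<open>*\<^sub>C\<close> 75)
  assumes scaleC_add_right: "c *\<^sub>C (x + y) = c *\<^sub>C x + c *\<^sub>C y"
    and scaleC_add_left: "(b + c) *\<^sub>C x = b *\<^sub>C x + c *\<^sub>C x"
    and scaleC_scaleC: "b *\<^sub>C c *\<^sub>C x = (b * c) *\<^sub>C x"
    and scaleC_one: "1 *\<^sub>C x = x"

global_interpretation complex_vector:
  vector_space "scaleC :: complex \<Rightarrow> 'a \<Rightarrow> 'a :: complex_vector"
  by unfold_locales (rule scaleC_add_right scaleC_add_left scaleC_scaleC scaleC_one)+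

abbreviation "cspan \<equiv> complex_vector.span"
abbreviation "csubspace \<equiv> complex_vector.subspace"
abbreviation "cdim \<equiv> complex_vector.dim"

abbreviation clinear :: "('a::complex_vector \<Rightarrow> 'b::complex_vector) \<Rightarrow> bool"
  where "clinear \<equiv> Vector_Spaces.linear scaleC scaleC"

instantiation complex :: complex_vector
begin
definition scaleC_complex :: "complex \<Rightarrow> complex \<Rightarrow> complex"
  where "scaleC_complex c x = c * x"
instance
  by standard (simp_all add: scaleC_complex_def algebra_simps)
end

instantiation "fun" :: (type, complex_vector) complex_vector
begin
definition scaleC_fun :: "complex \<Rightarrow> ('a \<Rightarrow> 'b) \<Rightarrow> 'a \<Rightarrow> 'b"
  where "scaleC_fun c f = (\<lambda>x. c *\<^sub>C f x)"
instance
  by standard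
    (simp_all add: scaleC_fun_def fun_eq_iff scaleC_add_right scaleC_add_left
      scaleC_scaleC scaleC_one)
end


section \<open>The fourth symmetric power\<close>

text \<open>The symmetric power \<open>S\<^sup>4 W\<close> is realised as the space of homogeneous polynomial functions
  of degree 4 on the dual \<open>W\<^sup>*\<close>: the product \<open>w\<^sub>1 w\<^sub>2 w\<^sub>3 w\<^sub>4\<close> is the function
  \<open>\<phi> \<mapsto> \<phi>(w\<^sub>1) \<phi>(w\<^sub>2) \<phi>(w\<^sub>3) \<phi>(w\<^sub>4)\<close>. Arguments outside \<open>W\<^sup>*\<close>, i.e. non-linear \<open>\<phi>\<close>, are sent
  to \<open>0\<close>.\<close>

definition sym_prod :: "'w::complex_vector list \<Rightarrow> ('w \<Rightarrow> complex) \<Rightarrow> complex"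
  where "sym_prod ws = (\<lambda>\<phi>. if clinear \<phi> then (\<Prod>w\<leftarrow>ws. \<phi> w) else 0)"

typedef (overloaded) 'w sym4 =
  "cspan {sym_prod ws | ws :: 'w::complex_vector list. length ws = 4}"
  by (rule exI[of _ 0]) (rule complex_vector.span_zero)

setup_lifting type_definition_sym4

instantiation sym4 :: (complex_vector) complex_vector
begin
lift_definition zero_sym4 :: "'a sym4" is 0
  by (rule complex_vector.span_zero)
lift_definition plus_sym4 :: "'a sym4 \<Rightarrow> 'a sym4 \<Rightarrow> 'a sym4" is "(+)"
  by (rule complex_vector.span_add)
lift_definition minus_sym4 :: "'a sym4 \<Rightarrow> 'a sym4 \<Rightarrow> 'a sym4" is "(-)"
  by (rule complex_vector.span_diff)
lift_definition uminus_sym4 :: "'a sym4 \<Rightarrow> 'a sym4" is "uminus"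
  by (rule complex_vector.span_neg)
lift_definition scaleC_sym4 :: "complex \<Rightarrow> 'a sym4 \<Rightarrow> 'a sym4" is "scaleC"
  by (rule complex_vector.span_scale)
instance
  by standard
    (transfer, simp add: algebra_simps scaleC_add_right scaleC_add_left
      scaleC_scaleC scaleC_one)+
end

text \<open>The endomorphism \<open>S\<^sup>4 g\<close> of \<open>S\<^sup>4 W\<close> induced by a linear map \<open>g\<close>; the lemmas
  below show that it is well defined and is given by \<open>w\<^sub>1 w\<^sub>2 w\<^sub>3 w\<^sub>4 \<mapsto> g(w\<^sub>1) g(w\<^sub>2) g(w\<^sub>3) g(w\<^sub>4)\<close>.\<close>

definition sym4_map :: "('w::complex_vector \<Rightarrow> 'w) \<Rightarrow> 'w sym4 \<Rightarrow> 'w sym4"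
  where "sym4_map g p = Abs_sym4 (\<lambda>\<phi>. if clinear \<phi> then Rep_sym4 p (\<phi> \<circ> g) else 0)"

lemma sym_prod_comp:
  assumes "clinear g"
  shows "(\<lambda>\<phi>. if clinear \<phi> then sym_prod ws (\<phi> \<circ> g) else 0) = sym_prod (map g ws)"
  using assms by (auto simp: sym_prod_def fun_eq_iff o_def
      dest: Vector_Spaces.linear_compose[unfolded o_def])

lemma sym4_map_well_defined:
  assumes g: "clinear g"
  shows "(\<lambda>\<phi>. if clinear \<phi> then Rep_sym4 p (\<phi> \<circ> g) else 0) \<in>
    cspan {sym_prod ws | ws. length ws = 4}"
proof -
  let ?S = "{sym_prod ws | ws. length ws = 4}"
  let ?T = "\<lambda>q \<phi>. if clinear \<phi> then q (\<phi> \<circ> g) else (0::complex)"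
  have "Rep_sym4 p \<in> cspan ?S" by (rule Rep_sym4)
  then have "?T (Rep_sym4 p) \<in> cspan ?S"
  proof (induction rule: complex_vector.span_induct_alt)
    case base
    have "0 = ?T 0" by (rule ext) simp
    then show ?case by (rule subst) (rule complex_vector.span_zero)
  next
    case (step c x y)
    then obtain ws where ws: "x = sym_prod ws" "length ws = 4" by blast
    have "?T (c *\<^sub>C x + y) = c *\<^sub>C ?T x + ?T y"
      by (rule ext) (simp add: scaleC_fun_def scaleC_complex_def)
    also have "?T x = sym_prod (map g ws)"
      unfolding ws(1) by (rule sym_prod_comp[OF g])
    finally have eq: "c *\<^sub>C sym_prod (map g ws) + ?T y = ?T (c *\<^sub>C x + y)" by (rule sym)
    have "sym_prod (map g ws) \<in> ?S"
      using ws(2) by (intro CollectI exI[of _ "map g ws"]) simp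
    then have "c *\<^sub>C sym_prod (map g ws) + ?T y \<in> cspan ?S"
      by (intro complex_vector.span_add complex_vector.span_scale complex_vector.span_base step.IH)
    then show ?case
      by (rule back_subst[of "\<lambda>f. f \<in> cspan ?S", OF _ eq])
  qed
  then show ?thesis .
qed

lemma Rep_sym4_map:
  assumes "clinear g"
  shows "Rep_sym4 (sym4_map g p) = (\<lambda>\<phi>. if clinear \<phi> then Rep_sym4 p (\<phi> \<circ> g) else 0)"
  unfolding sym4_map_def using sym4_map_well_defined[OF assms] by (rule Abs_sym4_inverse)

lemma sym4_map_prod:
  assumes "clinear g" "length ws = 4"
  shows "sym4_map g (Abs_sym4 (sym_prod ws)) = Abs_sym4 (sym_prod (map g ws))"
proof -
  have "Rep_sym4 (Abs_sym4 (sym_prod ws)) = sym_prod ws"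
    using assms(2) by (intro Abs_sym4_inverse complex_vector.span_base) blast
  then show ?thesis
    unfolding sym4_map_def by (simp only: sym_prod_comp[OF assms(1)])
qed


section \<open>Alternating forms, bivectors and the Grassmannian\<close>

definition alt_forms :: "('v::complex_vector \<Rightarrow> 'v \<Rightarrow> complex) set"
  where "alt_forms = {\<omega>. (\<forall>x. clinear (\<omega> x)) \<and> (\<forall>y. clinear (\<lambda>x. \<omega> x y)) \<and> (\<forall>x. \<omega> x x = 0)}"

text \<open>On a space of dimension 2 the forms in \<open>\<Lambda>\<^sup>2 W\<^sup>*\<close> are the multiples of a non-zero one, on
  which \<open>g\<close> acts by \<open>det g\<close>; so this is the special linear group \<open>SL\<^sub>2(W)\<close>.\<close>

definition SL2 :: "('w::complex_vector \<Rightarrow> 'w) set"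
  where "SL2 = {g. clinear g \<and> (\<forall>\<omega>\<in>alt_forms. \<forall>x y. \<omega> (g x) (g y) = \<omega> x y)}"

text \<open>\<open>\<Lambda>\<^sup>2 V\<close> is realised inside the dual of \<open>\<Lambda>\<^sup>2 V\<^sup>*\<close>, so that the pairing of \<open>\<xi> \<in> \<Lambda>\<^sup>2 V\<close> with
  \<open>a \<in> \<Lambda>\<^sup>2 V\<^sup>*\<close> is \<open>\<xi> a\<close>.\<close>

type_synonym 'v bivec = "('v \<Rightarrow> 'v \<Rightarrow> complex) \<Rightarrow> complex"

definition wedge :: "'v::complex_vector \<Rightarrow> 'v \<Rightarrow> 'v bivec"
  where "wedge u v = (\<lambda>\<omega>. if \<omega> \<in> alt_forms then \<omega> u v else 0)"

definition bivectors :: "'v::complex_vector bivec set"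
  where "bivectors = cspan {wedge u v | u v. True}"

definition perp :: "('v::complex_vector \<Rightarrow> 'v \<Rightarrow> complex) set \<Rightarrow> 'v bivec set"
  where "perp A = {\<xi> \<in> bivectors. \<forall>a\<in>A. \<xi> a = 0}"

text \<open>Points of projective spaces are lines through the origin, as sets of vectors.\<close>

definition line :: "'a::complex_vector \<Rightarrow> 'a set"
  where "line x = cspan {x}"

definition proj :: "'a::complex_vector set \<Rightarrow> 'a set set"
  where "proj E = line ` (E - {0})"

definition plucker :: "'v::complex_vector set \<Rightarrow> 'v bivec set"
  where "plucker U = cspan {wedge u v | u v. u \<in> U \<and> v \<in> U}"

definition grass2 :: "'v::complex_vector set set"
  where "grass2 = {U. csubspace U \<and> cdim U = 2}"

definition Y_var :: "('v::complex_vector \<Rightarrow> 'v \<Rightarrow> complex) set \<Rightarrow> 'v bivec set set"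
  where "Y_var A = plucker ` grass2 \<inter> proj (perp A)"

text \<open>The projective bundle \<open>P\<^sub>Y(U)\<close> as a subvariety of \<open>P(V) \<times> P(\<Lambda>\<^sup>2 V)\<close>: the fibre of the
  tautological bundle at the point \<open>plucker U\<close> of \<open>Y\<close> is \<open>U\<close>. Its projection to \<open>P(V)\<close> is
  \<^const>\<open>fst\<close>.\<close>

definition PU :: "('v::complex_vector \<Rightarrow> 'v \<Rightarrow> complex) set \<Rightarrow> ('v set \<times> 'v bivec set) set"
  where "PU A = {(l, y). y \<in> Y_var A \<and> (\<exists>U\<in>grass2. y = plucker U \<and> l \<in> proj U)}"

text \<open>\<open>ker_form k\<close> is the kernel of any non-zero form on the line \<open>k\<close>.\<close>

definition ker_form :: "('v::complex_vector \<Rightarrow> 'v \<Rightarrow> complex) set \<Rightarrow> 'v set"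
  where "ker_form k = {v. \<forall>a\<in>k. \<forall>w. a v w = 0}"


section \<open>Varieties in products of two projective spaces\<close>

definition hpoly :: "nat \<Rightarrow> ('a::complex_vector \<Rightarrow> complex) set"
  where "hpoly d = cspan {\<lambda>x. (\<Prod>\<phi>\<leftarrow>\<phi>s. \<phi> x) | \<phi>s. length \<phi>s = d \<and> (\<forall>\<phi>\<in>set \<phi>s. clinear \<phi>)}"

definition bihpoly :: "nat \<Rightarrow> nat \<Rightarrow> ('a::complex_vector \<Rightarrow> 'b::complex_vector \<Rightarrow> complex) set"
  where "bihpoly d e = cspan {\<lambda>x y. p x * q y | p q. p \<in> hpoly d \<and> q \<in> hpoly e}"

definition bihpoly_vec ::
  "nat \<Rightarrow> nat \<Rightarrow> ('a::complex_vector \<Rightarrow> 'b::complex_vector \<Rightarrow> 'c::complex_vector) set"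
  where "bihpoly_vec d e = cspan {\<lambda>x y. p x y *\<^sub>C c | p c. p \<in> bihpoly d e}"

definition vanishes_at ::
  "('a::complex_vector \<Rightarrow> 'b::complex_vector \<Rightarrow> complex) \<Rightarrow> 'a set \<times> 'b set \<Rightarrow> bool"
  where "vanishes_at h z \<longleftrightarrow> (\<forall>x\<in>fst z. \<forall>y\<in>snd z. h x y = 0)"

definition zariski_closure ::
  "('a::complex_vector set \<times> 'b::complex_vector set) set \<Rightarrow> ('a set \<times> 'b set) set"
  where "zariski_closure S = {z \<in> proj UNIV \<times> proj UNIV.
    \<forall>d e. \<forall>h\<in>bihpoly d e. (\<forall>s\<in>S. vanishes_at h s) \<longrightarrow> vanishes_at h z}"

text \<open>A map from \<open>X \<subseteq> P(E\<^sub>1) \<times> P(E\<^sub>2)\<close> to a projective space is regular if on suitable basic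
  Zariski open neighbourhoods \<open>{h \<noteq> 0}\<close> of the points of \<open>X\<close> it is given by bihomogeneous
  polynomials without common zeros.\<close>

definition regular_to_proj ::
  "('a::complex_vector set \<times> 'b::complex_vector set) set \<Rightarrow>
    ('a set \<times> 'b set \<Rightarrow> 'c::complex_vector set) \<Rightarrow> bool"
  where "regular_to_proj X f \<longleftrightarrow> (\<forall>z\<in>X. \<exists>d e d' e'. \<exists>h\<in>bihpoly d e. \<exists>Q\<in>bihpoly_vec d' e'.
    \<not> vanishes_at h z \<and>
    (\<forall>k l. (k, l) \<in> X \<and> \<not> vanishes_at h (k, l) \<longrightarrow>
      (\<forall>x\<in>k - {0}. \<forall>y\<in>l - {0}. Q x y \<noteq> 0 \<and> f (k, l) = line (Q x y))))"

definition regular_map ::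
  "('a::complex_vector set \<times> 'b::complex_vector set) set \<Rightarrow>
    ('a set \<times> 'b set \<Rightarrow> 'c::complex_vector set \<times> 'd::complex_vector set) \<Rightarrow> bool"
  where "regular_map X f \<longleftrightarrow> regular_to_proj X (fst \<circ> f) \<and> regular_to_proj X (snd \<circ> f)"

definition variety_iso ::
  "('a::complex_vector set \<times> 'b::complex_vector set) set \<Rightarrow>
    ('c::complex_vector set \<times> 'd::complex_vector set) set \<Rightarrow>
    ('a set \<times> 'b set \<Rightarrow> 'c set \<times> 'd set) \<Rightarrow> bool"
  where "variety_iso X X' f \<longleftrightarrow>
    bij_betw f X X' \<and> regular_map X f \<and> regular_map X' (inv_into X f)"


section \<open>Blow-ups of projective space\<close>

definition ideal_deg :: "'v::complex_vector set set \<Rightarrow> nat \<Rightarrow> ('v \<Rightarrow> complex) set"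
  where "ideal_deg Z d = {p \<in> hpoly d. \<forall>k\<in>Z. \<forall>x\<in>k. p x = 0}"

text \<open>\<open>F\<^sub>0, \<dots>, F\<^sub>r\<^sub>-\<^sub>1\<close> are homogeneous of degree \<open>d\<close> and generate an ideal which agrees with the
  homogeneous ideal of \<open>Z\<close> in all large degrees, i.e. has it as saturation; equivalently, they
  generate a twist of the ideal sheaf of \<open>Z\<close>.\<close>

definition generates_ideal ::
  "'v::complex_vector set set \<Rightarrow> nat \<Rightarrow> nat \<Rightarrow> (nat \<Rightarrow> 'v \<Rightarrow> complex) \<Rightarrow> bool"
  where "generates_ideal Z d r F \<longleftrightarrow> (\<forall>i<r. F i \<in> hpoly d) \<and>
    (\<exists>e0. \<forall>e\<ge>e0. ideal_deg Z (d + e) = cspan {\<lambda>x. q x * F i x | q i. q \<in> hpoly e \<and> i < r})"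

text \<open>The graph of the rational map \<open>(F\<^sub>0 : \<dots> : F\<^sub>r\<^sub>-\<^sub>1)\<close>, on the complement of the common zeros.
  The target \<open>P\<^sup>r\<^sup>-\<^sup>1\<close> is the subspace of \<open>proj (UNIV :: (nat \<Rightarrow> complex) set)\<close> where all
  coordinates with index at least \<open>r\<close> vanish.\<close>

definition rational_graph ::
  "nat \<Rightarrow> (nat \<Rightarrow> 'v::complex_vector \<Rightarrow> complex) \<Rightarrow> ('v set \<times> (nat \<Rightarrow> complex) set) set"
  where "rational_graph r F =
    {(line x, line (\<lambda>i. if i < r then F i x else 0)) | x. \<exists>i<r. F i x \<noteq> 0}"

text \<open>The blow-up of \<open>P(V)\<close> along \<open>Z\<close> is the closure of the graph of the rational map given by
  such equations \<open>F\<close>. It depends on \<open>F\<close> only up to isomorphism over \<open>P(V)\<close>, hence is a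
  predicate here. The blow-down morphism is \<^const>\<open>fst\<close>.\<close>

definition is_blowup ::
  "'v::complex_vector set set \<Rightarrow> ('v set \<times> (nat \<Rightarrow> complex) set) set \<Rightarrow> bool"
  where "is_blowup Z B \<longleftrightarrow>
    (\<exists>d r F. generates_ideal Z d r F \<and> B = zariski_closure (rational_graph r F))"

end

(* In coordinates, A is spanned by the third transvectant of binary quartics and the kernel of the
   form attached to a quadric q is spanned by q^2, so the surface Z consists of the squares. For x off Z
   the subspaces U in Y containing x are determined by the three linear equations a(x, u) = 0, and the
   bivector of U has as coordinates seven cubics in x. Over a point of Z the fibre is a line, but no U is
   contained in Z, so P_Y(U) is the closure of the graph of the rational map given by the seven cubics.
   These cubics generate the ideal of Z: reduce a polynomial to a normal form over C[x0, x2, x4] and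
   compare coefficients on Z using the deck transformations of (a, b, c) -> (a^2, b^2 + 2ac, c^2). If two
   tuples of forms generate the ideal of Z in all large degrees, multiplication by powers of a coordinate
   expresses each tuple through the other, which gives mutually inverse regular maps between the
   closures of their graphs. *)
theory Submission
  imports Defs "HOL-Computational_Algebra.Polynomial"
begin

section \<open>Linear maps and spans\<close>

text \<open>No local analysis of the blow-up is needed: a bihomogeneous identity that holds on a
  graph holds on its closure, so mutual inversion and independence of the chart reduce to identities
  checked on the graph. Powers of a coordinate enter because the given forms generate the ideal only
  in large degrees: multiplying by them moves both tuples into one degree in which the two
  descriptions of the ideal agree, and the charts X_k \<noteq> 0 cover the projective space. That A
  is the expected subspace is forced without decomposing the exterior square. The torus splits A
  into weight components, the coefficient of r in the unipotent family acts as a raising operator,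
  and an extremal weight vector of S^6 W would already produce four independent forms in the
  three-dimensional A. A quartic is written x0 s^4 + 2 x1 s^3 t + x2 s^2 t^2 + 2 x3 s t^3 + x4 t^4;
  with the two factors 2 the square of \<alpha> s^2 + \<beta> s t + \<gamma> t^2 has the simple
  coordinates \<alpha>^2, \<alpha> \<beta>, \<beta>^2 + 2 \<alpha> \<gamma>, \<beta> \<gamma>,
  \<gamma>^2.\<close>

lemma clinear_iff:
  "clinear f \<longleftrightarrow> (\<forall>x y. f (x + y) = f x + f y) \<and> (\<forall>c x. f (c *\<^sub>C x) = c *\<^sub>C f x)"
  by (simp add: Vector_Spaces.linear_iff complex_vector.vector_space_axioms)

lemma clinearI:
  assumes "\<And>x y. f (x + y) = f x + f y" "\<And>c x. f (c *\<^sub>C x) = c *\<^sub>C f x"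
  shows "clinear f"
  using assms by (simp add: clinear_iff)

lemma clinear_add: "clinear f \<Longrightarrow> f (x + y) = f x + f y"
  and clinear_scale: "clinear f \<Longrightarrow> f (c *\<^sub>C x) = c *\<^sub>C f x"
  by (simp_all add: clinear_iff)

lemma clinear_zero: "clinear f \<Longrightarrow> f 0 = 0"
  using clinear_scale[of f 0 0] by simp

lemma clinear_diff: "clinear f \<Longrightarrow> f (x - y) = f x - f y"
  using clinear_add[of f "x - y" y] by (simp add: algebra_simps)

lemma clinear_sum: "clinear f \<Longrightarrow> f (\<Sum>i\<in>I. x i) = (\<Sum>i\<in>I. f (x i))"
  by (induction I rule: infinite_finite_induct) (simp_all add: clinear_zero clinear_add)

lemma clinear_span_image:
  assumes "clinear f" "\<And>s. s \<in> S \<Longrightarrow> f s \<in> cspan R" "x \<in> cspan S"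
  shows "f x \<in> cspan R"
  using assms(3)
  by (induction rule: complex_vector.span_induct_alt)
    (simp_all add: assms(1,2) clinear_zero clinear_add clinear_scale complex_vector.span_zero
      complex_vector.span_add complex_vector.span_scale)

text \<open>Applied to products of functions, it reduces closure of spaces of polynomials under
  multiplication to their generators.\<close>

lemma bilinear_span_image:
  assumes "\<And>y. clinear (\<lambda>x. f x y)" "\<And>x. clinear (f x)"
    and "\<And>s t. s \<in> S \<Longrightarrow> t \<in> T \<Longrightarrow> f s t \<in> cspan R" "x \<in> cspan S" "y \<in> cspan T"
  shows "f x y \<in> cspan R"
proof (rule clinear_span_image[OF assms(1) _ assms(4)])
  fix s assume "s \<in> S"
  then show "f s y \<in> cspan R"
    using clinear_span_image[OF assms(2) _ assms(5), of s] assms(3) by blast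
qed

lemma scaleC_apply [simp]: "(c *\<^sub>C f) x = c *\<^sub>C f x"
  by (simp add: scaleC_fun_def)

text \<open>Keeps the next rule from rewriting the scalar multiplications inside \<open>clinear\<close>.\<close>

lemma linear_cong [cong]: "f = g \<Longrightarrow> Vector_Spaces.linear s t f = Vector_Spaces.linear s t g"
  by simp

lemma scaleC_complex [simp]: "c *\<^sub>C (z :: complex) = c * z"
  by (simp add: scaleC_complex_def)

lemma sum_apply: "(\<Sum>i\<in>I. f i) x = (\<Sum>i\<in>I. f i x)"
  by (induction I rule: infinite_finite_induct) simp_all

lemma span_subspace_mem:
  assumes "x \<in> cspan S" "S \<subseteq> T" "csubspace T"
  shows "x \<in> T"
  using complex_vector.span_minimal[OF assms(2,3)] assms(1) by blast

section \<open>Polynomial functions\<close>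

lemma hpoly_subspace: "csubspace (hpoly d)"
  and bihpoly_subspace: "csubspace (bihpoly d e)"
  and bihpoly_vec_subspace: "csubspace (bihpoly_vec d e)"
  by (simp_all add: hpoly_def bihpoly_def bihpoly_vec_def)

lemma subspace_fun_add: "csubspace S \<Longrightarrow> p \<in> S \<Longrightarrow> q \<in> S \<Longrightarrow> (\<lambda>x. p x + q x) \<in> S"
  using complex_vector.subspace_add[of S p q] by (simp add: plus_fun_def)

lemma subspace_fun_scale:
  fixes p :: "'a \<Rightarrow> complex"
  shows "csubspace S \<Longrightarrow> p \<in> S \<Longrightarrow> (\<lambda>x. c * p x) \<in> S"
  using complex_vector.subspace_scale[of S p c] by (simp add: scaleC_fun_def)

lemmas hpoly_add = subspace_fun_add[OF hpoly_subspace]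
  and hpoly_scale = subspace_fun_scale[OF hpoly_subspace]

lemma bihpoly_add: "p \<in> bihpoly d e \<Longrightarrow> q \<in> bihpoly d e \<Longrightarrow> (\<lambda>x y. p x y + q x y) \<in> bihpoly d e"
  using complex_vector.subspace_add[OF bihpoly_subspace, of p d e q] by (simp add: plus_fun_def)

lemma bihpoly_scale: "p \<in> bihpoly d e \<Longrightarrow> (\<lambda>x y. c * p x y) \<in> bihpoly d e"
  using complex_vector.subspace_scale[OF bihpoly_subspace, of p d e c]
  by (simp add: scaleC_fun_def)

lemma bihpoly_diff: "p \<in> bihpoly d e \<Longrightarrow> q \<in> bihpoly d e \<Longrightarrow> (\<lambda>x y. p x y - q x y) \<in> bihpoly d e"
  using bihpoly_add[of p d e "\<lambda>x y. (-1) * q x y"] bihpoly_scale[of q d e "-1"] by simp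

lemma bihpoly_zero: "(\<lambda>x y. 0) \<in> bihpoly d e"
  using complex_vector.subspace_0[OF bihpoly_subspace] by (simp add: zero_fun_def)

lemma bihpoly_sum:
  "(\<And>i. i \<in> I \<Longrightarrow> p i \<in> bihpoly d e) \<Longrightarrow> (\<lambda>x y. \<Sum>i\<in>I. p i x y) \<in> bihpoly d e"
  by (induction I rule: infinite_finite_induct) (simp_all add: bihpoly_zero bihpoly_add)

lemma hpoly_const: "(\<lambda>x. c) \<in> hpoly 0"
proof -
  have "(\<lambda>x. 1) \<in> hpoly 0"
    unfolding hpoly_def by (intro complex_vector.span_base CollectI exI[of _ "[]"]) simp
  then show ?thesis using hpoly_scale[of "\<lambda>x. 1" 0 c] by simp
qed

lemma hpoly_linear: "clinear \<phi> \<Longrightarrow> \<phi> \<in> hpoly (Suc 0)"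
  unfolding hpoly_def by (intro complex_vector.span_base CollectI exI[of _ "[\<phi>]"]) simp

lemma hpoly_mult:
  assumes "p \<in> hpoly d" "q \<in> hpoly e"
  shows "(\<lambda>x. p x * q x) \<in> hpoly (d + e)"
  using assms unfolding hpoly_def
proof (rule bilinear_span_image[rotated 3])
  fix s t :: "'a \<Rightarrow> complex"
  assume "s \<in> {\<lambda>x. \<Prod>\<phi>\<leftarrow>\<phi>s. \<phi> x |\<phi>s. length \<phi>s = d \<and> (\<forall>\<phi>\<in>set \<phi>s. clinear \<phi>)}"
    and "t \<in> {\<lambda>x. \<Prod>\<phi>\<leftarrow>\<phi>s. \<phi> x |\<phi>s. length \<phi>s = e \<and> (\<forall>\<phi>\<in>set \<phi>s. clinear \<phi>)}"
  then obtain us vs where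
    "s = (\<lambda>x. \<Prod>\<phi>\<leftarrow>us. \<phi> x)" "length us = d" "\<forall>\<phi>\<in>set us. clinear \<phi>"
    "t = (\<lambda>x. \<Prod>\<phi>\<leftarrow>vs. \<phi> x)" "length vs = e" "\<forall>\<phi>\<in>set vs. clinear \<phi>"
    by blast
  then show "(\<lambda>x. s x * t x) \<in>
    cspan {\<lambda>x. \<Prod>\<phi>\<leftarrow>\<phi>s. \<phi> x |\<phi>s. length \<phi>s = d + e \<and> (\<forall>\<phi>\<in>set \<phi>s. clinear \<phi>)}"
    by (intro complex_vector.span_base CollectI exI[of _ "us @ vs"]) auto
qed (auto simp: clinear_iff fun_eq_iff algebra_simps)

lemma hpoly_power:
  assumes "p \<in> hpoly d" shows "(\<lambda>x. p x ^ n) \<in> hpoly (n * d)"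
proof (induction n)
  case (Suc n)
  then show ?case using hpoly_mult[OF assms, of "\<lambda>x. p x ^ n" "n * d"] by simp
qed (simp add: hpoly_const)

text \<open>Splits one linear factor off each generator, so that the expansion into monomials can
  proceed by induction on the degree.\<close>

lemma hpoly_Suc:
  assumes "p \<in> hpoly (Suc d)"
  shows "p \<in> cspan {\<lambda>x. \<phi> x * q x | \<phi> q. clinear \<phi> \<and> q \<in> hpoly d}"
  using assms unfolding hpoly_def[of "Suc d"]
proof (rule span_subspace_mem, intro subsetI)
  fix s :: "'a \<Rightarrow> complex"
  assume "s \<in> {\<lambda>x. \<Prod>\<phi>\<leftarrow>\<phi>s. \<phi> x |\<phi>s. length \<phi>s = Suc d \<and> (\<forall>\<phi>\<in>set \<phi>s. clinear \<phi>)}"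
  then obtain us where us: "s = (\<lambda>x. \<Prod>\<phi>\<leftarrow>us. \<phi> x)" "length us = Suc d" "\<forall>\<phi>\<in>set us. clinear \<phi>"
    by blast
  then obtain \<phi> vs where vs: "us = \<phi> # vs" "length vs = d" by (cases us) auto
  have "(\<lambda>x. \<Prod>\<psi>\<leftarrow>vs. \<psi> x) \<in> hpoly d"
    unfolding hpoly_def using us vs
    by (intro complex_vector.span_base CollectI exI[of _ vs]) auto
  then show "s \<in> cspan {\<lambda>x. \<phi> x * q x | \<phi> q. clinear \<phi> \<and> q \<in> hpoly d}"
    using us vs by (intro complex_vector.span_base) auto
qed simp

lemma hpoly_homogeneous:
  assumes "p \<in> hpoly d"
  shows "p (c *\<^sub>C x) = c ^ d * p x"
  using assms unfolding hpoly_def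
proof (induction rule: complex_vector.span_induct_alt)
  case (step k p q)
  then obtain us where us: "p = (\<lambda>x. \<Prod>\<phi>\<leftarrow>us. \<phi> x)" "length us = d" "\<forall>\<phi>\<in>set us. clinear \<phi>"
    by blast
  have "(\<Prod>\<phi>\<leftarrow>us. \<phi> (c *\<^sub>C x)) = c ^ length us * (\<Prod>\<phi>\<leftarrow>us. \<phi> x)"
    using us(3) by (induction us) (auto simp: clinear_scale)
  then show ?case using us step.IH by (simp add: algebra_simps)
qed simp

text \<open>Restriction to an affine line turns limit arguments into statements about polynomials in
  one variable, where a product is zero only if a factor is.\<close>

lemma hpoly_poly:
  assumes "p \<in> hpoly d"
  shows "\<exists>P. \<forall>t. p (x + t *\<^sub>C y) = poly P t"
  using assms unfolding hpoly_def
proof (induction rule: complex_vector.span_induct_alt)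
  case base
  show ?case by (rule exI[of _ 0]) simp
next
  case (step k p q)
  then obtain us where us: "p = (\<lambda>x. \<Prod>\<phi>\<leftarrow>us. \<phi> x)" "\<forall>\<phi>\<in>set us. clinear \<phi>"
    by blast
  have "(\<Prod>\<phi>\<leftarrow>us. \<phi> (x + t *\<^sub>C y)) = poly (\<Prod>\<phi>\<leftarrow>us. [:\<phi> x, \<phi> y:]) t" for t
    using us(2) by (induction us) (auto simp: clinear_scale clinear_add algebra_simps)
  moreover obtain Q where "\<forall>t. q (x + t *\<^sub>C y) = poly Q t" using step.IH by blast
  ultimately show ?case using us
    by (intro exI[of _ "smult k (\<Prod>\<phi>\<leftarrow>us. [:\<phi> x, \<phi> y:]) + Q"]) simp
qed

lemma bihpoly_product: "p \<in> hpoly d \<Longrightarrow> q \<in> hpoly e \<Longrightarrow> (\<lambda>x y. p x * q y) \<in> bihpoly d e"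
  unfolding bihpoly_def by (intro complex_vector.span_base) blast

lemma bihpoly_const: "(\<lambda>x y. c) \<in> bihpoly 0 0"
  using bihpoly_product[OF hpoly_const[of c] hpoly_const[of 1]] by simp

lemma bihpoly_left: "p \<in> hpoly d \<Longrightarrow> (\<lambda>x y. p x) \<in> bihpoly d 0"
  using bihpoly_product[OF _ hpoly_const[of 1]] by force

lemma bihpoly_right: "q \<in> hpoly e \<Longrightarrow> (\<lambda>x y. q y) \<in> bihpoly 0 e"
  using bihpoly_product[OF hpoly_const[of 1]] by force

lemma bihpoly_linear: "p \<in> hpoly d \<Longrightarrow> clinear \<psi> \<Longrightarrow> (\<lambda>x y. p x * \<psi> y) \<in> bihpoly d (Suc 0)"
  by (intro bihpoly_product hpoly_linear)

lemma bihpoly_mult: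
  assumes "p \<in> bihpoly d e" "q \<in> bihpoly d' e'"
  shows "(\<lambda>x y. p x y * q x y) \<in> bihpoly (d + d') (e + e')"
  using assms unfolding bihpoly_def[of d] bihpoly_def[of d']
    bihpoly_def[of "d + d'"]
proof (rule bilinear_span_image[rotated 3])
  fix s t :: "'a \<Rightarrow> 'b \<Rightarrow> complex"
  assume "s \<in> {\<lambda>x y. p x * q y |p q. p \<in> hpoly d \<and> q \<in> hpoly e}"
    and "t \<in> {\<lambda>x y. p x * q y |p q. p \<in> hpoly d' \<and> q \<in> hpoly e'}"
  then obtain p q p' q' where
    "s = (\<lambda>x y. p x * q y)" "p \<in> hpoly d" "q \<in> hpoly e"
    "t = (\<lambda>x y. p' x * q' y)" "p' \<in> hpoly d'" "q' \<in> hpoly e'"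
    by blast
  then show "(\<lambda>x y. s x y * t x y) \<in>
    cspan {\<lambda>x y. p x * q y |p q. p \<in> hpoly (d + d') \<and> q \<in> hpoly (e + e')}"
    by (intro complex_vector.span_base CollectI exI[of _ "\<lambda>x. p x * p' x"]
        exI[of _ "\<lambda>y. q y * q' y"]) (auto intro: hpoly_mult simp: fun_eq_iff)
qed (auto simp: clinear_iff fun_eq_iff algebra_simps)

lemma bihpoly_homogeneous:
  assumes "h \<in> bihpoly d e"
  shows "h (c *\<^sub>C x) (k *\<^sub>C y) = c ^ d * k ^ e * h x y"
  using assms unfolding bihpoly_def
proof (induction rule: complex_vector.span_induct_alt)
  case (step r p q)
  then obtain u v where "p = (\<lambda>x y. u x * v y)" "u \<in> hpoly d" "v \<in> hpoly e" by blast
  then show ?case using step.IH by (simp add: hpoly_homogeneous algebra_simps)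
qed simp

lemma bihpoly_slice:
  assumes "h \<in> bihpoly d e" shows "(\<lambda>x. h x y) \<in> hpoly d"
  using assms unfolding bihpoly_def
proof (induction rule: complex_vector.span_induct_alt)
  case base
  show ?case using hpoly_scale[of "\<lambda>x. 0" d 0] complex_vector.subspace_0[OF hpoly_subspace]
    by (simp add: zero_fun_def)
next
  case (step r p q)
  then obtain u v where "p = (\<lambda>x y. u x * v y)" "u \<in> hpoly d" by blast
  then show ?case using hpoly_add[OF hpoly_scale[of u d "r * v y"] step.IH]
    by (simp add: mult_ac)
qed

lemma bihpoly_vec_scale: "h \<in> bihpoly d e \<Longrightarrow> (\<lambda>x y. h x y *\<^sub>C c) \<in> bihpoly_vec d e"
  unfolding bihpoly_vec_def by (intro complex_vector.span_base) blast

lemma bihpoly_vec_add: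
  "P \<in> bihpoly_vec d e \<Longrightarrow> Q \<in> bihpoly_vec d e \<Longrightarrow> (\<lambda>x y. P x y + Q x y) \<in> bihpoly_vec d e"
  using complex_vector.subspace_add[OF bihpoly_vec_subspace, of P d e Q]
  by (simp add: plus_fun_def)

lemma bihpoly_vec_sum:
  "(\<And>i. i \<in> I \<Longrightarrow> P i \<in> bihpoly_vec d e) \<Longrightarrow> (\<lambda>x y. \<Sum>i\<in>I. P i x y) \<in> bihpoly_vec d e"
proof (induction I rule: infinite_finite_induct)
  case (insert i I)
  then show ?case by (simp add: bihpoly_vec_add)
qed (use complex_vector.subspace_0[OF bihpoly_vec_subspace] in \<open>simp_all add: zero_fun_def\<close>)

lemma bihpoly_vec_functional:
  assumes "Q \<in> bihpoly_vec d e" "clinear \<psi>"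
  shows "(\<lambda>x y. \<psi> (Q x y)) \<in> bihpoly d e"
  using assms(1) unfolding bihpoly_vec_def
proof (induction rule: complex_vector.span_induct_alt)
  case base
  show ?case using bihpoly_zero assms(2) by (simp add: clinear_zero)
next
  case (step r p q)
  then obtain h c where "p = (\<lambda>x y. h x y *\<^sub>C c)" "h \<in> bihpoly d e" by blast
  then show ?case using bihpoly_add[OF bihpoly_scale[of h d e "r * \<psi> c"] step.IH]
    by (simp add: clinear_add[OF assms(2)] clinear_scale[OF assms(2)] mult_ac)
qed

lemma bihpoly_vec_homogeneous:
  assumes "Q \<in> bihpoly_vec d e"
  shows "Q (c *\<^sub>C x) (k *\<^sub>C y) = (c ^ d * k ^ e) *\<^sub>C Q x y"
  using assms unfolding bihpoly_vec_def
proof (induction rule: complex_vector.span_induct_alt)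
  case (step r p q)
  then obtain h v where "p = (\<lambda>x y. h x y *\<^sub>C v)" "h \<in> bihpoly d e" by blast
  then show ?case using step.IH
    by (simp add: bihpoly_homogeneous scaleC_add_right scaleC_scaleC mult_ac)
qed simp

lemma bihpoly_power_left:
  "l \<in> hpoly (Suc 0) \<Longrightarrow> (\<lambda>x y. l x ^ n) \<in> bihpoly n 0"
  using bihpoly_left[OF hpoly_power, of l "Suc 0" n] by simp

lemma hpoly_comp_bihpoly_vec:
  assumes "p \<in> hpoly n" "Q \<in> bihpoly_vec d e"
  shows "(\<lambda>x y. p (Q x y)) \<in> bihpoly (n * d) (n * e)"
  using assms(1) unfolding hpoly_def
proof (induction rule: complex_vector.span_induct_alt)
  case base
  show ?case by (simp add: bihpoly_zero)
next
  case (step r p q)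
  then obtain us where us: "p = (\<lambda>x. \<Prod>\<phi>\<leftarrow>us. \<phi> x)" "length us = n" "\<forall>\<phi>\<in>set us. clinear \<phi>"
    by blast
  have "(\<lambda>x y. \<Prod>\<phi>\<leftarrow>us. \<phi> (Q x y)) \<in> bihpoly (length us * d) (length us * e)"
    using us(3)
  proof (induction us)
    case (Cons \<phi> us)
    then show ?case
      using bihpoly_mult[OF bihpoly_vec_functional[OF assms(2), of \<phi>] Cons.IH] by simp
  qed (simp add: bihpoly_const)
  then show ?case using bihpoly_add[OF bihpoly_scale[of _ _ _ r] step.IH] us by simp
qed

text \<open>Pulls an equation of the target back along (x, y) \<mapsto> (x, Q x y); each of the n
  factors in the second variable contributes bidegree (d, e).\<close>

lemma bihpoly_comp:
  assumes "h \<in> bihpoly m n" "Q \<in> bihpoly_vec d e"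
  shows "(\<lambda>x y. h x (Q x y)) \<in> bihpoly (m + n * d) (n * e)"
  using assms(1) unfolding bihpoly_def[of m]
proof (induction rule: complex_vector.span_induct_alt)
  case base
  show ?case by (simp add: bihpoly_zero)
next
  case (step r p q)
  then obtain u v where u: "p = (\<lambda>x y. u x * v y)" "u \<in> hpoly m" "v \<in> hpoly n" by blast
  have "(\<lambda>x y. u x * v (Q x y)) \<in> bihpoly (m + n * d) (0 + n * e)"
    by (intro bihpoly_mult bihpoly_left hpoly_comp_bihpoly_vec assms u)
  then show ?case using bihpoly_add[OF bihpoly_scale[of _ _ _ r] step.IH] u(1) by simp
qed

section \<open>Points of projective spaces and closures of graphs\<close>

lemma mem_line: "y \<in> line x \<longleftrightarrow> (\<exists>c. y = c *\<^sub>C x)"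
  by (auto simp: line_def complex_vector.span_singleton)

lemma self_mem_line: "x \<in> line x"
  by (simp add: line_def complex_vector.span_base)

lemma line_scale:
  assumes "c \<noteq> 0" shows "line (c *\<^sub>C x) = line x"
proof -
  have "k *\<^sub>C x \<in> line (c *\<^sub>C x)" for k
    unfolding mem_line using assms by (intro exI[of _ "k / c"]) (simp add: scaleC_scaleC)
  then show ?thesis by (auto simp: mem_line scaleC_scaleC)
qed

lemma line_eqI: "y \<in> line x \<Longrightarrow> y \<noteq> 0 \<Longrightarrow> line y = line x"
  by (elim mem_line[THEN iffD1, THEN exE]) (auto simp: line_scale)

lemma proj_UNIV_E:
  assumes "k \<in> proj E" obtains x where "x \<in> E" "x \<noteq> 0" "k = line x"
  using assms by (auto simp: proj_def)

lemma line_mem_proj: "x \<in> E \<Longrightarrow> x \<noteq> 0 \<Longrightarrow> line x \<in> proj E"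
  by (auto simp: proj_def)

lemma vanishes_at_line:
  assumes "h \<in> bihpoly d e"
  shows "vanishes_at h (line x, line y) \<longleftrightarrow> h x y = 0"
proof
  show "vanishes_at h (line x, line y) \<Longrightarrow> h x y = 0"
    by (auto simp: vanishes_at_def self_mem_line)
  show "h x y = 0 \<Longrightarrow> vanishes_at h (line x, line y)"
    by (auto simp: vanishes_at_def mem_line bihpoly_homogeneous[OF assms])
qed

text \<open>Allows an arbitrary target space, so that the bivector-valued map and the coordinate
  tuples of a blow-up are treated alike.\<close>

definition proj_graph :: "('v::complex_vector \<Rightarrow> 'c::complex_vector) \<Rightarrow> ('v set \<times> 'c set) set"
  where "proj_graph F = {(line x, line (F x)) | x. F x \<noteq> 0}"

lemma rational_graph_eq:
  "rational_graph r F = proj_graph (\<lambda>x i. if i < r then F i x else 0)"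
proof -
  have "(\<exists>i<r. F i x \<noteq> 0) \<longleftrightarrow> (\<lambda>i. if i < r then F i x else 0) \<noteq> 0" for x
    by (auto simp: fun_eq_iff)
  then show ?thesis by (simp add: rational_graph_def proj_graph_def)
qed

text \<open>Bihomogeneity makes vanishing independent of representatives, so membership in the
  closure can be tested on vectors instead of lines.\<close>

lemma closure_graph_iff:
  "(line x, line y) \<in> zariski_closure (proj_graph F) \<longleftrightarrow> line x \<in> proj UNIV \<and> line y \<in> proj UNIV \<and>
    (\<forall>d e. \<forall>h\<in>bihpoly d e. (\<forall>z. F z \<noteq> 0 \<longrightarrow> h z (F z) = 0) \<longrightarrow> h x y = 0)"
proof -
  have "(\<forall>s\<in>proj_graph F. vanishes_at h s) \<longleftrightarrow> (\<forall>z. F z \<noteq> 0 \<longrightarrow> h z (F z) = 0)"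
    if "h \<in> bihpoly d e" for h d e
    using vanishes_at_line[OF that] by (fastforce simp: proj_graph_def)
  then show ?thesis by (simp add: zariski_closure_def vanishes_at_line)
qed

lemma closure_graph_vanish:
  assumes "(line x, line y) \<in> zariski_closure (proj_graph F)" "h \<in> bihpoly d e"
    and "\<And>z. F z \<noteq> 0 \<Longrightarrow> h z (F z) = 0"
  shows "h x y = 0"
  using assms by (auto simp: closure_graph_iff)

lemma closure_graph_E:
  assumes "z \<in> zariski_closure S"
  obtains x y where "z = (line x, line y)" "x \<noteq> 0" "y \<noteq> 0"
  using assms by (auto simp: zariski_closure_def proj_def)

text \<open>\<open>P k\<close> and \<open>R k\<close> are linear in the second argument and turn
  each tuple into the other up to a power of the coordinate \<open>l k\<close>; where that
  coordinate is nonzero, no line is changed by the power. By \<open>l_expand\<close> the coordinates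
  have no common zero except the origin, so these charts cover the projective space.\<close>

locale graph_transition =
  fixes l :: "nat \<Rightarrow> 'v::complex_vector \<Rightarrow> complex" and n :: nat and b :: "nat \<Rightarrow> 'v"
    and F :: "'v \<Rightarrow> 'i \<Rightarrow> complex" and G :: "'v \<Rightarrow> 'j \<Rightarrow> complex"
    and P :: "nat \<Rightarrow> 'v \<Rightarrow> ('i \<Rightarrow> complex) \<Rightarrow> 'j \<Rightarrow> complex"
    and R :: "nat \<Rightarrow> 'v \<Rightarrow> ('j \<Rightarrow> complex) \<Rightarrow> 'i \<Rightarrow> complex"
    and d e :: nat
  assumes l_linear: "\<And>k. k < n \<Longrightarrow> clinear (l k)"
    and l_expand: "\<And>x. x = (\<Sum>k<n. l k x *\<^sub>C b k)"
    and P: "\<And>k. k < n \<Longrightarrow> P k \<in> bihpoly_vec e (Suc 0)"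
    and R: "\<And>k. k < n \<Longrightarrow> R k \<in> bihpoly_vec d (Suc 0)"
    and PF: "\<And>k x. k < n \<Longrightarrow> P k x (F x) = (l k x ^ d) *\<^sub>C G x"
    and RG: "\<And>k x. k < n \<Longrightarrow> R k x (G x) = (l k x ^ e) *\<^sub>C F x"
begin

lemma l_nonzero:
  assumes "x \<noteq> 0" obtains k where "k < n" "l k x \<noteq> 0"
proof -
  have "\<exists>k<n. l k x \<noteq> 0"
  proof (rule ccontr)
    assume "\<not> (\<exists>k<n. l k x \<noteq> 0)"
    then have "(\<Sum>k<n. l k x *\<^sub>C b k) = 0" by (intro sum.neutral) simp
    then show False using assms l_expand[of x] by simp
  qed
  then show thesis using that by blast
qed

lemma P_scale: "k < n \<Longrightarrow> P k (a *\<^sub>C x) (c *\<^sub>C y) = (a ^ e * c) *\<^sub>C P k x y"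
  using bihpoly_vec_homogeneous[OF P, of k a x c y] by simp

lemma R_scale: "k < n \<Longrightarrow> R k (a *\<^sub>C x) (c *\<^sub>C y) = (a ^ d * c) *\<^sub>C R k x y"
  using bihpoly_vec_homogeneous[OF R, of k a x c y] by simp

lemma clinear_component: "clinear (\<lambda>y :: 'k \<Rightarrow> complex. y i)"
  by (rule clinearI) simp_all

text \<open>On the graph, \<open>P k\<close> contributes the factor \<open>l k x ^ d\<close> and
  \<open>R k\<close> the factor \<open>l k x ^ e\<close>. Both sides have bidegree (d + e, 1), so
  the equality passes to the closure.\<close>

lemma R_P:
  assumes z: "(line x, line y) \<in> zariski_closure (proj_graph F)" and k: "k < n"
  shows "R k x (P k x y) = (l k x ^ (d + e)) *\<^sub>C y"
proof
  fix i
  let ?h = "\<lambda>x y. R k x (P k x y) i - l k x ^ (d + e) * y i"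
  have "(\<lambda>x y. R k x y i) \<in> bihpoly d 1"
    using bihpoly_vec_functional[OF R[OF k] clinear_component[of i]] by simp
  then have "(\<lambda>x y. R k x (P k x y) i) \<in> bihpoly (d + 1 * e) (1 * Suc 0)"
    by (rule bihpoly_comp[OF _ P[OF k]])
  moreover have "(\<lambda>x y. l k x ^ (d + e) * y i) \<in> bihpoly (d + e) (Suc 0)"
    using hpoly_power[OF hpoly_linear[OF l_linear[OF k]], of "d + e"]
    by (intro bihpoly_linear clinear_component) simp
  ultimately have h: "?h \<in> bihpoly (d + e) (Suc 0)"
    using bihpoly_diff by simp
  have "?h x (F x) = 0" for x
    using R_scale[OF k, of 1 x "l k x ^ d" "G x"]
    by (simp add: PF[OF k] RG[OF k] scaleC_one power_add)
  then have "?h x y = 0" by (rule closure_graph_vanish[OF z h])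
  then show "R k x (P k x y) i = ((l k x ^ (d + e)) *\<^sub>C y) i" by simp
qed

text \<open>On the graph both sides are \<open>l k x ^ d * l m x ^ d\<close> times
  \<open>G x\<close>. Hence the charts define the same line wherever both coordinates are
  nonzero.\<close>

lemma P_independent:
  assumes z: "(line x, line y) \<in> zariski_closure (proj_graph F)" and k: "k < n" "m < n"
  shows "(l m x ^ d) *\<^sub>C P k x y = (l k x ^ d) *\<^sub>C P m x y"
proof
  fix i
  let ?h = "\<lambda>x y. l m x ^ d * P k x y i - l k x ^ d * P m x y i"
  have *: "(\<lambda>x y. l m x ^ d * P k x y i) \<in> bihpoly (d + e) (0 + Suc 0)" if "k < n" "m < n" for k m
    using that
    by (intro bihpoly_mult bihpoly_vec_functional[OF P clinear_component[of i]]
        bihpoly_power_left hpoly_linear l_linear)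
  have h: "?h \<in> bihpoly (d + e) (0 + Suc 0)"
    using bihpoly_diff[OF *[OF k] *[OF k(2) k(1)]] .
  have "?h x (F x) = 0" for x using k by (simp add: PF)
  then have "?h x y = 0" by (rule closure_graph_vanish[OF z h])
  then show "((l m x ^ d) *\<^sub>C P k x y) i = ((l k x ^ d) *\<^sub>C P m x y) i" by simp
qed

lemma P_nonzero:
  assumes "(line x, line y) \<in> zariski_closure (proj_graph F)" "k < n" "l k x \<noteq> 0" "y \<noteq> 0"
  shows "P k x y \<noteq> 0"
proof
  assume "P k x y = 0"
  then have "R k x (P k x y) = 0" using R_scale[OF assms(2), of 1 x 0 0] by simp
  then show False using R_P[OF assms(1,2)] assms(3,4) by simp
qed

lemma P_closure:
  assumes z: "(line x, line y) \<in> zariski_closure (proj_graph F)"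
    and k: "k < n" "l k x \<noteq> 0" and y: "y \<noteq> 0"
  shows "(line x, line (P k x y)) \<in> zariski_closure (proj_graph G)"
  unfolding closure_graph_iff
proof (intro conjI allI ballI impI)
  show "line x \<in> proj UNIV" using z by (simp add: closure_graph_iff)
  show "line (P k x y) \<in> proj UNIV" by (intro line_mem_proj P_nonzero assms UNIV_I)
  fix m q h
  assume h: "h \<in> bihpoly m q" and 0: "\<forall>z. G z \<noteq> 0 \<longrightarrow> h z (G z) = 0"
  txt \<open>The factor \<open>l k\<close> takes care of the points where \<open>F\<close> does not vanish but \<open>G\<close> does.\<close>
  let ?h = "\<lambda>x y. l k x * h x (P k x y)"
  have "?h \<in> bihpoly (Suc 0 + (m + q * e)) (0 + q * Suc 0)"
    by (intro bihpoly_mult bihpoly_left hpoly_linear l_linear k bihpoly_comp[OF h] P)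
  moreover have "?h x (F x) = 0" if "F x \<noteq> 0" for x
  proof (cases "G x = 0 \<and> l k x \<noteq> 0")
    case True
    then have "F x = 0"
      using RG[OF k(1), of x] R_scale[OF k(1), of 1 x 0 0] by simp
    then show ?thesis using that by simp
  next
    case False
    then show ?thesis
      using bihpoly_homogeneous[OF h, of 1 x "l k x ^ d" "G x"] 0
      by (auto simp: PF[OF k(1)] scaleC_one)
  qed
  ultimately have "?h x y = 0" by (rule closure_graph_vanish[OF z])
  then show "h x (P k x y) = 0" using k by simp
qed

text \<open>Representatives and charts are picked arbitrarily; \<open>transition_eq\<close> shows
  that the resulting point does not depend on the choices.\<close>

definition rep :: "'a::complex_vector set \<Rightarrow> 'a"
  where "rep m = (SOME x. x \<in> m - {0})"

definition idx :: "'v \<Rightarrow> nat"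
  where "idx x = (SOME k. k < n \<and> l k x \<noteq> 0)"

definition transition :: "'v set \<times> ('i \<Rightarrow> complex) set \<Rightarrow> 'v set \<times> ('j \<Rightarrow> complex) set"
  where "transition z = (fst z, line (P (idx (rep (fst z))) (rep (fst z)) (rep (snd z))))"

lemma rep_line: "x \<noteq> 0 \<Longrightarrow> rep (line x) \<in> line x - {0}"
  unfolding rep_def by (rule someI_ex) (use self_mem_line[of x] in blast)

lemma transition_eq:
  assumes z: "(line x, line y) \<in> zariski_closure (proj_graph F)" "x \<noteq> 0" "y \<noteq> 0"
    and k: "k < n" "l k x \<noteq> 0"
  shows "transition (line x, line y) = (line x, line (P k x y))"
proof -
  obtain a c where a: "rep (line x) = a *\<^sub>C x" "rep (line y) = c *\<^sub>C y"
    using rep_line[OF z(2)] rep_line[OF z(3)] by (auto simp: mem_line)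
  have ac: "a \<noteq> 0" "c \<noteq> 0" using a rep_line[OF z(2)] rep_line[OF z(3)] by auto
  define j where "j = idx (a *\<^sub>C x)"
  have j: "j < n" "l j (a *\<^sub>C x) \<noteq> 0"
    using l_nonzero[of "a *\<^sub>C x"] someI_ex[of "\<lambda>k. k < n \<and> l k (a *\<^sub>C x) \<noteq> 0"] z(2) ac(1)
    unfolding j_def idx_def by auto
  have "l j x \<noteq> 0" using j clinear_scale[OF l_linear[OF j(1)], of a x] by auto
  have "line (P j (a *\<^sub>C x) (c *\<^sub>C y)) = line (P j x y)"
    using ac by (simp add: P_scale[OF j(1)] line_scale)
  also have "\<dots> = line ((l k x ^ d) *\<^sub>C P j x y)" using k by (simp add: line_scale)
  also have "\<dots> = line (P k x y)"
    using \<open>l j x \<noteq> 0\<close> by (simp add: P_independent[OF z(1) j(1) k(1)] line_scale)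
  finally show ?thesis by (simp add: transition_def a j_def[symmetric])
qed

lemma regular_transition:
  "regular_map (zariski_closure (proj_graph F)) transition"
  unfolding regular_map_def regular_to_proj_def
proof (intro conjI ballI)
  fix z assume z: "z \<in> zariski_closure (proj_graph F)"
  let ?X = "zariski_closure (proj_graph F)"
  from closure_graph_E[OF z] obtain x y where xy: "z = (line x, line y)" "x \<noteq> 0" "y \<noteq> 0" .
  \<comment> \<open>The first component of the map is the identity. Expanding a vector in the
    coordinates \<open>l k\<close> shows that this is a polynomial map of bidegree (1, 0), valid
    everywhere with h = 1.\<close>
  have 1: "(\<lambda>x (y :: 'i \<Rightarrow> complex). \<Sum>k<n. l k x *\<^sub>C b k) \<in> bihpoly_vec (Suc 0) 0"
    by (intro bihpoly_vec_sum bihpoly_vec_scale bihpoly_left hpoly_linear l_linear) simp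
  have eq: "(\<lambda>x (y :: 'i \<Rightarrow> complex). \<Sum>k<n. l k x *\<^sub>C b k) = (\<lambda>x y. x)"
    by (intro ext l_expand[symmetric])
  have "(\<lambda>(x :: 'v) (y :: 'i \<Rightarrow> complex). x) \<in> bihpoly_vec (Suc 0) 0"
    using 1 unfolding eq .
  moreover have "\<forall>k m. (k, m) \<in> ?X \<longrightarrow>
    (\<forall>x\<in>k - {0}. \<forall>y\<in>m - {0}. x \<noteq> 0 \<and> (fst \<circ> transition) (k, m) = line x)"
  proof (intro allI impI ballI)
    fix s m x y assume sm: "(s, m) \<in> ?X" "x \<in> s - {0}"
    from closure_graph_E[OF sm(1)] obtain x' y' where "(s, m) = (line x', line y')" .
    then show "x \<noteq> 0 \<and> (fst \<circ> transition) (s, m) = line x"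
      using line_eqI[of x x'] sm(2) by (simp add: transition_def)
  qed
  moreover have "\<not> vanishes_at (\<lambda>x y. 1) z"
    using vanishes_at_line[OF bihpoly_const[of 1]] xy(1) by simp
  ultimately have "\<exists>h\<in>bihpoly 0 0. \<exists>Q\<in>bihpoly_vec (Suc 0) 0.
    \<not> vanishes_at h z \<and> (\<forall>k m. (k, m) \<in> ?X \<and> \<not> vanishes_at h (k, m) \<longrightarrow>
      (\<forall>x\<in>k - {0}. \<forall>y\<in>m - {0}. Q x y \<noteq> 0 \<and> (fst \<circ> transition) (k, m) = line (Q x y)))"
    by (intro bexI[of _ "\<lambda>(x :: 'v) (y :: 'i \<Rightarrow> complex). 1"]
        bexI[of _ "\<lambda>(x :: 'v) (y :: 'i \<Rightarrow> complex). x"] bihpoly_const) auto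
  then show "\<exists>d e d' e'. \<exists>h\<in>bihpoly d e. \<exists>Q\<in>bihpoly_vec d' e'.
    \<not> vanishes_at h z \<and> (\<forall>k m. (k, m) \<in> ?X \<and> \<not> vanishes_at h (k, m) \<longrightarrow>
      (\<forall>x\<in>k - {0}. \<forall>y\<in>m - {0}. Q x y \<noteq> 0 \<and> (fst \<circ> transition) (k, m) = line (Q x y)))"
    by (intro exI)
  \<comment> \<open>For the second component the neighbourhood of z is the chart of a coordinate
    that is nonzero at z.\<close>
  from l_nonzero[OF xy(2)] obtain k where k: "k < n" "l k x \<noteq> 0" .
  have lk: "(\<lambda>x (y :: 'i \<Rightarrow> complex). l k x) \<in> bihpoly (Suc 0) 0"
    by (intro bihpoly_left hpoly_linear l_linear k)
  have "\<forall>s m. (s, m) \<in> ?X \<and> \<not> vanishes_at (\<lambda>x y. l k x) (s, m) \<longrightarrow>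
      (\<forall>x\<in>s - {0}. \<forall>y\<in>m - {0}. P k x y \<noteq> 0 \<and> (snd \<circ> transition) (s, m) = line (P k x y))"
  proof (intro allI impI ballI)
    fix s m x y
    assume sm: "(s, m) \<in> ?X \<and> \<not> vanishes_at (\<lambda>x y. l k x) (s, m)" "x \<in> s - {0}" "y \<in> m - {0}"
    from closure_graph_E[OF conjunct1[OF sm(1)]] obtain x' y' where "(s, m) = (line x', line y')" .
    then have s: "s = line x" "m = line y" using line_eqI[of x x'] line_eqI[of y y'] sm(2,3) by simp_all
    with sm(1) have lx: "l k x \<noteq> 0" using vanishes_at_line[OF lk] by blast
    show "P k x y \<noteq> 0 \<and> (snd \<circ> transition) (s, m) = line (P k x y)"
      using sm s lx k(1) P_nonzero[of x y k] transition_eq[of x y k] by simp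
  qed
  moreover have "\<not> vanishes_at (\<lambda>x y. l k x) z"
    using k vanishes_at_line[OF lk] xy(1) by blast
  ultimately have "\<exists>h\<in>bihpoly (Suc 0) 0. \<exists>Q\<in>bihpoly_vec e (Suc 0).
    \<not> vanishes_at h z \<and> (\<forall>k m. (k, m) \<in> ?X \<and> \<not> vanishes_at h (k, m) \<longrightarrow>
      (\<forall>x\<in>k - {0}. \<forall>y\<in>m - {0}. Q x y \<noteq> 0 \<and> (snd \<circ> transition) (k, m) = line (Q x y)))"
    by (intro bexI[OF _ lk] bexI[OF _ P[OF k(1)]] conjI)
  then show "\<exists>d e d' e'. \<exists>h\<in>bihpoly d e. \<exists>Q\<in>bihpoly_vec d' e'.
    \<not> vanishes_at h z \<and> (\<forall>k m. (k, m) \<in> ?X \<and> \<not> vanishes_at h (k, m) \<longrightarrow>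
      (\<forall>x\<in>k - {0}. \<forall>y\<in>m - {0}. Q x y \<noteq> 0 \<and> (snd \<circ> transition) (k, m) = line (Q x y)))"
    by (intro exI)
qed

end

lemma regular_map_cong:
  assumes "\<And>z. z \<in> X \<Longrightarrow> f z = g z" "regular_map X f"
  shows "regular_map X g"
  using assms unfolding regular_map_def regular_to_proj_def comp_def by simp

context graph_transition
begin

text \<open>The axioms are symmetric under exchanging \<open>F\<close>, \<open>P\<close>,
  \<open>d\<close> with \<open>G\<close>, \<open>R\<close>, \<open>e\<close>, so the inverse map and
  its regularity come from the same lemmas.\<close>

sublocale inverse: graph_transition l n b G F R P e d
  by (rule graph_transition.intro) (fact l_linear l_expand P R PF RG)+

lemma transition_mem:
  assumes "z \<in> zariski_closure (proj_graph F)"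
  shows "transition z \<in> zariski_closure (proj_graph G)"
    and "inverse.transition (transition z) = z"
proof -
  from closure_graph_E[OF assms] obtain x y where xy: "z = (line x, line y)" "x \<noteq> 0" "y \<noteq> 0" .
  from l_nonzero[OF xy(2)] obtain k where k: "k < n" "l k x \<noteq> 0" .
  have z: "(line x, line y) \<in> zariski_closure (proj_graph F)" using assms xy by simp
  note t = transition_eq[OF z xy(2,3) k] and c = P_closure[OF z k xy(3)]
  show "transition z \<in> zariski_closure (proj_graph G)" using t c xy by simp
  show "inverse.transition (transition z) = z"
    using inverse.transition_eq[OF c xy(2) P_nonzero[OF z k xy(3)] k] R_P[OF z k(1)]
    by (simp add: t xy line_scale k)
qed

end

lemma (in graph_transition) variety_iso_transition:
  "variety_iso (zariski_closure (proj_graph F)) (zariski_closure (proj_graph G)) transition"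
proof -
  let ?X = "zariski_closure (proj_graph F)" and ?Y = "zariski_closure (proj_graph G)"
  have bij: "bij_betw transition ?X ?Y"
    by (rule bij_betw_byWitness[where f' = inverse.transition])
      (use transition_mem inverse.transition_mem in auto)
  have "inv_into ?X transition w = inverse.transition w" if "w \<in> ?Y" for w
    by (rule inv_into_f_eq[OF bij_betw_imp_inj_on[OF bij]])
      (use that inverse.transition_mem in auto)
  then have "regular_map ?Y (inv_into ?X transition)"
    by (intro regular_map_cong[OF _ inverse.regular_transition]) simp
  then show ?thesis using bij regular_transition by (simp add: variety_iso_def)
qed

section \<open>The ideal of the surface of squares\<close>

definition poly_fun :: "(complex \<Rightarrow> complex) \<Rightarrow> bool"
  where "poly_fun f \<longleftrightarrow> (\<exists>P. \<forall>t. f t = poly P t)"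

lemma poly_fun_add: "poly_fun f \<Longrightarrow> poly_fun g \<Longrightarrow> poly_fun (\<lambda>t. f t + g t)"
  unfolding poly_fun_def by (metis poly_add)

lemma poly_fun_mult: "poly_fun f \<Longrightarrow> poly_fun g \<Longrightarrow> poly_fun (\<lambda>t. f t * g t)"
  unfolding poly_fun_def by (metis poly_mult)

lemma poly_fun_const: "poly_fun (\<lambda>t. c)"
  unfolding poly_fun_def by (rule exI[of _ "[:c:]"]) simp

lemma poly_fun_power: "poly_fun (\<lambda>t. t ^ n)"
  unfolding poly_fun_def by (rule exI[of _ "monom 1 n"]) (simp add: poly_monom)

lemma poly_fun_zero:
  assumes "poly_fun f" "finite S" "\<And>t. t \<notin> S \<Longrightarrow> f t = 0"
  shows "f t = 0"
proof -
  obtain P where P: "\<And>t. f t = poly P t" using assms(1) by (auto simp: poly_fun_def)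
  have "P = 0"
  proof (rule ccontr)
    assume "P \<noteq> 0"
    then have "finite {t. poly P t = 0}" by (rule poly_roots_finite)
    moreover have "UNIV = S \<union> {t. poly P t = 0}" using assms(3) P by auto
    ultimately have "finite (UNIV :: complex set)" using assms(2) by (metis finite_UnI)
    then show False using infinite_UNIV_char_0 by blast
  qed
  then show ?thesis using P by simp
qed

text \<open>Being polynomial in each variable separately suffices, because the density arguments
  below vary one variable at a time.\<close>

definition poly_fun3 :: "(complex \<Rightarrow> complex \<Rightarrow> complex \<Rightarrow> complex) \<Rightarrow> bool"
  where "poly_fun3 p \<longleftrightarrow> (\<forall>y z. poly_fun (\<lambda>x. p x y z)) \<and> (\<forall>x z. poly_fun (\<lambda>y. p x y z)) \<and>
    (\<forall>x y. poly_fun (\<lambda>z. p x y z))"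

section \<open>Coordinates, monomials and the seven cubics\<close>

locale coordinates5 =
  fixes X :: "nat \<Rightarrow> 'v::complex_vector \<Rightarrow> complex" and b :: "nat \<Rightarrow> 'v"
  assumes X_linear: "\<And>i. i < 5 \<Longrightarrow> clinear (X i)"
    and X_b: "\<And>i j. i < 5 \<Longrightarrow> j < 5 \<Longrightarrow> X i (b j) = (if i = j then 1 else 0)"
    and X_expand: "\<And>x. x = (\<Sum>k<5. X k x *\<^sub>C b k)"
begin

lemma eqI: "(\<And>i. i < 5 \<Longrightarrow> X i x = X i y) \<Longrightarrow> x = y"
  using X_expand[of x] X_expand[of y] by simp

lemma X_vec:
  assumes "i < 5" shows "X i (\<Sum>k<5. c k *\<^sub>C b k) = c i"
  using assms by (simp add: clinear_sum[OF X_linear] clinear_scale[OF X_linear] X_b if_distrib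
      cong: if_cong)

definition pt :: "complex \<Rightarrow> complex \<Rightarrow> complex \<Rightarrow> complex \<Rightarrow> complex \<Rightarrow> 'v"
  where "pt x0 x1 x2 x3 x4 = (\<Sum>k<5. ([x0, x1, x2, x3, x4] ! k) *\<^sub>C b k)"

lemma X_pt [simp]:
  "X 0 (pt x0 x1 x2 x3 x4) = x0" "X (Suc 0) (pt x0 x1 x2 x3 x4) = x1" "X 1 (pt x0 x1 x2 x3 x4) = x1"
  "X 2 (pt x0 x1 x2 x3 x4) = x2" "X 3 (pt x0 x1 x2 x3 x4) = x3" "X 4 (pt x0 x1 x2 x3 x4) = x4"
  by (simp_all add: pt_def X_vec)

definition monomial :: "nat \<Rightarrow> nat \<Rightarrow> nat \<Rightarrow> nat \<Rightarrow> nat \<Rightarrow> 'v \<Rightarrow> complex"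
  where "monomial i0 i1 i2 i3 i4 =
    (\<lambda>x. X 0 x ^ i0 * X 1 x ^ i1 * X 2 x ^ i2 * X 3 x ^ i3 * X 4 x ^ i4)"

definition monomials :: "nat \<Rightarrow> ('v \<Rightarrow> complex) set"
  where "monomials d = {monomial i0 i1 i2 i3 i4 | i0 i1 i2 i3 i4. i0 + i1 + i2 + i3 + i4 = d}"

lemma X_power: "i < 5 \<Longrightarrow> (\<lambda>x. X i x ^ n) \<in> hpoly n"
  using hpoly_power[OF hpoly_linear[OF X_linear], of i n] by simp

lemma monomial_hpoly: "monomial i0 i1 i2 i3 i4 \<in> hpoly (i0 + i1 + i2 + i3 + i4)"
  unfolding monomial_def by (intro hpoly_mult X_power) simp_all

lemma X_mult_monomials:
  assumes "k < 5" "m \<in> monomials d"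
  shows "(\<lambda>x. X k x * m x) \<in> monomials (Suc d)"
proof -
  obtain i0 i1 i2 i3 i4 where m: "m = monomial i0 i1 i2 i3 i4" "i0 + i1 + i2 + i3 + i4 = d"
    using assms(2) by (auto simp: monomials_def)
  from assms(1) consider "k = 0" | "k = 1" | "k = 2" | "k = 3" | "k = 4" by linarith
  then show ?thesis
  proof cases
    case 1 then have "(\<lambda>x. X k x * m x) = monomial (Suc i0) i1 i2 i3 i4"
      by (simp add: m monomial_def mult_ac)
    with m show ?thesis unfolding monomials_def by force
  next
    case 2 then have "(\<lambda>x. X k x * m x) = monomial i0 (Suc i1) i2 i3 i4"
      by (simp add: m monomial_def mult_ac)
    with m show ?thesis unfolding monomials_def by force
  next
    case 3 then have "(\<lambda>x. X k x * m x) = monomial i0 i1 (Suc i2) i3 i4"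
      by (simp add: m monomial_def mult_ac)
    with m show ?thesis unfolding monomials_def by force
  next
    case 4 then have "(\<lambda>x. X k x * m x) = monomial i0 i1 i2 (Suc i3) i4"
      by (simp add: m monomial_def mult_ac)
    with m show ?thesis unfolding monomials_def by force
  next
    case 5 then have "(\<lambda>x. X k x * m x) = monomial i0 i1 i2 i3 (Suc i4)"
      by (simp add: m monomial_def mult_ac)
    with m show ?thesis unfolding monomials_def by force
  qed
qed

lemma clinear_span_X:
  assumes "clinear \<phi>" shows "\<phi> \<in> cspan {X k | k. k < 5}"
proof -
  have "\<phi> x = (\<Sum>k<5. \<phi> (b k) *\<^sub>C X k) x" for x
    using arg_cong[OF X_expand[of x], of \<phi>]
    by (simp add: clinear_sum[OF assms] clinear_scale[OF assms] sum_apply mult_ac)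
  then have "\<phi> = (\<Sum>k<5. \<phi> (b k) *\<^sub>C X k)" by blast
  moreover have "(\<Sum>k<5. \<phi> (b k) *\<^sub>C X k) \<in> cspan {X k | k. k < 5}"
    by (intro complex_vector.span_sum complex_vector.span_scale complex_vector.span_base) auto
  ultimately show ?thesis by simp
qed

lemma hpoly_span_monomials: "p \<in> hpoly d \<Longrightarrow> p \<in> cspan (monomials d)"
proof (induction d arbitrary: p)
  case 0
  have "monomial 0 0 0 0 0 = (\<lambda>x. 1)" by (simp add: monomial_def)
  then have "(\<lambda>x. 1) \<in> monomials 0" unfolding monomials_def by force
  then have "{\<lambda>x. \<Prod>\<phi>\<leftarrow>\<phi>s. \<phi> x |\<phi>s. length \<phi>s = 0 \<and> (\<forall>\<phi>\<in>set \<phi>s. clinear \<phi>)} \<subseteq> monomials 0"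
    by auto
  then show ?case using 0 complex_vector.span_mono unfolding hpoly_def by blast
next
  case (Suc d)
  show ?case
    using hpoly_Suc[OF Suc.prems]
  proof (rule span_subspace_mem, safe)
    fix \<phi> q :: "'v \<Rightarrow> complex" assume "clinear \<phi>" "q \<in> hpoly d"
    moreover have "clinear (\<lambda>f x. f x * g x)" "clinear (\<lambda>f x. g x * f x)" for g :: "'v \<Rightarrow> complex"
      by (auto simp: clinear_iff fun_eq_iff algebra_simps)
    moreover have "(\<lambda>x. s x * t x) \<in> cspan (monomials (Suc d))"
      if "s \<in> {X k | k. k < 5}" "t \<in> monomials d" for s t
      using that by (auto intro!: complex_vector.span_base X_mult_monomials)
    ultimately show "(\<lambda>x. \<phi> x * q x) \<in> cspan (monomials (Suc d))"
      using bilinear_span_image[OF _ _ _ clinear_span_X[of \<phi>] Suc.IH[of q], of "\<lambda>s t x. s x * t x"]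
      by blast
  qed
qed

text \<open>The coefficients of the sextic covariant of a binary quartic; equivalently, up to a factor, the
  independent ones among the \<open>3 \<times> 3\<close> minors of the matrix of the linear forms \<open>a(x, -)\<close>, where \<open>a\<close>
  runs through a basis of \<open>A\<close>.\<close>

definition cubic :: "nat \<Rightarrow> 'v \<Rightarrow> complex"
  where "cubic j x = (let x0 = X 0 x; x1 = X 1 x; x2 = X 2 x; x3 = X 3 x; x4 = X 4 x in
    [x1 ^ 3 - x0 * x1 * x2 + 2 * x0\<^sup>2 * x3,
     x1\<^sup>2 * x2 - x0 * x2\<^sup>2 + 2 * x0 * x1 * x3 + 4 * x0\<^sup>2 * x4,
     x1\<^sup>2 * x3 - x0 * x2 * x3 + 2 * x0 * x1 * x4,
     x1\<^sup>2 * x4 - x0 * x3\<^sup>2,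
     x1 * x2 * x4 - x1 * x3\<^sup>2 - 2 * x0 * x3 * x4,
     x2\<^sup>2 * x4 - x2 * x3\<^sup>2 - 2 * x1 * x3 * x4 - 4 * x0 * x4\<^sup>2,
     x2 * x3 * x4 - x3 ^ 3 - 2 * x1 * x4\<^sup>2] ! j)"

lemma cubic_simps:
  "cubic 0 x = X 1 x ^ 3 - X 0 x * X 1 x * X 2 x + 2 * (X 0 x)\<^sup>2 * X 3 x"
  "cubic 1 x = (X 1 x)\<^sup>2 * X 2 x - X 0 x * (X 2 x)\<^sup>2 + 2 * X 0 x * X 1 x * X 3 x + 4 * (X 0 x)\<^sup>2 * X 4 x"
  "cubic 2 x = (X 1 x)\<^sup>2 * X 3 x - X 0 x * X 2 x * X 3 x + 2 * X 0 x * X 1 x * X 4 x"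
  "cubic 3 x = (X 1 x)\<^sup>2 * X 4 x - X 0 x * (X 3 x)\<^sup>2"
  "cubic 4 x = X 1 x * X 2 x * X 4 x - X 1 x * (X 3 x)\<^sup>2 - 2 * X 0 x * X 3 x * X 4 x"
  "cubic 5 x = (X 2 x)\<^sup>2 * X 4 x - X 2 x * (X 3 x)\<^sup>2 - 2 * X 1 x * X 3 x * X 4 x - 4 * X 0 x * (X 4 x)\<^sup>2"
  "cubic 6 x = X 2 x * X 3 x * X 4 x - X 3 x ^ 3 - 2 * X 1 x * (X 4 x)\<^sup>2"
  by (simp_all add: cubic_def Let_def)

lemma less7: "j < 7 \<longleftrightarrow> j = 0 \<or> j = 1 \<or> j = 2 \<or> j = 3 \<or> j = 4 \<or> j = 5 \<or> j = (6::nat)"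
  by linarith

lemma cubic_hpoly:
  assumes "j < 7" shows "cubic j \<in> hpoly 3"
proof -
  have m: "monomial i0 i1 i2 i3 i4 \<in> hpoly 3" if "i0 + i1 + i2 + i3 + i4 = 3" for i0 i1 i2 i3 i4
    using monomial_hpoly[of i0 i1 i2 i3 i4] that by simp
  have eqs: "cubic 0 = (\<lambda>x. monomial 0 3 0 0 0 x + ((-1) * monomial 1 1 1 0 0 x + 2 * monomial 2 0 0 1 0 x))"
    "cubic 1 = (\<lambda>x. monomial 0 2 1 0 0 x + ((-1) * monomial 1 0 2 0 0 x +
      (2 * monomial 1 1 0 1 0 x + 4 * monomial 2 0 0 0 1 x)))"
    "cubic 2 = (\<lambda>x. monomial 0 2 0 1 0 x + ((-1) * monomial 1 0 1 1 0 x + 2 * monomial 1 1 0 0 1 x))"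
    "cubic 3 = (\<lambda>x. monomial 0 2 0 0 1 x + (-1) * monomial 1 0 0 2 0 x)"
    "cubic 4 = (\<lambda>x. monomial 0 1 1 0 1 x + ((-1) * monomial 0 1 0 2 0 x + (-2) * monomial 1 0 0 1 1 x))"
    "cubic 5 = (\<lambda>x. monomial 0 0 2 0 1 x + ((-1) * monomial 0 0 1 2 0 x +
      ((-2) * monomial 0 1 0 1 1 x + (-4) * monomial 1 0 0 0 2 x)))"
    "cubic 6 = (\<lambda>x. monomial 0 0 1 1 1 x + ((-1) * monomial 0 0 0 3 0 x + (-2) * monomial 0 1 0 0 2 x))"
    by (simp_all add: fun_eq_iff cubic_simps monomial_def del: One_nat_def)
  have "cubic 0 \<in> hpoly 3" "cubic 1 \<in> hpoly 3" "cubic 2 \<in> hpoly 3" "cubic 3 \<in> hpoly 3"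
    "cubic 4 \<in> hpoly 3" "cubic 5 \<in> hpoly 3" "cubic 6 \<in> hpoly 3"
    unfolding eqs by (intro hpoly_add hpoly_scale m; simp)+
  then show ?thesis using assms unfolding less7 by blast
qed

section \<open>Normal forms modulo the cubics\<close>

definition cubic_ideal :: "nat \<Rightarrow> ('v \<Rightarrow> complex) set"
  where "cubic_ideal e = cspan {\<lambda>x. q x * cubic i x | q i. q \<in> hpoly e \<and> i < 7}"

text \<open>Over \<open>\<complex>[x\<^sub>0, x\<^sub>2, x\<^sub>4]\<close> the coordinate ring of the surface is spanned by \<open>1\<close>, \<open>x\<^sub>1\<close>, \<open>x\<^sub>3\<close> and the
  products of \<open>x\<^sub>1\<close> and \<open>x\<^sub>3\<close>; the three Koszul relations between the latter restrict the monomials with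
  \<open>x\<^sub>1\<^sup>2\<close> and \<open>x\<^sub>3\<^sup>2\<close>.\<close>

definition normal_monomials :: "('v \<Rightarrow> complex) set"
  where "normal_monomials = {monomial i0 i1 i2 i3 i4 | i0 i1 i2 i3 i4.
    i1 \<le> 1 \<and> i3 \<le> 1 \<or> i1 = 2 \<and> i2 = 0 \<and> i3 = 0 \<and> i4 = 0 \<or> i1 = 0 \<and> i2 = 0 \<and> i3 = 2}"

text \<open>The normal monomials carry no degree bound: the later comparison on the surface uses
  only their shape.\<close>

definition reducible :: "nat \<Rightarrow> ('v \<Rightarrow> complex) set"
  where "reducible e = cspan (normal_monomials \<union>
    {\<lambda>x. q x * cubic i x | q i. q \<in> hpoly e \<and> i < 7})"

lemma reducible_normal:
  assumes "i1 \<le> 1 \<and> i3 \<le> 1 \<or> i1 = 2 \<and> i2 = 0 \<and> i3 = 0 \<and> i4 = 0 \<or> i1 = 0 \<and> i2 = 0 \<and> i3 = 2"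
  shows "monomial i0 i1 i2 i3 i4 \<in> reducible e"
  unfolding reducible_def normal_monomials_def
  by (intro complex_vector.span_base UnI1) (use assms in blast)

text \<open>A rewriting rule leaves at most three monomials; rules with fewer fill the empty places
  with the zero function.\<close>

lemma reducible_step:
  assumes "i < 7" "j0 + j1 + j2 + j3 + j4 = e"
    and "p \<in> reducible e" "q \<in> reducible e" "r \<in> reducible e"
    and "\<And>x. m x = \<alpha> * p x + \<beta> * q x + \<gamma> * r x + \<delta> * (monomial j0 j1 j2 j3 j4 x * cubic i x)"
  shows "m \<in> reducible e"
proof -
  have "(\<lambda>x. monomial j0 j1 j2 j3 j4 x * cubic i x) \<in> reducible e"
    unfolding reducible_def
    by (intro complex_vector.span_base UnI2) (use assms(1,2) monomial_hpoly in blast)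
  then have "(\<lambda>x. \<alpha> * p x + \<beta> * q x + \<gamma> * r x + \<delta> * (monomial j0 j1 j2 j3 j4 x * cubic i x)) \<in> reducible e"
    using assms(3-5) unfolding reducible_def
    by (intro subspace_fun_add subspace_fun_scale) simp_all
  moreover have "m = (\<lambda>x. \<alpha> * p x + \<beta> * q x + \<gamma> * r x + \<delta> * (monomial j0 j1 j2 j3 j4 x * cubic i x))"
    using assms(6) by blast
  ultimately show ?thesis by simp
qed

lemma reducible_zero: "(\<lambda>x. 0) \<in> reducible e"
proof -
  have "(0 :: 'v \<Rightarrow> complex) \<in> reducible e"
    unfolding reducible_def by (rule complex_vector.span_zero)
  then show ?thesis by (simp add: zero_fun_def)
qed

text \<open>Cubics 0, 2, 4, 6, 5, 3, 1 solved for one of their terms: in this order x1^3, x1^2 x3,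
  x1 x3^2, x3^3, x2 x3^2, x1^2 x4 and x1^2 x2. The summands \<open>0 * 0\<close> match the three
  places of \<open>reducible_step\<close>.\<close>

lemma monomial_reduce:
  "monomial i0 (j + 3) i2 i3 i4 x = 1 * monomial (i0 + 1) (j + 1) (i2 + 1) i3 i4 x +
    (-2) * monomial (i0 + 2) j i2 (i3 + 1) i4 x + 0 * 0 + 1 * (monomial i0 j i2 i3 i4 x * cubic 0 x)"
  "monomial i0 (j + 2) i2 (k + 1) i4 x = 1 * monomial (i0 + 1) j (i2 + 1) (k + 1) i4 x +
    (-2) * monomial (i0 + 1) (j + 1) i2 k (i4 + 1) x + 0 * 0 + 1 * (monomial i0 j i2 k i4 x * cubic 2 x)"
  "monomial i0 (j + 1) i2 (k + 2) i4 x = 1 * monomial i0 (j + 1) (i2 + 1) k (i4 + 1) x +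
    (-2) * monomial (i0 + 1) j i2 (k + 1) (i4 + 1) x + 0 * 0 + (-1) * (monomial i0 j i2 k i4 x * cubic 4 x)"
  "monomial i0 i1 i2 (k + 3) i4 x = 1 * monomial i0 i1 (i2 + 1) (k + 1) (i4 + 1) x +
    (-2) * monomial i0 (i1 + 1) i2 k (i4 + 2) x + 0 * 0 + (-1) * (monomial i0 i1 i2 k i4 x * cubic 6 x)"
  "monomial i0 0 (j + 1) 2 i4 x = 1 * monomial i0 0 (j + 2) 0 (i4 + 1) x +
    (-2) * monomial i0 1 j 1 (i4 + 1) x + (-4) * monomial (i0 + 1) 0 j 0 (i4 + 2) x +
    (-1) * (monomial i0 0 j 0 i4 x * cubic 5 x)"
  "monomial i0 2 i2 0 (k + 1) x = 1 * monomial (i0 + 1) 0 i2 2 k x + 0 * 0 + 0 * 0 +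
    1 * (monomial i0 0 i2 0 k x * cubic 3 x)"
  "monomial i0 2 (k + 1) 0 i4 x = 1 * monomial (i0 + 1) 0 (k + 2) 0 i4 x +
    (-2) * monomial (i0 + 1) 1 k 1 i4 x + (-4) * monomial (i0 + 2) 0 k 0 (i4 + 1) x +
    1 * (monomial i0 0 k 0 i4 x * cubic 1 x)"
  unfolding monomial_def cubic_simps power_add power_one_right power_0
  by algebra+

text \<open>The rules from cubics 0, 2, 4 and 6 lower the joint exponent of x1 and x3 by two, which
  drives the induction. Those from cubics 1 and 5 can keep it at two, but their outputs are already
  normal.\<close>

lemma reducible_monomial:
  "i0 + i1 + i2 + i3 + i4 = 3 + e \<Longrightarrow> monomial i0 i1 i2 i3 i4 \<in> reducible e"
proof (induction "i1 + i3" arbitrary: i0 i1 i2 i3 i4 rule: less_induct)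
  case less
  note d = less.prems
  have IH: "monomial k0 k1 k2 k3 k4 \<in> reducible e"
    if "k1 + k3 < i1 + i3" "k0 + k1 + k2 + k3 + k4 = 3 + e" for k0 k1 k2 k3 k4
    using less.hyps that by blast
  \<comment> \<open>The rule from cubic 3 replaces x1^2 x4 by x0 x3^2, of the same joint exponent,
    so the induction hypothesis does not reach its output; that output is settled here.\<close>
  have case02: "monomial k0 0 k2 2 k4 \<in> reducible e" if k: "k0 + k2 + 2 + k4 = 3 + e" for k0 k2 k4
  proof (cases k2)
    case 0 then show ?thesis by (intro reducible_normal) simp
  next
    case (Suc j)
    have "monomial k0 0 (j + 1) 2 k4 \<in> reducible e"
      by (rule reducible_step[OF _ _ reducible_normal reducible_normal reducible_normal
            monomial_reduce(5)]) (use k Suc in simp_all)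
    then show ?thesis using Suc by simp
  qed
  consider "i1 \<ge> 3" | "i1 \<ge> 2" "i3 \<ge> 1" | "i1 \<ge> 1" "i3 \<ge> 2" | "i3 \<ge> 3" | "i1 \<le> 1" "i3 \<le> 1"
    | "i1 = 0" "i3 = 2" | "i1 = 2" "i3 = 0" "i4 = 0" "i2 = 0" | "i1 = 2" "i3 = 0" "i4 \<ge> 1"
    | "i1 = 2" "i3 = 0" "i2 \<ge> 1"
    by linarith
  then show ?case
  proof cases
    case 1
    obtain j where *: "i1 = j + 3"
      using 1 by (metis le_add_diff_inverse2)
    show ?thesis unfolding *
      by (rule reducible_step[OF _ _ IH IH reducible_zero monomial_reduce(1)]) (use d * in simp_all)
  next
    case 2
    obtain j k where *: "i1 = j + 2" "i3 = k + 1"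
      using 2 by (metis le_add_diff_inverse2)
    show ?thesis unfolding *
      by (rule reducible_step[OF _ _ IH IH reducible_zero monomial_reduce(2)]) (use d * in simp_all)
  next
    case 3
    obtain j k where *: "i1 = j + 1" "i3 = k + 2"
      using 3 by (metis le_add_diff_inverse2)
    show ?thesis unfolding *
      by (rule reducible_step[OF _ _ IH IH reducible_zero monomial_reduce(3)]) (use d * in simp_all)
  next
    case 4
    obtain k where *: "i3 = k + 3"
      using 4 by (metis le_add_diff_inverse2)
    show ?thesis unfolding *
      by (rule reducible_step[OF _ _ IH IH reducible_zero monomial_reduce(4)]) (use d * in simp_all)
  next
    case 5 then show ?thesis by (intro reducible_normal) simp
  next
    case 6 then show ?thesis using case02 d by simp
  next
    case 7 then show ?thesis by (intro reducible_normal) simp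
  next
    case 8
    obtain k where *: "i4 = k + 1"
      using 8 by (metis le_add_diff_inverse2)
    show ?thesis unfolding * 8(1,2)
      by (rule reducible_step[OF _ _ case02 reducible_zero reducible_zero monomial_reduce(6)])
        (use d * 8(1,2) in simp_all)
  next
    case 9
    obtain k where *: "i2 = k + 1"
      using 9 by (metis le_add_diff_inverse2)
    show ?thesis unfolding * 9(1,2)
      by (rule reducible_step[OF _ _ reducible_normal reducible_normal reducible_normal
            monomial_reduce(7)]) (use d * 9(1,2) in simp_all)
  qed
qed

lemma hpoly_reducible:
  assumes "p \<in> hpoly (3 + e)"
  obtains N q where "N \<in> cspan normal_monomials" "q \<in> cubic_ideal e" "\<And>x. p x = N x + q x"
proof -
  have "monomials (3 + e) \<subseteq> reducible e"
    using reducible_monomial by (auto simp: monomials_def)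
  then have "p \<in> reducible e"
    using hpoly_span_monomials[OF assms] span_subspace_mem[of p "monomials (3 + e)" "reducible e"]
    by (simp add: reducible_def)
  then show thesis
    using that unfolding reducible_def complex_vector.span_Un cubic_ideal_def by auto
qed

text \<open>The square of \<open>\<alpha> X\<^sup>2 + \<beta> X Y + \<gamma> Y\<^sup>2\<close>, in coordinates where the coefficients of \<open>X\<^sup>3 Y\<close> and \<open>X Y\<^sup>3\<close> are
  \<open>2 x\<^sub>1\<close> and \<open>2 x\<^sub>3\<close>.\<close>

definition square :: "complex \<Rightarrow> complex \<Rightarrow> complex \<Rightarrow> 'v"
  where "square \<alpha> \<beta> \<gamma> = pt (\<alpha>\<^sup>2) (\<alpha> * \<beta>) (\<beta>\<^sup>2 + 2 * \<alpha> * \<gamma>) (\<beta> * \<gamma>) (\<gamma>\<^sup>2)"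

lemma X_square [simp]:
  "X 0 (square \<alpha> \<beta> \<gamma>) = \<alpha>\<^sup>2" "X (Suc 0) (square \<alpha> \<beta> \<gamma>) = \<alpha> * \<beta>" "X 1 (square \<alpha> \<beta> \<gamma>) = \<alpha> * \<beta>"
  "X 2 (square \<alpha> \<beta> \<gamma>) = \<beta>\<^sup>2 + 2 * \<alpha> * \<gamma>" "X 3 (square \<alpha> \<beta> \<gamma>) = \<beta> * \<gamma>" "X 4 (square \<alpha> \<beta> \<gamma>) = \<gamma>\<^sup>2"
  by (simp_all add: square_def)

lemma cubic_square: "j < 7 \<Longrightarrow> cubic j (square \<alpha> \<beta> \<gamma>) = 0"
  unfolding less7
  by (auto simp: cubic_simps[unfolded One_nat_def] cubic_simps power2_eq_square power3_eq_cube algebra_simps)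

section \<open>Uniqueness of normal forms on the surface\<close>

definition normal_weight :: "nat \<Rightarrow> complex \<Rightarrow> complex \<Rightarrow> complex"
  where "normal_weight k x1 x3 = [1, x1, x3, x1 * x3, x1\<^sup>2, x3\<^sup>2] ! k"

text \<open>\<open>p k\<close> is a coefficient function in x0, x2, x4. The two equations record the
  restrictions on normal monomials: the coefficient of x1^2 depends on x0 only, that of x3^2 on x0
  and x4 only.\<close>

definition normal_rep :: "(nat \<Rightarrow> complex \<Rightarrow> complex \<Rightarrow> complex \<Rightarrow> complex) \<Rightarrow> ('v \<Rightarrow> complex) \<Rightarrow> bool"
  where "normal_rep p N \<longleftrightarrow> (\<forall>k. poly_fun3 (p k)) \<and>
    (\<forall>x y z. p 4 x y z = p 4 x 0 0) \<and> (\<forall>x y z. p 5 x y z = p 5 x 0 z) \<and>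
    (\<forall>v. N v = (\<Sum>k<6. p k (X 0 v) (X 2 v) (X 4 v) * normal_weight k (X 1 v) (X 3 v)))"

lemma normal_repD:
  assumes "normal_rep p N"
  shows "poly_fun3 (p k)" "p 4 x y z = p 4 x 0 0" "p 5 x y z = p 5 x 0 z"
    "N v = (\<Sum>k<6. p k (X 0 v) (X 2 v) (X 4 v) * normal_weight k (X 1 v) (X 3 v))"
  using assms by (simp_all only: normal_rep_def)

lemma normal_form:
  assumes "N \<in> cspan normal_monomials"
  shows "\<exists>p. normal_rep p N"
  using assms
proof (induction rule: complex_vector.span_induct_alt)
  case base
  show ?case by (rule exI[of _ "\<lambda>k x y z. 0"]) (simp add: normal_rep_def poly_fun3_def poly_fun_const)
next
  case (step c m q)
  obtain u where u: "normal_rep u q" using step.IH by blast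
  obtain i0 i1 i2 i3 i4 where m: "m = monomial i0 i1 i2 i3 i4"
    and i: "i1 \<le> 1 \<and> i3 \<le> 1 \<or> i1 = 2 \<and> i2 = 0 \<and> i3 = 0 \<and> i4 = 0 \<or> i1 = 0 \<and> i2 = 0 \<and> i3 = 2"
    using step.hyps by (auto simp: normal_monomials_def)
  define w where "w = (\<lambda>x y z::complex. x ^ i0 * y ^ i2 * z ^ i4)"
  have w: "poly_fun3 w"
    unfolding poly_fun3_def w_def by (intro conjI allI poly_fun_mult poly_fun_power poly_fun_const)
  obtain k where k: "k < 6" "\<And>x y. x ^ i1 * y ^ i3 = normal_weight k x y"
    "k = 4 \<Longrightarrow> i2 = 0 \<and> i4 = 0" "k = 5 \<Longrightarrow> i2 = 0"
  proof -
    from i consider "i1 = 0" "i3 = 0" | "i1 = 1" "i3 = 0" | "i1 = 0" "i3 = 1" | "i1 = 1" "i3 = 1"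
      | "i1 = 2" "i2 = 0" "i3 = 0" "i4 = 0" | "i1 = 0" "i2 = 0" "i3 = 2" by linarith
    then show thesis
    proof cases
      case 1 then show ?thesis by (intro that[of 0]) (simp_all add: normal_weight_def)
    next
      case 2 then show ?thesis by (intro that[of 1]) (simp_all add: normal_weight_def)
    next
      case 3 then show ?thesis by (intro that[of 2]) (simp_all add: normal_weight_def)
    next
      case 4 then show ?thesis by (intro that[of 3]) (simp_all add: normal_weight_def)
    next
      case 5 then show ?thesis by (intro that[of 4]) (simp_all add: normal_weight_def)
    next
      case 6 then show ?thesis by (intro that[of 5]) (simp_all add: normal_weight_def)
    qed
  qed
  define p where "p = (\<lambda>j x y z. (if j = k then c * w x y z else 0) + u j x y z)"
  have "m v = w (X 0 v) (X 2 v) (X 4 v) * normal_weight k (X 1 v) (X 3 v)" for v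
    using k(2)[of "X 1 v" "X 3 v", symmetric] by (simp add: m monomial_def w_def mult_ac)
  then have "(c *\<^sub>C m + q) v = (\<Sum>j<6. p j (X 0 v) (X 2 v) (X 4 v) * normal_weight j (X 1 v) (X 3 v))" for v
  proof -
    have "(\<Sum>j<6. p j (X 0 v) (X 2 v) (X 4 v) * normal_weight j (X 1 v) (X 3 v)) =
      (\<Sum>j<6. (if j = k then c * w (X 0 v) (X 2 v) (X 4 v) * normal_weight k (X 1 v) (X 3 v) else 0) +
        u j (X 0 v) (X 2 v) (X 4 v) * normal_weight j (X 1 v) (X 3 v))"
      by (rule sum.cong) (auto simp: p_def algebra_simps)
    also have "\<dots> = (\<Sum>j<6. if j = k then
      c * w (X 0 v) (X 2 v) (X 4 v) * normal_weight k (X 1 v) (X 3 v) else 0) + q v"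
      by (simp add: sum.distrib normal_repD(4)[OF u])
    finally have "(\<Sum>j<6. p j (X 0 v) (X 2 v) (X 4 v) * normal_weight j (X 1 v) (X 3 v)) = \<dots>" .
    then show ?thesis using k(1) \<open>m v = _\<close> by simp
  qed
  moreover have "poly_fun3 (p j)" for j
  proof (cases "j = k")
    case True
    then show ?thesis using normal_repD(1)[OF u] w unfolding poly_fun3_def p_def
      by (auto intro!: poly_fun_add poly_fun_mult poly_fun_const)
  next
    case False
    then show ?thesis using normal_repD(1)[OF u] by (simp add: p_def)
  qed
  moreover have "p 4 x y z = p 4 x 0 0" "p 5 x y z = p 5 x 0 z" for x y z
  proof -
    show "p 4 x y z = p 4 x 0 0" "p 5 x y z = p 5 x 0 z"
      using k(3,4) normal_repD(2)[OF u, of x y z] normal_repD(3)[OF u, of x y z]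
      by (simp_all add: p_def w_def)
  qed
  ultimately show ?case unfolding normal_rep_def by (intro exI[of _ p] conjI allI)
qed

text \<open>Modulo functions of x0, x2, x4, the products x1^2, x1 x3, x3^2 equal -2 x0, x2, -2 x4
  times \<alpha> \<gamma> on squares. So \<alpha> \<gamma>, the direction lost in the projection,
  occurs only multiplied by x0, x2 or x4; this is where the Koszul relations come from, and the
  restrictions on \<open>p 4\<close> and \<open>p 5\<close> remove exactly that ambiguity.\<close>

lemma normal_form_unique:
  assumes N: "N \<in> cspan normal_monomials" and van: "\<And>\<alpha> \<beta> \<gamma>. N (square \<alpha> \<beta> \<gamma>) = 0"
  shows "N v = 0"
proof -
  from normal_form[OF N] obtain p where rep: "normal_rep p N" ..
  note p = normal_repD(1)[OF rep] and p4 = normal_repD(2)[OF rep] and p5 = normal_repD(3)[OF rep]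
    and Np = normal_repD(4)[OF rep]
  have Ne: "N v = p 0 (X 0 v) (X 2 v) (X 4 v) + p 1 (X 0 v) (X 2 v) (X 4 v) * X 1 v +
      p 2 (X 0 v) (X 2 v) (X 4 v) * X 3 v + p 3 (X 0 v) (X 2 v) (X 4 v) * (X 1 v * X 3 v) +
      p 4 (X 0 v) (X 2 v) (X 4 v) * (X 1 v)\<^sup>2 + p 5 (X 0 v) (X 2 v) (X 4 v) * (X 3 v)\<^sup>2" for v
    unfolding Np by (simp add: normal_weight_def eval_nat_numeral)
  \<comment> \<open>On a square over (x, y, z) one has \<beta>^2 = y - 2 \<alpha> \<gamma>, hence
    x1^2 = x \<beta>^2, x3^2 = z \<beta>^2 and x1 x3 = \<alpha> \<gamma> \<beta>^2. After this
    substitution, with (\<alpha> \<gamma>)^2 = x z, \<open>E0\<close> collects the terms free of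
    \<alpha> \<gamma> and \<open>E1\<close> is the factor of \<alpha> \<gamma>; both come from the
    part of N that is even in \<beta>.\<close>
  define E0 where "E0 = (\<lambda>x y z. p 0 x y z - 2 * x * z * p 3 x y z + x * y * p 4 x y z + y * z * p 5 x y z)"
  define E1 where "E1 = (\<lambda>x y z. y * p 3 x y z - 2 * x * p 4 x y z - 2 * z * p 5 x y z)"
  have pm: "r = 0 \<and> t = 0" if "r + t = 0" "r - t = 0" for r t :: complex
    using that by (simp add: eq_neg_iff_add_eq_0[symmetric])
  have key: "E0 x y z = 0" "\<alpha> * \<gamma> * E1 x y z = 0"
    "y\<^sup>2 \<noteq> 4 * x * z \<Longrightarrow> \<alpha> * p 1 x y z = 0" "y\<^sup>2 \<noteq> 4 * x * z \<Longrightarrow> \<gamma> * p 2 x y z = 0"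
    if xz: "x = \<alpha>\<^sup>2" "z = \<gamma>\<^sup>2" for x y z \<alpha> \<gamma>
  proof -
    txt \<open>The deck transformations \<open>\<beta> \<mapsto> -\<beta>\<close> and \<open>\<gamma> \<mapsto> -\<gamma>\<close> separate the parts of \<open>N\<close>.\<close>
    have 1: "E0 x y z + \<alpha> * \<gamma> * E1 x y z = 0"
      "\<beta> * (\<alpha> * p 1 x y z + \<gamma> * p 2 x y z) = 0"
      if xz: "x = \<alpha>\<^sup>2" "z = \<gamma>\<^sup>2" and \<beta>: "\<beta>\<^sup>2 = y - 2 * \<alpha> * \<gamma>" for \<alpha> \<gamma> \<beta>
    proof -
      have *: "E0 x y z + \<alpha> * \<gamma> * E1 x y z + \<delta> * (\<alpha> * p 1 x y z + \<gamma> * p 2 x y z) = 0"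
        if "\<delta>\<^sup>2 = y - 2 * \<alpha> * \<gamma>" for \<delta>
      proof -
        have y: "y = \<delta>\<^sup>2 + 2 * \<alpha> * \<gamma>" using that by simp
        have "N (square \<alpha> \<delta> \<gamma>) = 0" by (rule van)
        then have "p 0 x y z + p 1 x y z * (\<alpha> * \<delta>) + p 2 x y z * (\<delta> * \<gamma>) +
            p 3 x y z * ((\<alpha> * \<delta>) * (\<delta> * \<gamma>)) + p 4 x y z * (\<alpha> * \<delta>)\<^sup>2 + p 5 x y z * (\<delta> * \<gamma>)\<^sup>2 = 0"
          unfolding Ne by (simp add: xz y)
        moreover have "E0 x y z + \<alpha> * \<gamma> * E1 x y z + \<delta> * (\<alpha> * p 1 x y z + \<gamma> * p 2 x y z) =
          p 0 x y z + p 1 x y z * (\<alpha> * \<delta>) + p 2 x y z * (\<delta> * \<gamma>) +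
            p 3 x y z * (\<alpha> * \<gamma> * (y - 2 * \<alpha> * \<gamma>)) + p 4 x y z * (\<alpha>\<^sup>2 * (y - 2 * \<alpha> * \<gamma>))
            + p 5 x y z * (\<gamma>\<^sup>2 * (y - 2 * \<alpha> * \<gamma>))"
          unfolding E0_def E1_def by (simp add: xz algebra_simps power2_eq_square)
        ultimately show ?thesis
          unfolding that[symmetric] by (simp add: algebra_simps power2_eq_square)
      qed
      have "E0 x y z + \<alpha> * \<gamma> * E1 x y z - \<beta> * (\<alpha> * p 1 x y z + \<gamma> * p 2 x y z) = 0"
        using *[of "- \<beta>"] \<beta> by simp
      then show "E0 x y z + \<alpha> * \<gamma> * E1 x y z = 0" "\<beta> * (\<alpha> * p 1 x y z + \<gamma> * p 2 x y z) = 0"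
        using *[OF \<beta>] pm by blast+
    qed
    \<comment> \<open>Changing the sign of \<gamma> keeps x and z; a second root \<beta>' is needed
      to stay over the same y.\<close>
    obtain \<beta> \<beta>' where \<beta>: "\<beta>\<^sup>2 = y - 2 * \<alpha> * \<gamma>" "\<beta>'\<^sup>2 = y - 2 * \<alpha> * (- \<gamma>)"
      using power2_csqrt by blast
    have z': "z = (- \<gamma>)\<^sup>2" using xz by simp
    note a = 1[OF xz \<beta>(1)] and b = 1[OF xz(1) z' \<beta>(2)]
    show "E0 x y z = 0" "\<alpha> * \<gamma> * E1 x y z = 0"
      using pm[of "E0 x y z" "\<alpha> * \<gamma> * E1 x y z"] a(1) b(1) by simp_all
    assume y: "y\<^sup>2 \<noteq> 4 * x * z"
    \<comment> \<open>The product is (y - 2 \<alpha> \<gamma>) (y + 2 \<alpha> \<gamma>) = y^2 - 4 x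
      z, so both roots can be cancelled off the branch locus.\<close>
    have "\<beta>\<^sup>2 * \<beta>'\<^sup>2 \<noteq> 0"
      using y unfolding \<beta> xz by (simp add: power2_eq_square algebra_simps) 
    then have "\<alpha> * p 1 x y z + \<gamma> * p 2 x y z = 0" "\<alpha> * p 1 x y z - \<gamma> * p 2 x y z = 0"
      using a(2) b(2) by auto
    then show "\<alpha> * p 1 x y z = 0" "\<gamma> * p 2 x y z = 0" using pm by blast+
  qed
  have E0: "E0 x y z = 0" for x y z
    using key(1)[of x "csqrt x" z "csqrt z"] by simp
  have E1': "E1 x y z = 0" if "x \<noteq> 0" "z \<noteq> 0" for x y z
    using key(2)[of x "csqrt x" z "csqrt z"] that by simp
  have p12: "p 1 x y z = 0 \<and> p 2 x y z = 0" if "x \<noteq> 0" "z \<noteq> 0" "y\<^sup>2 \<noteq> 4 * x * z" for x y z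
    using key(3,4)[of x "csqrt x" z "csqrt z" y] that by simp
  \<comment> \<open>The excluded loci are removed one variable at a time: for fixed nonzero x and z
    only finitely many y are lost, then only x = 0, then only z = 0.\<close>
  have dense: "f x y z = 0"
    if f: "poly_fun3 f" and 0: "\<And>x y z. x \<noteq> 0 \<Longrightarrow> z \<noteq> 0 \<Longrightarrow> y\<^sup>2 \<noteq> 4 * x * z \<Longrightarrow> f x y z = 0" for f x y z
  proof -
    have fin: "finite {y. y\<^sup>2 = 4 * x * z}" for x z :: complex
    proof -
      have "{y. y\<^sup>2 = 4 * x * z} \<subseteq> {csqrt (4 * x * z), - csqrt (4 * x * z)}"
      proof
        fix y assume "y \<in> {y. y\<^sup>2 = 4 * x * z}"
        then have "y\<^sup>2 = (csqrt (4 * x * z))\<^sup>2" by simp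
        then show "y \<in> {csqrt (4 * x * z), - csqrt (4 * x * z)}"
          unfolding power2_eq_iff by blast
      qed
      then show ?thesis by (rule finite_subset) simp
    qed
    have 1: "f x y z = 0" if "x \<noteq> 0" "z \<noteq> 0" for x y z
      by (rule poly_fun_zero[of "\<lambda>y. f x y z", OF _ fin[of x z]])
        (use f 0 that in \<open>auto simp: poly_fun3_def\<close>)
    have 2: "f x y z = 0" if "z \<noteq> 0" for x y z
      by (rule poly_fun_zero[of "\<lambda>x. f x y z" "{0}"]) (use f 1 that in \<open>auto simp: poly_fun3_def\<close>)
    show ?thesis
      by (rule poly_fun_zero[of "\<lambda>z. f x y z" "{0}"]) (use f 2 in \<open>auto simp: poly_fun3_def\<close>)
  qed
  have p1: "p 1 x y z = 0" for x y z
    by (rule dense[OF p]) (rule conjunct1[OF p12])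
  have p2: "p 2 x y z = 0" for x y z
    by (rule dense[OF p]) (rule conjunct2[OF p12])
  have pf: "poly_fun (\<lambda>x. p k x y z)" "poly_fun (\<lambda>y. p k x y z)" "poly_fun (\<lambda>z. p k x y z)" for k x y z
    using p[of k] by (simp_all add: poly_fun3_def)
  have "poly_fun3 E1"
  proof -
    have id: "poly_fun (\<lambda>x. x)" using poly_fun_power[of 1] by simp
    have "E1 = (\<lambda>x y z. y * p 3 x y z + ((-2) * (x * p 4 x y z) + (-2) * (z * p 5 x y z)))"
      by (simp add: E1_def fun_eq_iff algebra_simps)
    then show ?thesis unfolding poly_fun3_def
      by (auto simp only: intro!: poly_fun_add poly_fun_mult poly_fun_const id pf)
  qed
  then have E1: "E1 x y z = 0" for x y z by (rule dense) (rule E1')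
  \<comment> \<open>At y = 0 the term with \<open>p 3\<close> disappears; the restrictions on
    \<open>p 4\<close> and \<open>p 5\<close> then make the remaining two separable, since z = 0
    isolates \<open>p 4\<close>.\<close>
  have 45: "x * p 4 x 0 0 + z * p 5 x 0 z = 0" for x z
  proof -
    have "- 2 * (x * p 4 x 0 z + z * p 5 x 0 z) = 0"
      using E1[of x 0 z] by (simp add: E1_def distrib_left)
    then show ?thesis using p4[of x 0 z] by algebra
  qed
  have "p 4 x 0 0 = 0" if "x \<noteq> 0" for x using 45[of x 0] that by simp
  then have "p 4 x 0 0 = 0" for x by - (rule poly_fun_zero[OF pf(1), of "{0}"], simp_all)
  then have p4: "p 4 x y z = 0" for x y z using p4[of x y z] by simp
  have "p 5 x 0 z = 0" for x z
    by (rule poly_fun_zero[OF pf(3), of "{0}"]) (use 45[of x] p4 in auto)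
  then have p5: "p 5 x y z = 0" for x y z using p5[of x y z] by simp
  have p3: "p 3 x y z = 0" for x y z
    by (rule poly_fun_zero[OF pf(2), of "{0}"]) (use E1[of x _ z] p4 p5 in \<open>auto simp: E1_def\<close>)
  have p0: "p 0 x y z = 0" for x y z
    using E0[of x y z] by (simp add: E0_def p3 p4 p5)
  show ?thesis by (simp add: Ne p0 p1 p2 p3 p4 p5 del: One_nat_def)
qed

definition squares :: "'v set set"
  where "squares = {line (square \<alpha> \<beta> \<gamma>) | \<alpha> \<beta> \<gamma>. \<alpha> \<noteq> 0 \<or> \<beta> \<noteq> 0 \<or> \<gamma> \<noteq> 0}"

lemma cubic_ideal_vanishes:
  assumes "q \<in> cubic_ideal e" shows "q (square \<alpha> \<beta> \<gamma>) = 0"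
  using assms unfolding cubic_ideal_def
  by (induction rule: complex_vector.span_induct_alt) (auto simp: cubic_square)

text \<open>Removing the part in the cubics leaves a normal form that still vanishes on all squares,
  hence is zero. This works in every degree from 3 on, not just in large ones.\<close>

theorem ideal_squares: "ideal_deg squares (3 + e) = cubic_ideal e"
proof
  show "ideal_deg squares (3 + e) \<subseteq> cubic_ideal e"
  proof
    fix p assume p: "p \<in> ideal_deg squares (3 + e)"
    then have hp: "p \<in> hpoly (3 + e)" by (simp add: ideal_deg_def)
    have van: "p (square \<alpha> \<beta> \<gamma>) = 0" for \<alpha> \<beta> \<gamma>
    proof (cases "\<alpha> \<noteq> 0 \<or> \<beta> \<noteq> 0 \<or> \<gamma> \<noteq> 0")
      case True
      then show ?thesis
        using p self_mem_line by (fastforce simp: ideal_deg_def squares_def)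
    next
      \<comment> \<open>The zero quadric gives no point of \<open>squares\<close>; there p vanishes
        because its degree is positive.\<close>
      case False
      then have "square \<alpha> \<beta> \<gamma> = 0"
        by (simp add: square_def pt_def eval_nat_numeral)
      then show ?thesis using hpoly_homogeneous[OF hp, of 0 0] by (simp add: power_add)
    qed
    obtain N q
      where Nq: "N \<in> cspan normal_monomials" "q \<in> cubic_ideal e" "\<And>x. p x = N x + q x"
      using hpoly_reducible[OF hp] by blast
    have "N (square \<alpha> \<beta> \<gamma>) = 0" for \<alpha> \<beta> \<gamma>
      using van[of \<alpha> \<beta> \<gamma>] Nq(3) cubic_ideal_vanishes[OF Nq(2)] by simp
    then have "p = q" using Nq normal_form_unique[OF Nq(1)] by (simp add: fun_eq_iff)
    then show "p \<in> cubic_ideal e" using Nq by simp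
  qed
  show "cubic_ideal e \<subseteq> ideal_deg squares (3 + e)"
  proof
    fix q assume q: "q \<in> cubic_ideal e"
    have "(\<lambda>x. r x * cubic i x) \<in> hpoly (3 + e)" if "r \<in> hpoly e" "i < 7" for r i
      using hpoly_mult[OF that(1) cubic_hpoly[OF that(2)]] by (simp add: add.commute)
    then have hq: "q \<in> hpoly (3 + e)"
      using span_subspace_mem[OF q[unfolded cubic_ideal_def], of "hpoly (3 + e)"] hpoly_subspace by blast
    moreover have "q x = 0" if "x \<in> line (square \<alpha> \<beta> \<gamma>)" for x \<alpha> \<beta> \<gamma>
      using that cubic_ideal_vanishes[OF q] by (auto simp: mem_line hpoly_homogeneous[OF hq])
    ultimately show "q \<in> ideal_deg squares (3 + e)"
      by (auto simp: ideal_deg_def squares_def)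
  qed
qed

end

section \<open>The incidence variety as the closure of a graph\<close>

declare One_nat_def [simp del]

lemma sum5: "(\<Sum>k<5. f k) = f 0 + f 1 + f 2 + f 3 + f (4::nat)"
  and sum7: "(\<Sum>k<7. f k) = f 0 + f 1 + f 2 + f 3 + f 4 + f 5 + f (6::nat)"
  for f :: "nat \<Rightarrow> 'a::comm_monoid_add"
  by (simp_all add: eval_nat_numeral One_nat_def)

lemma less5: "j < 5 \<longleftrightarrow> j = 0 \<or> j = 1 \<or> j = 2 \<or> j = 3 \<or> j = (4::nat)"
  by linarith

section \<open>Alternating forms, bivectors and planes\<close>

lemma alt_formsD:
  assumes "\<omega> \<in> alt_forms"
  shows "clinear (\<omega> x)" "clinear (\<lambda>x. \<omega> x y)" "\<omega> x x = 0" "\<omega> x y = - \<omega> y x"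
proof -
  show 1: "clinear (\<omega> x)" "clinear (\<lambda>x. \<omega> x y)" "\<omega> x x = 0" for x y
    using assms by (simp_all add: alt_forms_def)
  have "\<omega> (x + y) (x + y) = \<omega> x x + \<omega> y x + (\<omega> x y + \<omega> y y)"
    by (simp only: clinear_add[OF 1(1)] clinear_add[OF 1(2)])
  then have "\<omega> x y + \<omega> y x = 0"
    by (simp add: 1(3) add.commute)
  then show "\<omega> x y = - \<omega> y x" by (simp add: eq_neg_iff_add_eq_0)
qed

lemma wedge_apply: "\<omega> \<in> alt_forms \<Longrightarrow> wedge u v \<omega> = \<omega> u v"
  and wedge_apply_other: "\<omega> \<notin> alt_forms \<Longrightarrow> wedge u v \<omega> = 0"
  by (simp_all add: wedge_def)

lemma wedge_plane:
  "wedge (\<alpha> *\<^sub>C e + \<beta> *\<^sub>C f) (\<gamma> *\<^sub>C e + \<delta> *\<^sub>C f) = (\<alpha> * \<delta> - \<beta> * \<gamma>) *\<^sub>C wedge e f"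
proof
  fix \<omega> :: "'a \<Rightarrow> 'a \<Rightarrow> complex"
  show "wedge (\<alpha> *\<^sub>C e + \<beta> *\<^sub>C f) (\<gamma> *\<^sub>C e + \<delta> *\<^sub>C f) \<omega> = ((\<alpha> * \<delta> - \<beta> * \<gamma>) *\<^sub>C wedge e f) \<omega>"
  proof (cases "\<omega> \<in> alt_forms")
    case True
    note l = alt_formsD[OF True]
    show ?thesis
      using l(4)[of f e]
      by (simp add: wedge_apply[OF True] clinear_add[OF l(1)] clinear_add[OF l(2)]
          clinear_scale[OF l(1)] clinear_scale[OF l(2)] l(3) algebra_simps)
  qed (simp add: wedge_apply_other)
qed

lemma wedge_mem_bivectors: "wedge u v \<in> bivectors"
  unfolding bivectors_def by (intro complex_vector.span_base) blast

lemma bivectors_subspace: "csubspace bivectors"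
  by (simp add: bivectors_def)

lemma mem_span2: "x \<in> cspan {e, f} \<longleftrightarrow> (\<exists>\<alpha> \<beta>. x = \<alpha> *\<^sub>C e + \<beta> *\<^sub>C f)"
proof -
  have "x \<in> cspan {e, f} \<longleftrightarrow> (\<exists>k c. x - k *\<^sub>C e = c *\<^sub>C f)"
    by (simp add: complex_vector.span_insert complex_vector.span_singleton)
  also have "\<dots> \<longleftrightarrow> (\<exists>\<alpha> \<beta>. x = \<alpha> *\<^sub>C e + \<beta> *\<^sub>C f)"
    by (simp add: algebra_simps)
  finally show ?thesis .
qed

lemma plucker_span: "plucker (cspan {e, f}) = line (wedge e f)"
proof
  have "{wedge u v |u v. u \<in> cspan {e, f} \<and> v \<in> cspan {e, f}} \<subseteq> line (wedge e f)"
    by (auto simp: mem_span2 wedge_plane mem_line)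
  then show "plucker (cspan {e, f}) \<subseteq> line (wedge e f)"
    unfolding plucker_def line_def by (rule complex_vector.span_minimal) simp
  have "{wedge e f} \<subseteq> {wedge u v |u v. u \<in> cspan {e, f} \<and> v \<in> cspan {e, f}}"
    by (auto intro: complex_vector.span_base)
  then show "line (wedge e f) \<subseteq> plucker (cspan {e, f})"
    unfolding plucker_def line_def by (rule complex_vector.span_mono)
qed

lemma grass2E:
  assumes "U \<in> grass2" obtains e f where "U = cspan {e, f}"
proof -
  have U: "csubspace U" "cdim U = 2" using assms by (auto simp: grass2_def)
  obtain B where B: "B \<subseteq> U" "U \<subseteq> cspan B" "card B = cdim U"
    using complex_vector.basis_exists[of U] by metis
  obtain e f where "B = {e, f}" using B(3) U(2) by (auto simp: card_2_iff)
  moreover have "cspan B = U" using B(1,2) complex_vector.span_minimal[OF B(1) U(1)] by blast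
  ultimately show thesis using that by blast
qed

lemma wedge_self: "wedge x x = 0"
  by (simp add: wedge_def fun_eq_iff alt_formsD(3))

lemma span_mem_grass2:
  assumes "wedge x u \<noteq> 0" shows "cspan {x, u} \<in> grass2"
proof -
  have dep: "wedge x u = 0" if x: "x \<in> cspan {u}"
  proof -
    obtain k where "x = k *\<^sub>C u"
      using x unfolding complex_vector.span_singleton by blast
    then show ?thesis using wedge_plane[of k u 0 u 1 0] by (simp add: scaleC_one wedge_self)
  qed
  have "u \<noteq> 0"
  proof
    assume "u = 0"
    then show False using assms wedge_plane[of 1 x 0 x 0 0] by (simp add: scaleC_one)
  qed
  moreover have "x \<notin> cspan {u}" using dep assms by blast
  ultimately have "complex_vector.independent {x, u}" "x \<noteq> u"
    by (auto simp: complex_vector.independent_insert complex_vector.span_base)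
  then show ?thesis
    by (simp add: grass2_def complex_vector.dim_eq_card_independent)
qed

section \<open>The invariant forms and their annihilator in coordinates\<close>

context coordinates5
begin

text \<open>For i < j < 5 this is both a basis element of the alternating forms and the Pluecker
  coordinate of index (i, j) of x \<and> u.\<close>

definition pl :: "nat \<Rightarrow> nat \<Rightarrow> 'v \<Rightarrow> 'v \<Rightarrow> complex"
  where "pl i j x u = X i x * X j u - X j x * X i u"

lemma pl_alt: "i < 5 \<Longrightarrow> j < 5 \<Longrightarrow> pl i j \<in> alt_forms"
  using X_linear[of i] X_linear[of j]
  by (simp add: alt_forms_def pl_def clinear_iff algebra_simps)

lemma pl_swap: "pl j i = (\<lambda>x u. - pl i j x u)"
  by (simp add: pl_def fun_eq_iff)

lemma alt_form_expand:
  assumes "\<omega> \<in> alt_forms"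
  shows "\<omega> u v = pl 0 1 u v * \<omega> (b 0) (b 1) + pl 0 2 u v * \<omega> (b 0) (b 2) + pl 0 3 u v * \<omega> (b 0) (b 3) +
    pl 0 4 u v * \<omega> (b 0) (b 4) + pl 1 2 u v * \<omega> (b 1) (b 2) + pl 1 3 u v * \<omega> (b 1) (b 3) +
    pl 1 4 u v * \<omega> (b 1) (b 4) + pl 2 3 u v * \<omega> (b 2) (b 3) + pl 2 4 u v * \<omega> (b 2) (b 4) +
    pl 3 4 u v * \<omega> (b 3) (b 4)"
proof -
  note l = alt_formsD[OF assms]
  have "\<omega> u v = (\<Sum>i<5. \<Sum>j<5. X i u * X j v * \<omega> (b i) (b j))"
    unfolding arg_cong2[OF X_expand[of u] X_expand[of v], of \<omega>]
    by (simp add: clinear_sum[OF l(1)] clinear_sum[OF l(2)] clinear_scale[OF l(1)]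
        clinear_scale[OF l(2)] sum_distrib_left) (subst sum.swap, simp add: mult_ac)
  then show ?thesis
    using l(4)[of "b 1" "b 0"] l(4)[of "b 2" "b 0"] l(4)[of "b 3" "b 0"] l(4)[of "b 4" "b 0"]
      l(4)[of "b 2" "b 1"] l(4)[of "b 3" "b 1"] l(4)[of "b 4" "b 1"] l(4)[of "b 3" "b 2"]
      l(4)[of "b 4" "b 2"] l(4)[of "b 4" "b 3"]
    by (simp add: sum5 l(3) pl_def algebra_simps)
qed

text \<open>The three coefficients are those of the third transvectant \<open>S\<^sup>4 W \<times> S\<^sup>4 W \<rightarrow> S\<^sup>2 W\<close>.\<close>

definition form :: "complex \<Rightarrow> complex \<Rightarrow> complex \<Rightarrow> 'v \<Rightarrow> 'v \<Rightarrow> complex"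
  where "form p q r x u = p * (2 * pl 0 3 x u - pl 1 2 x u) + q * (2 * pl 0 4 x u - pl 1 3 x u) +
    r * (2 * pl 1 4 x u - pl 2 3 x u)"

definition forms :: "('v \<Rightarrow> 'v \<Rightarrow> complex) set"
  where "forms = {form p q r | p q r. True}"

lemma X_b_simps [simp]:
  "X 0 (b 0) = 1" "X 0 (b 1) = 0" "X 0 (b 2) = 0" "X 0 (b 3) = 0" "X 0 (b 4) = 0"
  "X 1 (b 0) = 0" "X 1 (b 1) = 1" "X 1 (b 2) = 0" "X 1 (b 3) = 0" "X 1 (b 4) = 0"
  "X 2 (b 0) = 0" "X 2 (b 1) = 0" "X 2 (b 2) = 1" "X 2 (b 3) = 0" "X 2 (b 4) = 0"
  "X 3 (b 0) = 0" "X 3 (b 1) = 0" "X 3 (b 2) = 0" "X 3 (b 3) = 1" "X 3 (b 4) = 0"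
  "X 4 (b 0) = 0" "X 4 (b 1) = 0" "X 4 (b 2) = 0" "X 4 (b 3) = 0" "X 4 (b 4) = 1"
  by (simp_all add: X_b)

lemma form_alt: "form p q r \<in> alt_forms"
proof -
  have "clinear (\<lambda>u. pl i j x u)" "clinear (\<lambda>x. pl i j x u)" if "i < 5" "j < 5" for i j x u
    using alt_formsD(1,2)[OF pl_alt[OF that]] by auto
  then show ?thesis
    unfolding alt_forms_def form_def
    by (auto simp: clinear_iff algebra_simps) (simp_all add: pl_def)
qed

lemma form_eq_0_iff: "form p q r = 0 \<longleftrightarrow> p = 0 \<and> q = 0 \<and> r = 0"
proof
  assume "form p q r = 0"
  then have "form p q r (b i) (b j) = 0" for i j by (simp add: fun_eq_iff)
  from this[of 0 3] this[of 0 4] this[of 1 4] show "p = 0 \<and> q = 0 \<and> r = 0"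
    by (simp add: form_def pl_def)
qed (simp add: form_def fun_eq_iff)

lemma X_lin:
  assumes "i < 5"
  shows "X i (x + y) = X i x + X i y" "X i (c *\<^sub>C x) = c * X i x" "X i 0 = 0"
  using clinear_add[OF X_linear[OF assms]] clinear_scale[OF X_linear[OF assms]]
    clinear_zero[OF X_linear[OF assms]] by auto

lemma coord_eqI:
  assumes "X 0 x = X 0 y" "X 1 x = X 1 y" "X 2 x = X 2 y" "X 3 x = X 3 y" "X 4 x = X 4 y"
  shows "x = y"
  by (rule eqI) (use assms in \<open>auto simp: less5\<close>)

text \<open>The reversed order and the sign of the coefficients reflect the invariant pairing of
  binary quadratic forms, which pairs X^2 with Y^2 and XY with itself with opposite sign. Testing
  against the basis vectors gives five linear equations for the kernel.\<close>

lemma form_kernel: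
  assumes "\<alpha> \<noteq> 0 \<or> \<beta> \<noteq> 0 \<or> \<gamma> \<noteq> 0"
  shows "{v. \<forall>w. form \<gamma> (- \<beta>) \<alpha> v w = 0} = line (square \<alpha> \<beta> \<gamma>)"
proof
  show "line (square \<alpha> \<beta> \<gamma>) \<subseteq> {v. \<forall>w. form \<gamma> (- \<beta>) \<alpha> v w = 0}"
    by (auto simp: mem_line form_def pl_def X_lin) algebra
  show "{v. \<forall>w. form \<gamma> (- \<beta>) \<alpha> v w = 0} \<subseteq> line (square \<alpha> \<beta> \<gamma>)"
  proof
    fix v assume "v \<in> {v. \<forall>w. form \<gamma> (- \<beta>) \<alpha> v w = 0}"
    then have "form \<gamma> (- \<beta>) \<alpha> v (b i) = 0" for i by blast
    from this[of 0] this[of 1] this[of 2] this[of 3] this[of 4]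
    have eqs: "\<alpha> * X 1 v = \<beta> * X 0 v" "\<gamma> * X 3 v = \<beta> * X 4 v"
      "\<alpha> * X 3 v = \<gamma> * X 1 v"
      "\<gamma> * X 2 v = \<beta> * X 3 v + 2 * \<alpha> * X 4 v"
      "\<alpha> * X 2 v = \<beta> * X 1 v + 2 * \<gamma> * X 0 v"
      unfolding form_def pl_def X_b_simps by algebra+
    \<comment> \<open>A nonzero outer coefficient of the quadric fixes the scalar through an outer
      coordinate of v; otherwise the quadric is a multiple of XY and only the middle coordinate
      survives.\<close>
    consider "\<alpha> \<noteq> 0" | "\<gamma> \<noteq> 0" | "\<alpha> = 0" "\<gamma> = 0" "\<beta> \<noteq> 0" using assms by blast
    then have "\<exists>c. v = c *\<^sub>C square \<alpha> \<beta> \<gamma>"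
    proof cases
      case 1
      then obtain c where c: "X 0 v = c * \<alpha>\<^sup>2"
        by (metis nonzero_eq_divide_eq power_not_zero)
      have "X 1 v = c * \<alpha> * \<beta>" using eqs(1) c 1 by algebra
      moreover from this have "X 3 v = c * \<beta> * \<gamma>" using eqs(3) 1 by algebra
      moreover from calculation have "X 2 v = c * (\<beta>\<^sup>2 + 2 * \<alpha> * \<gamma>)" using eqs(5) c 1 by algebra
      moreover from calculation have "X 4 v = c * \<gamma>\<^sup>2" using eqs(4) 1 by algebra
      ultimately show ?thesis using c
        by (intro exI[of _ c] coord_eqI) (simp_all add: X_lin)
    next
      case 2
      then obtain c where c: "X 4 v = c * \<gamma>\<^sup>2"
        by (metis nonzero_eq_divide_eq power_not_zero)
      have "X 3 v = c * \<beta> * \<gamma>" using eqs(2) c 2 by algebra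
      moreover from this have "X 1 v = c * \<alpha> * \<beta>" using eqs(3) 2 by algebra
      moreover from calculation have "X 2 v = c * (\<beta>\<^sup>2 + 2 * \<alpha> * \<gamma>)" using eqs(4) c 2 by algebra
      moreover from calculation have "X 0 v = c * \<alpha>\<^sup>2" using eqs(5) 2 by algebra
      ultimately show ?thesis using c
        by (intro exI[of _ c] coord_eqI) (simp_all add: X_lin)
    next
      case 3
      then show ?thesis using eqs
        by (intro exI[of _ "X 2 v / \<beta>\<^sup>2"] coord_eqI) (simp_all add: X_lin)
    qed
    then show "v \<in> line (square \<alpha> \<beta> \<gamma>)" by (simp add: mem_line)
  qed
qed

lemma ker_form_line: "ker_form (line \<omega>) = {v. \<forall>w. \<omega> v w = 0}"
proof -
  have "(\<forall>a\<in>line \<omega>. \<forall>w. a v w = 0) \<longleftrightarrow> (\<forall>w. \<omega> v w = 0)" for v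
    using self_mem_line[of \<omega>] by (auto simp: mem_line)
  then show ?thesis by (simp add: ker_form_def)
qed

lemma ker_forms: "ker_form ` proj forms = squares"
proof
  show "ker_form ` proj forms \<subseteq> squares"
  proof
    fix k assume "k \<in> ker_form ` proj forms"
    then obtain p q r where k: "k = ker_form (line (form p q r))" "form p q r \<noteq> 0"
      by (auto simp: proj_def forms_def)
    then have "r \<noteq> 0 \<or> - q \<noteq> 0 \<or> p \<noteq> 0" using form_eq_0_iff[of p q r] by auto
    from form_kernel[OF this] this show "k \<in> squares"
      unfolding k ker_form_line squares_def
      by (intro CollectI exI[of _ r] exI[of _ "- q"] exI[of _ p]) simp
  qed
  show "squares \<subseteq> ker_form ` proj forms"
  proof
    fix k assume "k \<in> squares"
    then obtain \<alpha> \<beta> \<gamma> where k: "k = line (square \<alpha> \<beta> \<gamma>)" "\<alpha> \<noteq> 0 \<or> \<beta> \<noteq> 0 \<or> \<gamma> \<noteq> 0"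
      by (auto simp: squares_def)
    have "form \<gamma> (- \<beta>) \<alpha> \<noteq> 0" using k(2) form_eq_0_iff by auto
    then have "line (form \<gamma> (- \<beta>) \<alpha>) \<in> proj forms"
      by (intro line_mem_proj) (auto simp: forms_def)
    then show "k \<in> ker_form ` proj forms"
      by (rule rev_image_eqI) (simp only: k(1) ker_form_line form_kernel[OF k(2)])
  qed
qed

text \<open>Dual to \<open>perp_coord\<close>. Annihilation by the forms means that the coordinates
  12, 13, 23 are twice the coordinates 03, 04, 14, which explains the coupled vectors and their
  factors 2.\<close>

definition perp_basis :: "nat \<Rightarrow> 'v bivec"
  where "perp_basis j = [wedge (b 0) (b 1), wedge (b 0) (b 2),
    wedge (b 0) (b 3) + 2 *\<^sub>C wedge (b 1) (b 2), wedge (b 0) (b 4) + 2 *\<^sub>C wedge (b 1) (b 3),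
    wedge (b 1) (b 4) + 2 *\<^sub>C wedge (b 2) (b 3), wedge (b 2) (b 4), wedge (b 3) (b 4)] ! j"

definition perp_coord :: "nat \<Rightarrow> 'v \<Rightarrow> 'v \<Rightarrow> complex"
  where "perp_coord j = [pl 0 1, pl 0 2, pl 0 3, pl 0 4, pl 1 4, pl 2 4, pl 3 4] ! j"

lemma perp_basis_bivector: "j < 7 \<Longrightarrow> perp_basis j \<in> bivectors"
  unfolding less7 perp_basis_def
  by (elim disjE) (simp_all add: complex_vector.subspace_add[OF bivectors_subspace]
      complex_vector.subspace_scale[OF bivectors_subspace] wedge_mem_bivectors)

text \<open>Reduces equality of bivectors to ten Pluecker coordinates. The case distinction is due
  to bivectors being functions on all maps of two arguments, with value 0 off the alternating
  forms.\<close>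

lemma bivector_expand:
  assumes "\<eta> \<in> bivectors"
  shows "\<eta> \<omega> = (if \<omega> \<in> alt_forms then \<eta> (pl 0 1) * \<omega> (b 0) (b 1) + \<eta> (pl 0 2) * \<omega> (b 0) (b 2) +
    \<eta> (pl 0 3) * \<omega> (b 0) (b 3) + \<eta> (pl 0 4) * \<omega> (b 0) (b 4) + \<eta> (pl 1 2) * \<omega> (b 1) (b 2) +
    \<eta> (pl 1 3) * \<omega> (b 1) (b 3) + \<eta> (pl 1 4) * \<omega> (b 1) (b 4) + \<eta> (pl 2 3) * \<omega> (b 2) (b 3) +
    \<eta> (pl 2 4) * \<omega> (b 2) (b 4) + \<eta> (pl 3 4) * \<omega> (b 3) (b 4) else 0)"
  using assms unfolding bivectors_def
proof (induction rule: complex_vector.span_induct_alt)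
  case (step c w \<eta>)
  then obtain u v where w: "w = wedge u v" by blast
  show ?case
    by (cases "\<omega> \<in> alt_forms")
      (use step.IH alt_form_expand[of \<omega> u v] in
        \<open>simp_all add: w wedge_apply pl_alt wedge_apply_other algebra_simps\<close>)
qed simp

lemma form_b:
  "form p q r (b 0) (b 1) = 0" "form p q r (b 0) (b 2) = 0" "form p q r (b 0) (b 3) = 2 * p"
  "form p q r (b 0) (b 4) = 2 * q" "form p q r (b 1) (b 2) = - p" "form p q r (b 1) (b 3) = - q"
  "form p q r (b 1) (b 4) = 2 * r" "form p q r (b 2) (b 3) = - r" "form p q r (b 2) (b 4) = 0"
  "form p q r (b 3) (b 4) = 0"
  by (simp_all add: form_def pl_def)

lemma perp_forms_iff:
  "\<eta> \<in> perp forms \<longleftrightarrow> \<eta> \<in> bivectors \<and> \<eta> (pl 1 2) = 2 * \<eta> (pl 0 3) \<and> \<eta> (pl 1 3) = 2 * \<eta> (pl 0 4) \<and>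
    \<eta> (pl 2 3) = 2 * \<eta> (pl 1 4)"
proof (cases "\<eta> \<in> bivectors")
  case True
  have eval: "\<eta> (form p q r) = p * (2 * \<eta> (pl 0 3) - \<eta> (pl 1 2)) + q * (2 * \<eta> (pl 0 4) - \<eta> (pl 1 3)) +
    r * (2 * \<eta> (pl 1 4) - \<eta> (pl 2 3))" for p q r
    unfolding bivector_expand[OF True, of "form p q r"]
    by (simp add: form_alt form_b algebra_simps)
  have "\<eta> \<in> perp forms \<longleftrightarrow> (\<forall>p q r. \<eta> (form p q r) = 0)"
    using True by (auto simp: perp_def forms_def)
  also have "\<dots> \<longleftrightarrow> \<eta> (pl 1 2) = 2 * \<eta> (pl 0 3) \<and> \<eta> (pl 1 3) = 2 * \<eta> (pl 0 4) \<and> \<eta> (pl 2 3) = 2 * \<eta> (pl 1 4)"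
  proof
    assume h: "\<forall>p q r. \<eta> (form p q r) = 0"
    show "\<eta> (pl 1 2) = 2 * \<eta> (pl 0 3) \<and> \<eta> (pl 1 3) = 2 * \<eta> (pl 0 4) \<and> \<eta> (pl 2 3) = 2 * \<eta> (pl 1 4)"
      using h[rule_format, of 1 0 0] h[rule_format, of 0 1 0] h[rule_format, of 0 0 1]
      by (simp add: eval)
  qed (simp add: eval)
  finally show ?thesis using True by simp
qed (simp add: perp_def)

lemma perp_expand:
  assumes "\<eta> \<in> perp forms"
  shows "\<eta> = (\<Sum>j<7. \<eta> (perp_coord j) *\<^sub>C perp_basis j)"
proof
  fix \<omega>
  have \<eta>: "\<eta> \<in> bivectors" using assms by (simp add: perp_def)
  show "\<eta> \<omega> = (\<Sum>j<7. \<eta> (perp_coord j) *\<^sub>C perp_basis j) \<omega>"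
    unfolding bivector_expand[OF \<eta>, of \<omega>] using assms
    by (simp add: perp_forms_iff sum7 perp_coord_def perp_basis_def wedge_apply wedge_apply_other
        algebra_simps)
qed

text \<open>Off the surface the equations a(x, u) = 0, for a in a basis of the forms, cut out a
  plane of vectors u. Its Pluecker coordinates are, up to signs and a common factor, the
  complementary 3 x 3 minors of the coefficient matrix; these are the coordinates of this
  bivector.\<close>

definition cubic_bivector :: "'v \<Rightarrow> 'v bivec"
  where "cubic_bivector x = (\<Sum>j<7. cubic j x *\<^sub>C perp_basis j)"

lemma perp_lincomb_coords:
  assumes "\<eta> = (\<Sum>j<7. c j *\<^sub>C perp_basis j)"
  shows "\<eta> (pl 0 1) = c 0" "\<eta> (pl 0 2) = c 1" "\<eta> (pl 0 3) = c 2" "\<eta> (pl 0 4) = c 3"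
    "\<eta> (pl 1 2) = 2 * c 2" "\<eta> (pl 1 3) = 2 * c 3" "\<eta> (pl 1 4) = c 4" "\<eta> (pl 2 3) = 2 * c 4"
    "\<eta> (pl 2 4) = c 5" "\<eta> (pl 3 4) = c 6"
  unfolding assms
  by (simp_all add: sum7 perp_basis_def wedge_apply pl_alt) (simp_all add: pl_def)

lemma perp_lincomb_mem: "(\<Sum>j<7. c j *\<^sub>C perp_basis j) \<in> perp forms"
  unfolding perp_forms_iff
proof (intro conjI)
  show "(\<Sum>j<7. c j *\<^sub>C perp_basis j) \<in> bivectors"
    using perp_basis_bivector unfolding bivectors_def
    by (intro complex_vector.span_sum complex_vector.span_scale) simp
qed (simp_all add: perp_lincomb_coords[OF refl])

lemma perp_lincomb_coord: "i < 7 \<Longrightarrow> (\<Sum>j<7. c j *\<^sub>C perp_basis j) (perp_coord i) = c i"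
  unfolding less7 by (elim disjE) (simp_all add: perp_coord_def perp_lincomb_coords[OF refl])

lemma cubic_bivector_nonzeroI: "j < 7 \<Longrightarrow> cubic j x \<noteq> 0 \<Longrightarrow> cubic_bivector x \<noteq> 0"
  using perp_lincomb_coord[of j "\<lambda>j. cubic j x"] by (auto simp: cubic_bivector_def)

text \<open>The hypotheses are the ten components of x \<and> h = 0, with the coordinates 12, 13, 23
  replaced by their doubles of 03, 04, 14. Each 2 x 2 minor of the pair (h, t) is a combination of
  these relations with coefficients polynomial in x, so no genericity of x is required.\<close>

lemma bivector_proportional:
  fixes x0 x1 x2 x3 x4 h0 h1 h2 h3 h4 h5 h6 :: complex
  assumes r012: "x0 * (2 * h2) - x1 * h1 + x2 * h0 = 0"
    and r013: "x0 * (2 * h3) - x1 * h2 + x3 * h0 = 0"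
    and r014: "x0 * h4 - x1 * h3 + x4 * h0 = 0"
    and r023: "x0 * (2 * h4) - x2 * h2 + x3 * h1 = 0"
    and r024: "x0 * h5 - x2 * h3 + x4 * h1 = 0"
    and r034: "x0 * h6 - x3 * h3 + x4 * h2 = 0"
    and r123: "x1 * (2 * h4) - x2 * (2 * h3) + x3 * (2 * h2) = 0"
    and r124: "x1 * h5 - x2 * h4 + x4 * (2 * h2) = 0"
    and r134: "x1 * h6 - x3 * h4 + x4 * (2 * h3) = 0"
    and r234: "x2 * h6 - x3 * h5 + x4 * (2 * h4) = 0"
  defines "h \<equiv> (!) [h0, h1, h2, h3, h4, h5, h6]"
    and "t \<equiv> (!) [x1 ^ 3 - x0 * x1 * x2 + 2 * x0\<^sup>2 * x3,
      x1\<^sup>2 * x2 - x0 * x2\<^sup>2 + 2 * x0 * x1 * x3 + 4 * x0\<^sup>2 * x4,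
      x1\<^sup>2 * x3 - x0 * x2 * x3 + 2 * x0 * x1 * x4,
      x1\<^sup>2 * x4 - x0 * x3\<^sup>2,
      x1 * x2 * x4 - x1 * x3\<^sup>2 - 2 * x0 * x3 * x4,
      x2\<^sup>2 * x4 - x2 * x3\<^sup>2 - 2 * x1 * x3 * x4 - 4 * x0 * x4\<^sup>2,
      x2 * x3 * x4 - x3 ^ 3 - 2 * x1 * x4\<^sup>2]"
  assumes "i < 7" "j < 7"
  shows "h i * t j = h j * t i"
proof -
  have e01: "h0 * (x1\<^sup>2 * x2 - x0 * x2\<^sup>2 + 2 * x0 * x1 * x3 + 4 * x0\<^sup>2 * x4) =
      h1 * (x1 ^ 3 - x0 * x1 * x2 + 2 * x0\<^sup>2 * x3)"
    using r012 r013 r014 r023 by algebra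
  have e02: "h0 * (x1\<^sup>2 * x3 - x0 * x2 * x3 + 2 * x0 * x1 * x4) =
      h2 * (x1 ^ 3 - x0 * x1 * x2 + 2 * x0\<^sup>2 * x3)"
    using r012 r013 r014 r023 by algebra
  have e03: "h0 * (x1\<^sup>2 * x4 - x0 * x3\<^sup>2) =
      h3 * (x1 ^ 3 - x0 * x1 * x2 + 2 * x0\<^sup>2 * x3)"
    using r012 r013 r014 r023 by algebra
  have e04: "h0 * (x1 * x2 * x4 - x1 * x3\<^sup>2 - 2 * x0 * x3 * x4) =
      h4 * (x1 ^ 3 - x0 * x1 * x2 + 2 * x0\<^sup>2 * x3)"
    using r013 r014 r123 by algebra
  have e05: "h0 * (x2\<^sup>2 * x4 - x2 * x3\<^sup>2 - 2 * x1 * x3 * x4 - 4 * x0 * x4\<^sup>2) =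
      h5 * (x1 ^ 3 - x0 * x1 * x2 + 2 * x0\<^sup>2 * x3)"
    using r012 r013 r014 r023 r024 r123 r124 by algebra
  have e06: "h0 * (x2 * x3 * x4 - x3 ^ 3 - 2 * x1 * x4\<^sup>2) =
      h6 * (x1 ^ 3 - x0 * x1 * x2 + 2 * x0\<^sup>2 * x3)"
    using r012 r013 r014 r023 r034 r123 r134 by algebra
  have e12: "h1 * (x1\<^sup>2 * x3 - x0 * x2 * x3 + 2 * x0 * x1 * x4) =
      h2 * (x1\<^sup>2 * x2 - x0 * x2\<^sup>2 + 2 * x0 * x1 * x3 + 4 * x0\<^sup>2 * x4)"
    using r012 r013 r014 r023 by algebra
  have e13: "h1 * (x1\<^sup>2 * x4 - x0 * x3\<^sup>2) =
      h3 * (x1\<^sup>2 * x2 - x0 * x2\<^sup>2 + 2 * x0 * x1 * x3 + 4 * x0\<^sup>2 * x4)"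
    using r012 r013 r014 r023 by algebra
  have e14: "h1 * (x1 * x2 * x4 - x1 * x3\<^sup>2 - 2 * x0 * x3 * x4) =
      h4 * (x1\<^sup>2 * x2 - x0 * x2\<^sup>2 + 2 * x0 * x1 * x3 + 4 * x0\<^sup>2 * x4)"
    using r012 r014 r023 r123 by algebra
  have e15: "h1 * (x2\<^sup>2 * x4 - x2 * x3\<^sup>2 - 2 * x1 * x3 * x4 - 4 * x0 * x4\<^sup>2) =
      h5 * (x1\<^sup>2 * x2 - x0 * x2\<^sup>2 + 2 * x0 * x1 * x3 + 4 * x0\<^sup>2 * x4)"
    using r013 r014 r023 r024 r123 r124 by algebra
  have e16: "h1 * (x2 * x3 * x4 - x3 ^ 3 - 2 * x1 * x4\<^sup>2) =
      h6 * (x1\<^sup>2 * x2 - x0 * x2\<^sup>2 + 2 * x0 * x1 * x3 + 4 * x0\<^sup>2 * x4)"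
    using r012 r013 r014 r023 r034 r123 r134 by algebra
  have e23: "h2 * (x1\<^sup>2 * x4 - x0 * x3\<^sup>2) =
      h3 * (x1\<^sup>2 * x3 - x0 * x2 * x3 + 2 * x0 * x1 * x4)"
    using r012 r013 r014 r023 by algebra
  have e24: "h2 * (x1 * x2 * x4 - x1 * x3\<^sup>2 - 2 * x0 * x3 * x4) =
      h4 * (x1\<^sup>2 * x3 - x0 * x2 * x3 + 2 * x0 * x1 * x4)"
    using r012 r014 r023 r123 by algebra
  have e25: "h2 * (x2\<^sup>2 * x4 - x2 * x3\<^sup>2 - 2 * x1 * x3 * x4 - 4 * x0 * x4\<^sup>2) =
      h5 * (x1\<^sup>2 * x3 - x0 * x2 * x3 + 2 * x0 * x1 * x4)"
    using r012 r014 r023 r024 r123 r124 by algebra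
  have e26: "h2 * (x2 * x3 * x4 - x3 ^ 3 - 2 * x1 * x4\<^sup>2) =
      h6 * (x1\<^sup>2 * x3 - x0 * x2 * x3 + 2 * x0 * x1 * x4)"
    using r034 r123 r134 by algebra
  have e34: "h3 * (x1 * x2 * x4 - x1 * x3\<^sup>2 - 2 * x0 * x3 * x4) =
      h4 * (x1\<^sup>2 * x4 - x0 * x3\<^sup>2)"
    using r013 r014 r123 by algebra
  have e35: "h3 * (x2\<^sup>2 * x4 - x2 * x3\<^sup>2 - 2 * x1 * x3 * x4 - 4 * x0 * x4\<^sup>2) =
      h5 * (x1\<^sup>2 * x4 - x0 * x3\<^sup>2)"
    using r013 r014 r023 r024 r123 r124 by algebra
  have e36: "h3 * (x2 * x3 * x4 - x3 ^ 3 - 2 * x1 * x4\<^sup>2) =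
      h6 * (x1\<^sup>2 * x4 - x0 * x3\<^sup>2)"
    using r034 r123 r134 by algebra
  have e45: "h4 * (x2\<^sup>2 * x4 - x2 * x3\<^sup>2 - 2 * x1 * x3 * x4 - 4 * x0 * x4\<^sup>2) =
      h5 * (x1 * x2 * x4 - x1 * x3\<^sup>2 - 2 * x0 * x3 * x4)"
    using r023 r024 r123 r124 by algebra
  have e46: "h4 * (x2 * x3 * x4 - x3 ^ 3 - 2 * x1 * x4\<^sup>2) =
      h6 * (x1 * x2 * x4 - x1 * x3\<^sup>2 - 2 * x0 * x3 * x4)"
    using r034 r123 r134 by algebra
  have e56: "h5 * (x2 * x3 * x4 - x3 ^ 3 - 2 * x1 * x4\<^sup>2) =
      h6 * (x2\<^sup>2 * x4 - x2 * x3\<^sup>2 - 2 * x1 * x3 * x4 - 4 * x0 * x4\<^sup>2)"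
    using r034 r124 r134 r234 by algebra
  show ?thesis using assms(11,12,13,14) unfolding less7 h_def t_def
    by (elim disjE; simp add: e01 e02 e03 e04 e05 e06 e12 e13 e14 e15 e16 e23 e24 e25 e26 e34 e35 e36 e45 e46 e56)
qed

end

section \<open>Points of the incidence variety and the cubic bivector\<close>

context coordinates5
begin

lemma X_diff: "i < 5 \<Longrightarrow> X i (x - y) = X i x - X i y"
  by (rule clinear_diff[OF X_linear])

text \<open>If an outer coordinate is not identically zero on U, normalise it to 1 at some w. A
  vector v of U on which it vanishes must be 0, because along w + t v the cubics are polynomials in
  t with all coefficients zero; so that coordinate is injective on U. If both outer coordinates
  vanish on U, then x1^3 = x3^3 = 0 leaves the span of \<open>b 2\<close>.\<close>

lemma squares_contain_no_line:
  assumes U: "csubspace U" and van: "\<And>z j. z \<in> U \<Longrightarrow> j < 7 \<Longrightarrow> cubic j z = 0"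
  shows "\<exists>w. U \<subseteq> line w"
proof -
  have c: "cubic 0 z = 0" "cubic 1 z = 0" "cubic 5 z = 0" "cubic 6 z = 0" if "z \<in> U" for z
    by (rule van[OF that], simp)+
  have lc: "w + t *\<^sub>C v \<in> U" if "w \<in> U" "v \<in> U" for w v t
    using U that by (simp add: complex_vector.subspace_add complex_vector.subspace_scale)
  consider w where "w \<in> U" "X 0 w \<noteq> 0" | w where "w \<in> U" "X 4 w \<noteq> 0" "\<And>z. z \<in> U \<Longrightarrow> X 0 z = 0"
    | "\<And>z. z \<in> U \<Longrightarrow> X 0 z = 0 \<and> X 4 z = 0"
    by blast
  then show ?thesis
  proof cases
    case (1 y)
    define w where "w = (1 / X 0 y) *\<^sub>C y"
    have w: "w \<in> U" "X 0 w = 1"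
      using 1 U by (simp_all add: w_def X_lin complex_vector.subspace_scale)
    have zero: "v = 0" if v: "v \<in> U" "X 0 v = 0" for v
    proof -
      have v1: "X 1 v = 0" using c(1)[OF v(1)] by (simp add: cubic_simps v(2))
      have e: "X 1 w ^ 3 - X 1 w * (X 2 w + t * X 2 v) + 2 * (X 3 w + t * X 3 v) = 0"
        "(X 1 w)\<^sup>2 * (X 2 w + t * X 2 v) - (X 2 w + t * X 2 v)\<^sup>2 + 2 * X 1 w * (X 3 w + t * X 3 v) +
          4 * (X 4 w + t * X 4 v) = 0" for t
        using c(1,2)[OF lc[OF w(1) v(1), of t]] by (simp_all add: cubic_simps X_lin w(2) v(2) v1)
      \<comment> \<open>The values at 0, 1 and -1 give a second difference, which isolates the
        coefficient of t^2.\<close>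
      have "(X 2 v)\<^sup>2 = 0" using e(2)[of 0] e(2)[of 1] e(2)[of "-1"] by algebra
      then have v2: "X 2 v = 0" by simp
      have v3: "X 3 v = 0" using e(1)[of 0] e(1)[of 1] v2 by algebra
      have "X 4 v = 0" using e(2)[of 0] e(2)[of 1] v2 v3 by algebra
      then show ?thesis by (intro coord_eqI) (simp_all add: X_lin v(2) v1 v2 v3)
    qed
    have "x \<in> line w" if x: "x \<in> U" for x
    proof -
      have "x + (- X 0 x) *\<^sub>C w = 0"
        by (rule zero[OF lc[OF x w(1)]]) (simp add: X_lin X_diff w(2))
      then have "x = X 0 x *\<^sub>C w" by (simp add: add_eq_0_iff2)
      then show ?thesis by (auto simp: mem_line)
    qed
    then show ?thesis by blast
  next
    case (2 y)
    define w where "w = (1 / X 4 y) *\<^sub>C y"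
    have w: "w \<in> U" "X 4 w = 1"
      using 2 U by (simp_all add: w_def X_lin complex_vector.subspace_scale)
    have x01: "X 0 z = 0" "X 1 z = 0" if "z \<in> U" for z
      using c(1)[OF that] 2(3)[OF that] by (simp_all add: cubic_simps)
    have zero: "v = 0" if v: "v \<in> U" "X 4 v = 0" for v
    proof -
      have v3: "X 3 v = 0" using c(4)[OF v(1)] by (simp add: cubic_simps v(2))
      have e: "(X 2 w + t * X 2 v)\<^sup>2 - (X 2 w + t * X 2 v) * (X 3 w)\<^sup>2 = 0" for t
        using c(3)[OF lc[OF w(1) v(1), of t]]
        by (simp add: cubic_simps X_lin w(2) v(2) v3 x01[OF w(1)] x01[OF v(1)])
      have "(X 2 v)\<^sup>2 = 0" using e[of 0] e[of 1] e[of "-1"] by algebra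
      then show ?thesis by (intro coord_eqI) (simp_all add: X_lin v(2) x01[OF v(1)] v3)
    qed
    have "x \<in> line w" if x: "x \<in> U" for x
    proof -
      have "x + (- X 4 x) *\<^sub>C w = 0"
        by (rule zero[OF lc[OF x w(1)]]) (simp add: X_lin X_diff w(2))
      then have "x = X 4 x *\<^sub>C w" by (simp add: add_eq_0_iff2)
      then show ?thesis by (auto simp: mem_line)
    qed
    then show ?thesis by blast
  next
    case 3
    have "x \<in> line (b 2)" if x: "x \<in> U" for x
    proof -
      have "x = X 2 x *\<^sub>C b 2"
        using c(1)[OF x] c(4)[OF x] 3[OF x] van[OF x, of 0] van[OF x, of 6]
        by (intro coord_eqI) (simp_all add: X_lin cubic_simps)
      then show ?thesis by (auto simp: mem_line)
    qed
    then show ?thesis by blast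
  qed
qed

text \<open>Since z lies in the span of e and f, the trivector z \<and> \<eta> is zero, and its
  components are the relations that force proportionality.\<close>

lemma cubic_bivector_proportional:
  assumes \<eta>: "\<eta> \<in> perp forms" "\<eta> = wedge e f" and z: "z = \<alpha> *\<^sub>C e + \<beta> *\<^sub>C f" and ij: "i < 7" "j < 7"
  shows "\<eta> (perp_coord i) * cubic j z = \<eta> (perp_coord j) * cubic i z"
proof -
  have rel: "X k z * \<eta> (pl i j) - X i z * \<eta> (pl k j) + X j z * \<eta> (pl k i) = 0"
    if "i < 5" "j < 5" "k < 5" for i j k
    unfolding \<eta>(2) using that by (simp add: wedge_apply pl_alt z X_lin pl_def algebra_simps)
  have d: "\<eta> (pl 1 2) = 2 * \<eta> (pl 0 3)" "\<eta> (pl 1 3) = 2 * \<eta> (pl 0 4)" "\<eta> (pl 2 3) = 2 * \<eta> (pl 1 4)"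
    using \<eta>(1) by (simp_all add: perp_forms_iff)
  have "[\<eta> (pl 0 1), \<eta> (pl 0 2), \<eta> (pl 0 3), \<eta> (pl 0 4), \<eta> (pl 1 4), \<eta> (pl 2 4), \<eta> (pl 3 4)] ! i *
      cubic j z = [\<eta> (pl 0 1), \<eta> (pl 0 2), \<eta> (pl 0 3), \<eta> (pl 0 4), \<eta> (pl 1 4), \<eta> (pl 2 4), \<eta> (pl 3 4)] ! j *
      cubic i z"
    unfolding cubic_def Let_def
    by (rule bivector_proportional[OF _ _ _ _ _ _ _ _ _ _ ij])
      (use rel[of 1 2 0] rel[of 1 3 0] rel[of 1 4 0] rel[of 2 3 0] rel[of 2 4 0] rel[of 3 4 0]
        rel[of 2 3 1] rel[of 2 4 1] rel[of 3 4 1] rel[of 3 4 2] in \<open>simp_all add: d\<close>)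
  moreover have "[\<eta> (pl 0 1), \<eta> (pl 0 2), \<eta> (pl 0 3), \<eta> (pl 0 4), \<eta> (pl 1 4), \<eta> (pl 2 4), \<eta> (pl 3 4)] ! k =
    \<eta> (perp_coord k)" if "k < 7" for k
    using that unfolding less7 by (elim disjE) (simp_all add: perp_coord_def)
  ultimately show ?thesis using ij by simp
qed

text \<open>A single point of a plane in Y that lies off the surface already determines the
  plane.\<close>

lemma line_cubic_bivector:
  assumes \<eta>: "\<eta> \<in> perp forms" "\<eta> = wedge e f" "\<eta> \<noteq> 0" and z: "z = \<alpha> *\<^sub>C e + \<beta> *\<^sub>C f"
    and j: "j < 7" "cubic j z \<noteq> 0"
  shows "line (cubic_bivector z) = line \<eta>"
proof -
  have "\<eta> = (\<Sum>i<7. (\<eta> (perp_coord j) / cubic j z * cubic i z) *\<^sub>C perp_basis i)"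
    by (rule trans[OF perp_expand[OF \<eta>(1)]], rule sum.cong)
      (use cubic_bivector_proportional[OF \<eta>(1,2) z _ j(1)] j(2) in \<open>auto simp: field_simps\<close>)
  also have "\<dots> = (\<eta> (perp_coord j) / cubic j z) *\<^sub>C cubic_bivector z"
    by (simp add: cubic_bivector_def complex_vector.scale_sum_right)
  finally show ?thesis using \<eta>(3) by (metis line_eqI mem_line)
qed

text \<open>These are the components of x \<and> \<open>cubic_bivector x\<close> = 0. They express
  that x lies in the plane cut out by the equations a(x, u) = 0, because alternating forms satisfy
  a(x, x) = 0; as identities they also hold on the surface.\<close>

lemma cubic_bivector_relation:
  assumes "i < j" "j < k" "k < (5::nat)"
  shows "X i x * cubic_bivector x (pl j k) - X j x * cubic_bivector x (pl i k) + X k x * cubic_bivector x (pl i j) = 0"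
proof -
  note g = perp_lincomb_coords[OF cubic_bivector_def[of x]]
  have "i = 0 \<and> j = 1 \<and> k = 2 \<or> i = 0 \<and> j = 1 \<and> k = 3 \<or> i = 0 \<and> j = 1 \<and> k = 4 \<or>
    i = 0 \<and> j = 2 \<and> k = 3 \<or> i = 0 \<and> j = 2 \<and> k = 4 \<or> i = 0 \<and> j = 3 \<and> k = 4 \<or>
    i = 1 \<and> j = 2 \<and> k = 3 \<or> i = 1 \<and> j = 2 \<and> k = 4 \<or> i = 1 \<and> j = 3 \<and> k = 4 \<or>
    i = 2 \<and> j = 3 \<and> k = 4"
    using assms by presburger
  moreover have
    "X 0 x * cubic_bivector x (pl 1 2) - X 1 x * cubic_bivector x (pl 0 2) + X 2 x * cubic_bivector x (pl 0 1) = 0"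
    "X 0 x * cubic_bivector x (pl 1 3) - X 1 x * cubic_bivector x (pl 0 3) + X 3 x * cubic_bivector x (pl 0 1) = 0"
    "X 0 x * cubic_bivector x (pl 1 4) - X 1 x * cubic_bivector x (pl 0 4) + X 4 x * cubic_bivector x (pl 0 1) = 0"
    "X 0 x * cubic_bivector x (pl 2 3) - X 2 x * cubic_bivector x (pl 0 3) + X 3 x * cubic_bivector x (pl 0 2) = 0"
    "X 0 x * cubic_bivector x (pl 2 4) - X 2 x * cubic_bivector x (pl 0 4) + X 4 x * cubic_bivector x (pl 0 2) = 0"
    "X 0 x * cubic_bivector x (pl 3 4) - X 3 x * cubic_bivector x (pl 0 4) + X 4 x * cubic_bivector x (pl 0 3) = 0"
    "X 1 x * cubic_bivector x (pl 2 3) - X 2 x * cubic_bivector x (pl 1 3) + X 3 x * cubic_bivector x (pl 1 2) = 0"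
    "X 1 x * cubic_bivector x (pl 2 4) - X 2 x * cubic_bivector x (pl 1 4) + X 4 x * cubic_bivector x (pl 1 2) = 0"
    "X 1 x * cubic_bivector x (pl 3 4) - X 3 x * cubic_bivector x (pl 1 4) + X 4 x * cubic_bivector x (pl 1 3) = 0"
    "X 2 x * cubic_bivector x (pl 3 4) - X 3 x * cubic_bivector x (pl 2 4) + X 4 x * cubic_bivector x (pl 2 3) = 0"
    unfolding g cubic_simps by algebra+
  ultimately show ?thesis by (elim disjE conjE) simp_all
qed

lemma cubic_bivector_coord: "i < 7 \<Longrightarrow> cubic_bivector x (perp_coord i) = cubic i x"
  unfolding cubic_bivector_def by (rule perp_lincomb_coord)

text \<open>A pair in the closure satisfies x \<and> y = 0 and the linear equations of the
  annihilator of the forms, and these already reconstruct a plane of Y through x. So the closure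
  adds nothing beyond the incidence variety.\<close>

lemma PU_closure: "PU forms = zariski_closure (proj_graph cubic_bivector)"
proof (intro subset_antisym subsetI)
  fix z assume "z \<in> PU forms"
  then obtain l m U where z: "z = (l, m)" and m: "m \<in> proj (perp forms)" and U: "U \<in> grass2" "m = plucker U"
    and l: "l \<in> proj U"
    by (auto simp: PU_def Y_var_def)
  obtain e f where ef: "U = cspan {e, f}" using grass2E[OF U(1)] .
  define \<eta> where "\<eta> = wedge e f"
  have m\<eta>: "m = line \<eta>" by (simp add: U(2) ef plucker_span \<eta>_def)
  obtain \<xi> where \<xi>: "\<xi> \<in> perp forms" "\<xi> \<noteq> 0" "m = line \<xi>" using m by (rule proj_UNIV_E)
  have \<eta>0: "\<eta> \<noteq> 0"
    using \<xi>(2,3) self_mem_line[of \<xi>] m\<eta> by (auto simp: mem_line)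
  have psub: "csubspace (perp forms)"
    using bivectors_subspace by (auto simp: perp_def complex_vector.subspace_def)
  have \<eta>p: "\<eta> \<in> perp forms"
  proof -
    have "\<eta> \<in> line \<xi>" using self_mem_line[of \<eta>] \<xi>(3) m\<eta> by simp
    then show ?thesis using \<xi>(1) complex_vector.subspace_scale[OF psub] by (auto simp: mem_line)
  qed
  obtain x where x: "x \<in> U" "x \<noteq> 0" "l = line x" using l by (rule proj_UNIV_E)
  have Us: "csubspace U" by (simp add: ef)
  have "\<not> (\<exists>w. U \<subseteq> line w)"
  proof
    assume "\<exists>w. U \<subseteq> line w"
    then obtain w where w: "U \<subseteq> line w" ..
    have "e \<in> line w" "f \<in> line w"
      by (rule subsetD[OF w], simp add: ef complex_vector.span_base)+
    then obtain \<alpha> \<beta> where "e = \<alpha> *\<^sub>C w" "f = \<beta> *\<^sub>C w" by (auto simp: mem_line)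
    then show False using \<eta>0 wedge_plane[of \<alpha> w 0 w \<beta> 0] by (simp add: \<eta>_def)
  qed
  then obtain y j where y: "y \<in> U" "j < 7" "cubic j y \<noteq> 0"
    using squares_contain_no_line[OF Us] by blast
  txt \<open>The point \<open>x\<close> is a limit of points of the pencil \<open>U\<close> off the surface, for all of which the
    bivector is \<open>\<eta>\<close>.\<close>
  have "(line x, line \<eta>) \<in> zariski_closure (proj_graph cubic_bivector)"
    unfolding closure_graph_iff
  proof (intro conjI allI ballI impI)
    show "line x \<in> proj UNIV" "line \<eta> \<in> proj UNIV" using x \<eta>0 by (auto intro: line_mem_proj)
    fix d e' h assume h: "h \<in> bihpoly d e'" "\<forall>z. cubic_bivector z \<noteq> 0 \<longrightarrow> h z (cubic_bivector z) = 0"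
    let ?z = "\<lambda>t. x + t *\<^sub>C (y - x)"
    obtain P where P: "\<And>t. h (?z t) \<eta> = poly P t"
      using hpoly_poly[OF bihpoly_slice[OF h(1)]] by blast
    obtain Q where Q: "\<And>t. cubic j (?z t) = poly Q t"
      using hpoly_poly[OF cubic_hpoly[OF y(2)]] by blast
    \<comment> \<open>P vanishes wherever Q does not, and Q is not the zero polynomial because t = 1
      gives y, a point off the surface.\<close>
    have "poly (P * Q) t = 0" for t
    proof (cases "cubic j (?z t) = 0")
      case False
      have "?z t \<in> U"
        using x y Us by (simp add: complex_vector.subspace_add complex_vector.subspace_diff
            complex_vector.subspace_scale)
      then obtain \<alpha> \<beta> where zt: "?z t = \<alpha> *\<^sub>C e + \<beta> *\<^sub>C f" by (auto simp: ef mem_span2)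
      have "line (cubic_bivector (?z t)) = line \<eta>"
        by (rule line_cubic_bivector[OF \<eta>p \<eta>_def \<eta>0 zt y(2) False])
      moreover have "h (?z t) (cubic_bivector (?z t)) = 0"
        using h(2) cubic_bivector_nonzeroI[OF y(2) False] by blast
      ultimately have "h (?z t) \<eta> = 0"
        using vanishes_at_line[OF h(1), of "?z t" \<eta>]
          vanishes_at_line[OF h(1), of "?z t" "cubic_bivector (?z t)"] by simp
      then show ?thesis by (simp add: P)
    qed (simp add: Q)
    then have "P * Q = 0" using poly_all_0_iff_0 by blast
    moreover have "poly Q 1 \<noteq> 0" using Q[of 1] y(3) by (simp add: scaleC_one)
    ultimately have "P = 0" by auto
    then show "h x \<eta> = 0" using P[of 0] by simp
  qed
  then show "z \<in> zariski_closure (proj_graph cubic_bivector)" by (simp add: z x(3) m\<eta>)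
next
  fix z assume z: "z \<in> zariski_closure (proj_graph cubic_bivector)"
  from closure_graph_E[OF z] obtain x y where xy: "z = (line x, line y)" "x \<noteq> 0" "y \<noteq> 0" .
  note cl = z[unfolded xy(1)]
  have ev: "clinear (\<lambda>y :: 'v bivec. y \<omega>)" for \<omega> by (rule clinearI) simp_all
  \<comment> \<open>Lying in the span of \<open>perp_basis\<close> is a system of linear equations
    in y, so it passes from the graph to its closure.\<close>
  have y: "y = (\<Sum>j<7. y (perp_coord j) *\<^sub>C perp_basis j)"
  proof
    fix \<omega>
    let ?h = "\<lambda>y :: 'v bivec. y \<omega> - (\<Sum>j<7. y (perp_coord j) * perp_basis j \<omega>)"
    have "clinear ?h"
      by (rule clinearI) (simp_all add: sum.distrib sum_distrib_left algebra_simps)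
    then have "(\<lambda>(x::'v) y. ?h y) \<in> bihpoly 0 (Suc 0)" by (intro bihpoly_right hpoly_linear)
    then have "?h y = 0"
    proof (rule closure_graph_vanish[OF cl])
      fix z
      have "cubic_bivector z \<omega> = (\<Sum>j<7. cubic j z * perp_basis j \<omega>)" by (simp add: cubic_bivector_def sum_apply)
      then show "?h (cubic_bivector z) = 0" by (simp add: cubic_bivector_coord)
    qed
    then show "y \<omega> = (\<Sum>j<7. y (perp_coord j) *\<^sub>C perp_basis j) \<omega>" by (simp add: sum_apply)
  qed
  have yp: "y \<in> perp forms" by (subst y) (rule perp_lincomb_mem)
  have yb: "y \<in> bivectors" using yp by (simp add: perp_def)
  \<comment> \<open>An element of the bivector type is only a function of the form, so even its sign
    rule has to be read off from the expansion.\<close>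
  have sw: "y (pl j i) = - y (pl i j)" if "i < 5" "j < 5" for i j
    unfolding bivector_expand[OF yb, of "pl j i"] bivector_expand[OF yb, of "pl i j"]
    using pl_alt[OF that] pl_alt[OF that(2,1)] by (simp add: pl_swap[of j i] algebra_simps)
  have rel: "X i x * y (pl j k) - X j x * y (pl i k) + X k x * y (pl i j) = 0"
    if ijk: "i < j" "j < k" "k < 5" for i j k
  proof -
    let ?h = "\<lambda>x (y :: 'v bivec). X i x * y (pl j k) - X j x * y (pl i k) + X k x * y (pl i j)"
    have "?h \<in> bihpoly (Suc 0) (Suc 0)"
      using ijk by (intro bihpoly_add bihpoly_diff bihpoly_linear hpoly_linear X_linear ev) simp_all
    then show ?thesis
      by (rule closure_graph_vanish[OF cl]) (rule cubic_bivector_relation[OF ijk])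
  qed
  have "\<exists>k<5. X k x \<noteq> 0"
  proof (rule ccontr)
    assume "\<not> (\<exists>k<5. X k x \<noteq> 0)"
    then have "x = 0" by (intro eqI) (simp add: X_lin)
    then show False using xy(2) by simp
  qed
  then obtain k where k: "k < 5" "X k x \<noteq> 0" by blast
  \<comment> \<open>The contraction of y with the k-th coordinate, divided by \<open>X k x\<close>:
    the standard witness that x \<and> y = 0 with x nonzero implies y = x \<and> u.\<close>
  define u where "u = (\<Sum>j<5. (y (pl k j) / X k x) *\<^sub>C b j)"
  have Xu: "X j u = y (pl k j) / X k x" if "j < 5" for j
    using that by (simp add: u_def X_vec)
  have rel': "X k x * y (pl i j) = X i x * y (pl k j) - X j x * y (pl k i)" if "i < j" "j < 5" for i j
  proof -
    have s: "y (pl i k) = - y (pl k i)" "y (pl j k) = - y (pl k j)"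
      by (rule sw; use k that in simp)+
    have kk: "y (pl k k) = 0" using sw[OF k(1) k(1)] by simp
    consider "k < i" | "k = i" | "i < k" "k < j" | "k = j" | "j < k" using that by linarith
    then show ?thesis
    proof cases
      case 1 then show ?thesis using rel[of k i j] that by (simp add: algebra_simps)
    next
      case 2 then show ?thesis using kk by simp
    next
      case 3 then show ?thesis using rel[of i k j] that s by (simp add: algebra_simps)
    next
      case 4 then show ?thesis using s kk by simp
    next
      case 5 then show ?thesis using rel[of i j k] k(1) that(1) unfolding s by (simp add: algebra_simps)
    qed
  qed
  have yij: "wedge x u (pl i j) = y (pl i j)" if "i < j" "j < 5" for i j
    using that rel'[OF that] k(2)
    by (simp add: wedge_apply pl_alt pl_def Xu field_simps)
  have yw: "y = wedge x u"
  proof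
    fix \<omega>
    show "y \<omega> = wedge x u \<omega>"
      unfolding bivector_expand[OF yb, of \<omega>] bivector_expand[OF wedge_mem_bivectors, of x u \<omega>]
      by (simp add: yij)
  qed
  have "wedge x u \<noteq> 0" using yw xy(3) by simp
  from span_mem_grass2[OF this] have "cspan {x, u} \<in> grass2" .
  moreover have "line y = plucker (cspan {x, u})" by (simp add: plucker_span yw)
  moreover have "line y \<in> proj (perp forms)" using yp xy(3) by (rule line_mem_proj)
  moreover have "line x \<in> proj (cspan {x, u})"
    using xy(2) by (intro line_mem_proj complex_vector.span_base) simp_all
  ultimately show "z \<in> PU forms" unfolding xy(1) PU_def Y_var_def by auto
qed

section \<open>Comparison with an arbitrary system of generators\<close>

lemma ideal_span_representation:
  assumes "p \<in> cspan {\<lambda>x. q x * F i x | q i. q \<in> hpoly e \<and> i < (r::nat)}"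
  shows "\<exists>q. (\<forall>i. q i \<in> hpoly e) \<and> p = (\<lambda>x. \<Sum>i<r. q i x * F i x)"
  using assms
proof (induction rule: complex_vector.span_induct_alt)
  case base
  have "(\<lambda>x. 0) \<in> hpoly e"
    using complex_vector.subspace_0[OF hpoly_subspace] by (simp add: zero_fun_def)
  then show ?case by (intro exI[of _ "\<lambda>i x. 0"]) (simp add: fun_eq_iff)
next
  case (step c p p')
  then obtain q j where p: "p = (\<lambda>x. q x * F j x)" "q \<in> hpoly e" "j < r" by blast
  obtain q' where q': "\<And>i. q' i \<in> hpoly e" "p' = (\<lambda>x. \<Sum>i<r. q' i x * F i x)"
    using step.IH by blast
  have 1: "(\<lambda>x. c * q x + q' j x) \<in> hpoly e" by (intro hpoly_add hpoly_scale p q')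
  have "c * p x + p' x = (\<Sum>i<r. (if i = j then \<lambda>x. c * q x + q' j x else q' i) x * F i x)" for x
  proof -
    have "(\<Sum>i<r. (if i = j then \<lambda>x. c * q x + q' j x else q' i) x * F i x) =
      (\<Sum>i<r. (if i = j then c * q x * F j x else 0) + q' i x * F i x)"
      by (rule sum.cong) (auto simp: algebra_simps)
    then show ?thesis using p q' by (simp add: sum.distrib)
  qed
  then show ?case using 1 q'(1)
    by (intro exI[of _ "\<lambda>i. if i = j then \<lambda>x. c * q x + q' j x else q' i"]) (auto simp: fun_eq_iff)
qed

lemma generates_mem_ideal:
  assumes "generates_ideal Z d r F"
  shows "\<exists>e0. \<forall>e\<ge>e0. ideal_deg Z (d + e) = cspan {\<lambda>x. q x * F i x | q i. q \<in> hpoly e \<and> i < r}"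
  using assms by (simp add: generates_ideal_def)

theorem blowup_iso:
  assumes "generates_ideal squares d r F"
  shows "\<exists>f. variety_iso (PU forms) (zariski_closure (rational_graph r F)) f \<and>
    (\<forall>z\<in>PU forms. fst (f z) = fst z)"
proof -
  obtain e0 where e0: "\<And>e. e \<ge> e0 \<Longrightarrow>
      ideal_deg squares (d + e) = cspan {\<lambda>x. q x * F i x | q i. q \<in> hpoly e \<and> i < r}"
    using generates_mem_ideal[OF assms] by blast
  \<comment> \<open>The exponents satisfy d + dF = 3 + dG and dF \<ge> e0. So each F_i times
    \<open>X k x ^ dF\<close> and each cubic times \<open>X k x ^ dG\<close> lie in the same graded
    piece of the ideal, where both systems generate.\<close>
  define dF where "dF = e0 + 3"
  define dG where "dG = d + e0"
  have ideal: "cspan {\<lambda>x. q x * F i x | q i. q \<in> hpoly dF \<and> i < r} = cubic_ideal dG"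
    using e0[of dF] ideal_squares[of dG] by (simp add: dF_def dG_def add_ac)
  have "\<forall>k\<in>{..<5}. \<forall>i\<in>{..<r}. \<exists>p. (\<forall>j. p j \<in> hpoly dG) \<and>
      (\<lambda>x. X k x ^ dF * F i x) = (\<lambda>x. \<Sum>j<7. p j x * cubic j x)"
  proof (intro ballI)
    fix k i assume "k \<in> {..<5::nat}" "i \<in> {..<r}"
    then have "(\<lambda>x. X k x ^ dF * F i x) \<in> cubic_ideal dG"
      unfolding ideal[symmetric]
      by (intro complex_vector.span_base CollectI exI[of _ "\<lambda>x. X k x ^ dF"] exI[of _ i])
        (simp add: X_power)
    then show "\<exists>p. (\<forall>j. p j \<in> hpoly dG) \<and> (\<lambda>x. X k x ^ dF * F i x) = (\<lambda>x. \<Sum>j<7. p j x * cubic j x)"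
      unfolding cubic_ideal_def by (rule ideal_span_representation)
  qed
  then obtain p where p: "\<And>k i j. k < 5 \<Longrightarrow> i < r \<Longrightarrow> p k i j \<in> hpoly dG"
    "\<And>k i. k < 5 \<Longrightarrow> i < r \<Longrightarrow> (\<lambda>x. X k x ^ dF * F i x) = (\<lambda>x. \<Sum>j<7. p k i j x * cubic j x)"
    unfolding bchoice_iff by auto
  have "\<forall>k\<in>{..<5}. \<forall>j\<in>{..<7}. \<exists>q. (\<forall>i. q i \<in> hpoly dF) \<and>
      (\<lambda>x. X k x ^ dG * cubic j x) = (\<lambda>x. \<Sum>i<r. q i x * F i x)"
  proof (intro ballI)
    fix k j assume "k \<in> {..<5::nat}" "j \<in> {..<7::nat}"
    then have "(\<lambda>x. X k x ^ dG * cubic j x) \<in> cubic_ideal dG"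
      unfolding cubic_ideal_def
      by (intro complex_vector.span_base CollectI exI[of _ "\<lambda>x. X k x ^ dG"] exI[of _ j])
        (simp add: X_power)
    then show "\<exists>q. (\<forall>i. q i \<in> hpoly dF) \<and> (\<lambda>x. X k x ^ dG * cubic j x) = (\<lambda>x. \<Sum>i<r. q i x * F i x)"
      unfolding ideal[symmetric] by (rule ideal_span_representation)
  qed
  then obtain q where q: "\<And>k i j. k < 5 \<Longrightarrow> j < 7 \<Longrightarrow> q k j i \<in> hpoly dF"
    "\<And>k j. k < 5 \<Longrightarrow> j < 7 \<Longrightarrow> (\<lambda>x. X k x ^ dG * cubic j x) = (\<lambda>x. \<Sum>i<r. q k j i x * F i x)"
    unfolding bchoice_iff by auto
  let ?FF = "\<lambda>x i. if i < r then F i x else 0"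
  \<comment> \<open>\<open>P\<close> and \<open>R\<close> are the two changes of generators made
    linear in y: \<open>perp_coord\<close> reads the cubics off the bivector, and \<open>y i\<close>
    takes the place of the i-th form.\<close>
  define P where "P = (\<lambda>k x (y :: 'v bivec). \<Sum>i<r. (\<Sum>j<7. p k i j x * y (perp_coord j)) *\<^sub>C
    (\<lambda>n. if n = i then 1 else 0 :: complex))"
  define R where "R = (\<lambda>k x (y :: nat \<Rightarrow> complex). \<Sum>j<7. (\<Sum>i<r. q k j i x * y i) *\<^sub>C perp_basis j)"
  have ev: "clinear (\<lambda>y :: 'i \<Rightarrow> complex. y \<omega>)" for \<omega> by (rule clinearI) simp_all
  interpret T: graph_transition X 5 b cubic_bivector ?FF P R dF dG
  proof (rule graph_transition.intro)
    fix k :: nat and x assume k: "k < 5"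
    show "clinear (X k)" using k by (rule X_linear)
    show "P k \<in> bihpoly_vec dG (Suc 0)"
      unfolding P_def using p(1)[OF k] ev
      by (intro bihpoly_vec_sum bihpoly_vec_scale bihpoly_sum bihpoly_linear) simp_all
    show "R k \<in> bihpoly_vec dF (Suc 0)"
      unfolding R_def using q(1)[OF k] ev
      by (intro bihpoly_vec_sum bihpoly_vec_scale bihpoly_sum bihpoly_linear) simp_all
    show "P k x (cubic_bivector x) = (X k x ^ dF) *\<^sub>C ?FF x"
    proof
      fix n
      have "P k x (cubic_bivector x) n = (\<Sum>i<r. if n = i then \<Sum>j<7. p k i j x * cubic j x else 0)"
        unfolding P_def sum_apply
        by (rule sum.cong) (auto simp: cubic_bivector_coord)
      also have "\<dots> = (if n < r then \<Sum>j<7. p k n j x * cubic j x else 0)" by simp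
      finally show "P k x (cubic_bivector x) n = ((X k x ^ dF) *\<^sub>C ?FF x) n"
        using fun_cong[OF p(2)[OF k, of n], of x] by simp
    qed
    have "(\<Sum>i<r. q k j i x * ?FF x i) = X k x ^ dG * cubic j x" if "j < 7" for j
      using fun_cong[OF q(2)[OF k that], of x] by simp
    then show "R k x (?FF x) = (X k x ^ dG) *\<^sub>C cubic_bivector x"
      unfolding R_def cubic_bivector_def complex_vector.scale_sum_right
      by (intro sum.cong) (simp_all add: scaleC_scaleC)
  qed (rule X_expand)
  show ?thesis
    unfolding PU_closure rational_graph_eq
    using T.variety_iso_transition by (intro exI[of _ T.transition]) (simp add: T.transition_def)
qed

lemma generates_squares: "generates_ideal squares 3 7 cubic"
  using ideal_squares by (auto simp: generates_ideal_def cubic_hpoly cubic_ideal_def)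

end

section \<open>The three-dimensional subrepresentation\<close>

text \<open>This replaces passing to the Lie algebra: the coefficients of a polynomial family of vectors in
  a subspace lie in the subspace.\<close>

lemma polynomial_family_coefficients:
  fixes v :: "nat \<Rightarrow> 'a::complex_vector"
  assumes A: "csubspace A"
  shows "(\<And>s. s \<noteq> 0 \<Longrightarrow> (\<Sum>k\<le>n. s ^ k *\<^sub>C v k) \<in> A) \<Longrightarrow> k \<le> n \<Longrightarrow> v k \<in> A"
proof (induction n arbitrary: v k)
  case 0
  then show ?case using 0(1)[of 1] by (simp add: scaleC_one)
next
  case (Suc n)
  \<comment> \<open>Writing f(s) for the family, f(2 s) - 2^(n+1) f(s) has no term of degree n + 1,
    which brings the degree down. The other coefficients are multiplied by 2^k - 2^(n+1), which is
    nonzero.\<close>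
  have "(2 ^ k - 2 ^ Suc n) *\<^sub>C v k \<in> A" if "k \<le> n" for k
  proof (rule Suc.IH[OF _ that])
    fix s :: complex assume s: "s \<noteq> 0"
    have "(\<Sum>k\<le>Suc n. (2 * s) ^ k *\<^sub>C v k) - 2 ^ Suc n *\<^sub>C (\<Sum>k\<le>Suc n. s ^ k *\<^sub>C v k) \<in> A"
      using Suc.prems(1)[of s] Suc.prems(1)[of "2 * s"] s
      by (intro complex_vector.subspace_diff[OF A] complex_vector.subspace_scale[OF A]) simp_all
    also have "(\<Sum>k\<le>Suc n. (2 * s) ^ k *\<^sub>C v k) - 2 ^ Suc n *\<^sub>C (\<Sum>k\<le>Suc n. s ^ k *\<^sub>C v k) =
      (\<Sum>k\<le>Suc n. (s ^ k * (2 ^ k - 2 ^ Suc n)) *\<^sub>C v k)"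
      unfolding complex_vector.scale_sum_right sum_subtractf[symmetric]
      by (rule sum.cong[OF refl])
        (simp only: scaleC_scaleC complex_vector.scale_left_diff_distrib[symmetric] power_mult_distrib
          right_diff_distrib mult.commute)
    also have "\<dots> = (\<Sum>k\<le>n. s ^ k *\<^sub>C (2 ^ k - 2 ^ Suc n) *\<^sub>C v k)"
      by (simp add: scaleC_scaleC)
    finally show "(\<Sum>k\<le>n. s ^ k *\<^sub>C (2 ^ k - 2 ^ Suc n) *\<^sub>C v k) \<in> A" .
  qed
  moreover have "(2 :: complex) ^ k - 2 ^ Suc n \<noteq> 0" if "k \<le> n" for k
  proof -
    have "(2 :: nat) ^ k \<noteq> 2 ^ Suc n" using that by (simp del: power_Suc)
    then have "(of_nat (2 ^ k) :: complex) \<noteq> of_nat (2 ^ Suc n)" by (simp only: of_nat_eq_iff not_False_eq_True)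
    then show ?thesis by simp
  qed
  ultimately have le: "v k \<in> A" if "k \<le> n" for k
    using complex_vector.subspace_scale[OF A, of "(2 ^ k - 2 ^ Suc n) *\<^sub>C v k" "1 / (2 ^ k - 2 ^ Suc n)"] that
    by (simp add: scaleC_scaleC scaleC_one del: power_Suc)
  have "(\<Sum>k\<le>Suc n. 1 ^ k *\<^sub>C v k) - (\<Sum>k\<le>n. v k) \<in> A"
    by (intro complex_vector.subspace_diff[OF A] Suc.prems(1) complex_vector.subspace_sum[OF A] le) simp_all
  then have "v (Suc n) \<in> A" by (simp add: scaleC_one)
  then show ?case using le Suc.prems(2) by (cases "k = Suc n") auto
qed

text \<open>Lets independence be certified by a linear condition; below, T is the space of forms
  vanishing at one pair of basis vectors.\<close>

lemma independent_insertI: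
  assumes "complex_vector.independent S" "S \<subseteq> T" "csubspace T" "x \<notin> T"
  shows "complex_vector.independent (insert x S)"
  using assms complex_vector.span_minimal[OF assms(2,3)]
  by (auto simp: complex_vector.independent_insert)

lemma subspace_finite_basis:
  assumes "csubspace A" "cdim A = Suc n"
  obtains B where "finite B" "card B = Suc n" "complex_vector.independent B" "cspan B = A"
proof -
  obtain B where B: "B \<subseteq> A" "complex_vector.independent B" "A \<subseteq> cspan B" "card B = cdim A"
    by (rule complex_vector.basis_exists[of A])
  moreover have "finite B" using B(4) assms(2) card.infinite by fastforce
  moreover have "cspan B = A" using B(3) complex_vector.span_minimal[OF B(1) assms(1)] by blast
  ultimately show thesis using that assms(2) by simp
qed

section \<open>Torus, unipotent and Weyl elements acting on quartics\<close>

context coordinates5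
begin

definition torus :: "complex \<Rightarrow> 'v \<Rightarrow> 'v"
  where "torus c x = pt (c ^ 4 * X 0 x) (c\<^sup>2 * X 1 x) (X 2 x) (X 3 x / c\<^sup>2) (X 4 x / c ^ 4)"

definition unipotent :: "complex \<Rightarrow> 'v \<Rightarrow> 'v"
  where "unipotent r x = pt (X 0 x + 2 * r * X 1 x + r\<^sup>2 * X 2 x + 2 * r ^ 3 * X 3 x + r ^ 4 * X 4 x)
    (X 1 x + r * X 2 x + 3 * r\<^sup>2 * X 3 x + 2 * r ^ 3 * X 4 x)
    (X 2 x + 6 * r * X 3 x + 6 * r\<^sup>2 * X 4 x) (X 3 x + 2 * r * X 4 x) (X 4 x)"

definition weyl :: "'v \<Rightarrow> 'v"
  where "weyl x = pt (X 4 x) (- X 3 x) (X 2 x) (- X 1 x) (X 0 x)"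

text \<open>The divided powers of the nilpotent Lie algebra element, that is, the coefficients of
  the powers of r in the unipotent family; the element itself is \<open>raising 1\<close>.\<close>

definition raising :: "nat \<Rightarrow> 'v \<Rightarrow> 'v"
  where "raising k x = [x, pt (2 * X 1 x) (X 2 x) (6 * X 3 x) (2 * X 4 x) 0,
    pt (X 2 x) (3 * X 3 x) (6 * X 4 x) 0 0, pt (2 * X 3 x) (2 * X 4 x) 0 0 0, pt (X 4 x) 0 0 0 0] ! k"

lemma unipotent_raising: "unipotent r x = (\<Sum>k\<le>4. r ^ k *\<^sub>C raising k x)"
proof -
  have "{..4::nat} = {0, 1, 2, 3, 4}" by auto
  then show ?thesis
    by (intro coord_eqI) (simp_all add: unipotent_def raising_def X_lin)
qed

end

section \<open>Determination of the invariant subspace\<close>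

locale invariant_forms = coordinates5 X b for X :: "nat \<Rightarrow> 'v::complex_vector \<Rightarrow> complex" and b +
  fixes A :: "('v \<Rightarrow> 'v \<Rightarrow> complex) set"
  assumes A_subspace: "csubspace A" and A_alt: "A \<subseteq> alt_forms" and A_dim: "cdim A = 3"
    and A_torus: "\<And>a c. a \<in> A \<Longrightarrow> c \<noteq> 0 \<Longrightarrow> (\<lambda>x y. a (torus c x) (torus c y)) \<in> A"
    and A_unipotent: "\<And>a r. a \<in> A \<Longrightarrow> (\<lambda>x y. a (unipotent r x) (unipotent r y)) \<in> A"
    and A_weyl: "\<And>a. a \<in> A \<Longrightarrow> (\<lambda>x y. a (weyl x) (weyl y)) \<in> A"
begin

lemma A_scale: "a \<in> A \<Longrightarrow> (\<lambda>x y. c * a x y) \<in> A"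
  using complex_vector.subspace_scale[OF A_subspace, of a c] by (simp add: scaleC_fun_def)

lemma A_unscale:
  assumes "(\<lambda>x y. c * a x y) \<in> A" "c \<noteq> 0" shows "a \<in> A"
  using A_scale[OF assms(1), of "1 / c"] assms(2) by simp

text \<open>The Lie algebra action on forms, obtained as the coefficient of r in a(u_r x, u_r y) for
  the unipotent family u_r.\<close>

lemma A_raising:
  assumes "a \<in> A" shows "(\<lambda>x y. a (raising 1 x) y + a x (raising 1 y)) \<in> A"
proof -
  have alt: "a \<in> alt_forms" using assms A_alt by blast
  note l = alt_formsD[OF alt]
  \<comment> \<open>The coefficient of r^m; two families of degree 4 give total degree 8.\<close>
  define v where "v = (\<lambda>m x y. \<Sum>k\<le>4. \<Sum>j\<le>4. if k + j = m then a (raising k x) (raising j y) else 0)"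
  have "(\<Sum>m\<le>8. r ^ m *\<^sub>C v m) = (\<lambda>x y. a (unipotent r x) (unipotent r y))" for r
  proof (intro ext)
    fix x y
    have "(\<Sum>m\<le>8. r ^ m *\<^sub>C v m) x y =
      (\<Sum>m\<le>8. \<Sum>k\<le>4. \<Sum>j\<le>4. if k + j = m then r ^ m * a (raising k x) (raising j y) else 0)"
      by (simp add: sum_apply v_def sum_distrib_left if_distrib cong: if_cong)
    also have "\<dots> = (\<Sum>k\<le>4. \<Sum>m\<le>8. \<Sum>j\<le>4. if k + j = m then r ^ m * a (raising k x) (raising j y) else 0)"
      by (rule sum.swap)
    also have "\<dots> = (\<Sum>k\<le>4. \<Sum>j\<le>4. \<Sum>m\<le>8. if k + j = m then r ^ m * a (raising k x) (raising j y) else 0)"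
      by (intro sum.cong refl sum.swap)
    also have "\<dots> = (\<Sum>k\<le>4. \<Sum>j\<le>4. r ^ (k + j) * a (raising k x) (raising j y))"
      by (intro sum.cong refl) simp
    also have "\<dots> = a (unipotent r x) (unipotent r y)"
      unfolding unipotent_raising
      by (simp add: clinear_sum[OF l(1)] clinear_sum[OF l(2)] clinear_scale[OF l(1)]
          clinear_scale[OF l(2)] sum_distrib_left power_add) (subst sum.swap, simp add: mult_ac)
    finally show "(\<Sum>m\<le>8. r ^ m *\<^sub>C v m) x y = a (unipotent r x) (unipotent r y)" .
  qed
  then have "(\<Sum>m\<le>8. r ^ m *\<^sub>C v m) \<in> A" for r using A_unipotent[OF assms] by simp
  then have "v 1 \<in> A" by (rule polynomial_family_coefficients[OF A_subspace]) simp
  moreover have "v 1 = (\<lambda>x y. a (raising 1 x) y + a x (raising 1 y))"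
  proof (intro ext)
    fix x y
    have "{..4::nat} = {0, 1, 2, 3, 4}" by auto
    then have "v 1 x y = a (raising 0 x) (raising 1 y) + a (raising 1 x) (raising 0 y)"
      by (simp add: v_def)
    then show "v 1 x y = a (raising 1 x) y + a x (raising 1 y)" by (simp add: raising_def)
  qed
  ultimately show ?thesis by simp
qed

text \<open>Index k belongs to the torus character s^(k-3), where s = c^2; the shift by 3 makes all
  exponents nonnegative.\<close>

definition weight_part :: "('v \<Rightarrow> 'v \<Rightarrow> complex) \<Rightarrow> nat \<Rightarrow> 'v \<Rightarrow> 'v \<Rightarrow> complex"
  where "weight_part a k = [\<lambda>x y. a (b 3) (b 4) * pl 3 4 x y, \<lambda>x y. a (b 2) (b 4) * pl 2 4 x y,
    \<lambda>x y. a (b 1) (b 4) * pl 1 4 x y + a (b 2) (b 3) * pl 2 3 x y,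
    \<lambda>x y. a (b 0) (b 4) * pl 0 4 x y + a (b 1) (b 3) * pl 1 3 x y,
    \<lambda>x y. a (b 0) (b 3) * pl 0 3 x y + a (b 1) (b 2) * pl 1 2 x y,
    \<lambda>x y. a (b 0) (b 2) * pl 0 2 x y, \<lambda>x y. a (b 0) (b 1) * pl 0 1 x y] ! k"

lemma A_weight_part:
  assumes "a \<in> A" "k \<le> 6" shows "weight_part a k \<in> A"
proof (rule polynomial_family_coefficients[OF A_subspace _ assms(2)])
  fix s :: complex assume "s \<noteq> 0"
  \<comment> \<open>A square root of s makes the torus act through integral powers of s, and the
    factor s^3 below clears the denominators.\<close>
  define c where "c = csqrt s"
  have c: "c\<^sup>2 = s" "c \<noteq> 0" using \<open>s \<noteq> 0\<close> by (simp_all add: c_def)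
  have alt: "a \<in> alt_forms" using assms A_alt by blast
  have pw: "c ^ 4 = s\<^sup>2" unfolding c(1)[symmetric] by algebra
  define u where "u = 1 / s"
  have X_torus: "X 0 (torus c x) = s\<^sup>2 * X 0 x" "X 1 (torus c x) = s * X 1 x" "X 2 (torus c x) = 1 * X 2 x"
    "X 3 (torus c x) = u * X 3 x" "X 4 (torus c x) = u\<^sup>2 * X 4 x" for x
    by (simp_all add: torus_def pw c(1) u_def power_divide)
  have factor: "s ^ 3 * (\<alpha> * p * (\<beta> * q) - \<beta> * p' * (\<alpha> * q')) = s ^ 3 * \<alpha> * \<beta> * (p * q - p' * q')"
    for \<alpha> \<beta> p q p' q' :: complex
    by (simp add: algebra_simps)
  have coeffs: "s ^ 3 * s\<^sup>2 * s = s ^ 6"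
    "s ^ 3 * s\<^sup>2 * 1 = s ^ 5"
    "s ^ 3 * s\<^sup>2 * u = s ^ 4"
    "s ^ 3 * s\<^sup>2 * u\<^sup>2 = s ^ 3"
    "s ^ 3 * s * 1 = s ^ 4"
    "s ^ 3 * s * u = s ^ 3"
    "s ^ 3 * s * u\<^sup>2 = s ^ 2"
    "s ^ 3 * 1 * u = s ^ 2"
    "s ^ 3 * 1 * u\<^sup>2 = s ^ 1"
    "s ^ 3 * u * u\<^sup>2 = s ^ 0"
    using \<open>s \<noteq> 0\<close> by (simp_all add: u_def numeral_eq_Suc)
  have "(\<Sum>k\<le>6. s ^ k *\<^sub>C weight_part a k) = (\<lambda>x y. s ^ 3 * a (torus c x) (torus c y))"
  proof (intro ext)
    fix x y
    have six: "{..6::nat} = {0, 1, 2, 3, 4, 5, 6}" by auto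
    have t: "s ^ 3 * pl 0 1 (torus c x) (torus c y) = s ^ 6 * pl 0 1 x y"
      "s ^ 3 * pl 0 2 (torus c x) (torus c y) = s ^ 5 * pl 0 2 x y"
      "s ^ 3 * pl 0 3 (torus c x) (torus c y) = s ^ 4 * pl 0 3 x y"
      "s ^ 3 * pl 0 4 (torus c x) (torus c y) = s ^ 3 * pl 0 4 x y"
      "s ^ 3 * pl 1 2 (torus c x) (torus c y) = s ^ 4 * pl 1 2 x y"
      "s ^ 3 * pl 1 3 (torus c x) (torus c y) = s ^ 3 * pl 1 3 x y"
      "s ^ 3 * pl 1 4 (torus c x) (torus c y) = s ^ 2 * pl 1 4 x y"
      "s ^ 3 * pl 2 3 (torus c x) (torus c y) = s ^ 2 * pl 2 3 x y"
      "s ^ 3 * pl 2 4 (torus c x) (torus c y) = s ^ 1 * pl 2 4 x y"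
      "s ^ 3 * pl 3 4 (torus c x) (torus c y) = s ^ 0 * pl 3 4 x y"
      unfolding pl_def X_torus factor coeffs by (rule refl)+
    have "s ^ 3 * a (torus c x) (torus c y) =
        (s ^ 3 * pl 0 1 (torus c x) (torus c y)) * a (b 0) (b 1) +
        (s ^ 3 * pl 0 2 (torus c x) (torus c y)) * a (b 0) (b 2) +
        (s ^ 3 * pl 0 3 (torus c x) (torus c y)) * a (b 0) (b 3) +
        (s ^ 3 * pl 0 4 (torus c x) (torus c y)) * a (b 0) (b 4) +
        (s ^ 3 * pl 1 2 (torus c x) (torus c y)) * a (b 1) (b 2) +
        (s ^ 3 * pl 1 3 (torus c x) (torus c y)) * a (b 1) (b 3) +
        (s ^ 3 * pl 1 4 (torus c x) (torus c y)) * a (b 1) (b 4) +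
        (s ^ 3 * pl 2 3 (torus c x) (torus c y)) * a (b 2) (b 3) +
        (s ^ 3 * pl 2 4 (torus c x) (torus c y)) * a (b 2) (b 4) +
        (s ^ 3 * pl 3 4 (torus c x) (torus c y)) * a (b 3) (b 4)"
      unfolding alt_form_expand[OF alt, of "torus c x" "torus c y"] by (simp only: distrib_left mult.assoc)
    then show "(\<Sum>k\<le>6. s ^ k *\<^sub>C weight_part a k) x y = s ^ 3 * a (torus c x) (torus c y)"
      unfolding t six by (simp add: weight_part_def algebra_simps)
  qed
  then show "(\<Sum>k\<le>6. s ^ k *\<^sub>C weight_part a k) \<in> A"
    using A_scale[OF A_torus[OF assms(1) c(2)]] by simp
qed

lemma X_raising:
  "X 0 (raising 1 x) = 2 * X 1 x" "X 1 (raising 1 x) = X 2 x" "X 2 (raising 1 x) = 6 * X 3 x"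
  "X 3 (raising 1 x) = 2 * X 4 x" "X 4 (raising 1 x) = 0"
  by (simp_all add: raising_def)

lemma X_weyl:
  "X 0 (weyl x) = X 4 x" "X 1 (weyl x) = - X 3 x" "X 2 (weyl x) = X 2 x"
  "X 3 (weyl x) = - X 1 x" "X 4 (weyl x) = X 0 x"
  by (simp_all add: weyl_def)

text \<open>An extremal weight vector of S^6 W. Raising moves it through successive weights, and the
  first four vectors already exceed the dimension of A.\<close>

lemma pl01_notin: "pl 0 1 \<notin> A"
proof
  assume "pl 0 1 \<in> A"
  from A_raising[OF this] have 2: "pl 0 2 \<in> A"
    by (rule back_subst[of "\<lambda>f. f \<in> A"]) (auto simp: fun_eq_iff pl_def X_raising algebra_simps)
  define f3 where "f3 = (\<lambda>x y. 2 * pl 1 2 x y + 6 * pl 0 3 x y)"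
  define f4 where "f4 = (\<lambda>x y. 24 * pl 1 3 x y + 12 * pl 0 4 x y)"
  from A_raising[OF 2] have 3: "f3 \<in> A"
    by (rule back_subst[of "\<lambda>f. f \<in> A"]) (auto simp: f3_def fun_eq_iff pl_def X_raising algebra_simps)
  from A_raising[OF 3] have 4: "f4 \<in> A"
    by (rule back_subst[of "\<lambda>f. f \<in> A"]) (auto simp: f3_def f4_def fun_eq_iff pl_def X_raising algebra_simps)
  have sub: "csubspace {f :: 'v \<Rightarrow> 'v \<Rightarrow> complex. f u v = 0}" for u v
    by (auto simp: complex_vector.subspace_def)
  have "complex_vector.independent {f4}"
    by (rule independent_insertI[of "{}" "{f. f (b 1) (b 3) = 0}"])
      (auto simp: complex_vector.independent_empty sub f4_def pl_def)
  then have "complex_vector.independent {f3, f4}"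
    by (rule independent_insertI[of _ "{f. f (b 1) (b 2) = 0}"]) (auto simp: sub f3_def f4_def pl_def)
  then have "complex_vector.independent {pl 0 2, f3, f4}"
    by (rule independent_insertI[of _ "{f. f (b 0) (b 2) = 0}"]) (auto simp: sub f3_def f4_def pl_def)
  then have ind: "complex_vector.independent {pl 0 1, pl 0 2, f3, f4}"
    by (rule independent_insertI[of _ "{f. f (b 0) (b 1) = 0}"]) (auto simp: sub f3_def f4_def pl_def)
  have neq: "f \<noteq> g" if "f u v \<noteq> g u v" for f g :: "'v \<Rightarrow> 'v \<Rightarrow> complex" and u v using that by auto
  have "pl 0 1 \<noteq> pl 0 2" "pl 0 1 \<noteq> f3" "pl 0 1 \<noteq> f4"
    by (rule neq[of _ "b 0" "b 1"], simp add: f3_def f4_def pl_def)+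
  moreover have "pl 0 2 \<noteq> f3" "pl 0 2 \<noteq> f4"
    by (rule neq[of _ "b 0" "b 2"], simp add: f3_def f4_def pl_def)+
  moreover have "f3 \<noteq> f4"
    by (rule neq[of _ "b 1" "b 2"], simp add: f3_def f4_def pl_def)
  ultimately have "card {pl 0 1, pl 0 2, f3, f4} = 4" by simp
  moreover obtain B where "finite B" "card B = 3" "cspan B = A"
    using subspace_finite_basis[OF A_subspace, of 2] A_dim by auto
  ultimately show False
    using complex_vector.independent_span_bound[of B, OF _ ind] \<open>pl 0 1 \<in> A\<close> 2 3 4 by auto
qed

lemma pl34_notin: "pl 3 4 \<notin> A"
proof
  assume "pl 3 4 \<in> A"
  from A_weyl[OF this] have "pl 0 1 \<in> A"
    by (rule back_subst[of "\<lambda>f. f \<in> A"]) (auto simp: fun_eq_iff pl_def X_weyl algebra_simps)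
  then show False using pl01_notin by simp
qed

lemma pl24_notin: "pl 2 4 \<notin> A"
proof
  assume "pl 2 4 \<in> A"
  from A_raising[OF this] have "(\<lambda>x y. 6 * pl 3 4 x y) \<in> A"
    by (rule back_subst[of "\<lambda>f. f \<in> A"]) (auto simp: fun_eq_iff pl_def X_raising algebra_simps)
  then have "pl 3 4 \<in> A" by (rule A_unscale) simp
  then show False using pl34_notin by simp
qed

lemma pl02_notin: "pl 0 2 \<notin> A"
proof
  assume "pl 0 2 \<in> A"
  from A_weyl[OF this] have "(\<lambda>x y. (-1) * pl 2 4 x y) \<in> A"
    by (rule back_subst[of "\<lambda>f. f \<in> A"]) (auto simp: fun_eq_iff pl_def X_weyl algebra_simps)
  then have "pl 2 4 \<in> A" by (rule A_unscale) simp
  then show False using pl24_notin by simp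
qed

text \<open>Raising sends this combination to p + 2 q times \<open>pl 2 4\<close>, which A does not
  contain. What remains is the line annihilated by raising, the extremal weight line of S^2
  W.\<close>

lemma weight_minus2:
  assumes "(\<lambda>x y. p * pl 1 4 x y + q * pl 2 3 x y) \<in> A" shows "p = - 2 * q"
proof (rule ccontr)
  assume "p \<noteq> - 2 * q"
  from A_raising[OF assms] have "(\<lambda>x y. (p + 2 * q) * pl 2 4 x y) \<in> A"
    by (rule back_subst[of "\<lambda>f. f \<in> A"]) (auto simp: fun_eq_iff pl_def X_raising algebra_simps)
  then have "pl 2 4 \<in> A"
    by (rule A_unscale) (use \<open>p \<noteq> - 2 * q\<close> in \<open>simp add: eq_neg_iff_add_eq_0\<close>)
  then show False using pl24_notin by simp
qed

lemma A_subset_forms: "A \<subseteq> forms"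
proof
  fix a assume a: "a \<in> A"
  then have alt: "a \<in> alt_forms" using A_alt by blast
  have w: "weight_part a k \<in> A" if "k \<le> 6" for k by (rule A_weight_part[OF a that])
  have 34: "a (b 3) (b 4) = 0"
    using w[of 0] pl34_notin A_unscale[of "a (b 3) (b 4)" "pl 3 4"] by (auto simp: weight_part_def)
  have 24: "a (b 2) (b 4) = 0"
    using w[of 1] pl24_notin A_unscale[of "a (b 2) (b 4)" "pl 2 4"] by (auto simp: weight_part_def)
  have 02: "a (b 0) (b 2) = 0"
    using w[of 5] pl02_notin A_unscale[of "a (b 0) (b 2)" "pl 0 2"] by (auto simp: weight_part_def)
  have 01: "a (b 0) (b 1) = 0"
    using w[of 6] pl01_notin A_unscale[of "a (b 0) (b 1)" "pl 0 1"] by (auto simp: weight_part_def)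
  have m: "a (b 1) (b 4) = - 2 * a (b 2) (b 3)"
    by (rule weight_minus2) (use w[of 2] in \<open>simp add: weight_part_def\<close>)
  \<comment> \<open>The two remaining two-dimensional weight spaces are moved onto that of
    \<open>weight_minus2\<close>: the middle one by raising, the opposite one by the Weyl
    element.\<close>
  have "(\<lambda>x y. a (b 0) (b 4) * pl 0 4 x y + a (b 1) (b 3) * pl 1 3 x y) \<in> A"
    using w[of 3] by (simp add: weight_part_def)
  from A_raising[OF this]
  have "(\<lambda>x y. (2 * a (b 0) (b 4) + 2 * a (b 1) (b 3)) * pl 1 4 x y + a (b 1) (b 3) * pl 2 3 x y) \<in> A"
    by (rule back_subst[of "\<lambda>f. f \<in> A"]) (auto simp: fun_eq_iff pl_def X_raising algebra_simps)
  then have "2 * a (b 0) (b 4) + 2 * a (b 1) (b 3) = - 2 * a (b 1) (b 3)" by (rule weight_minus2)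
  then have z: "a (b 0) (b 4) = - 2 * a (b 1) (b 3)" by algebra
  have "(\<lambda>x y. a (b 0) (b 3) * pl 0 3 x y + a (b 1) (b 2) * pl 1 2 x y) \<in> A"
    using w[of 4] by (simp add: weight_part_def)
  from A_weyl[OF this]
  have "(\<lambda>x y. a (b 0) (b 3) * pl 1 4 x y + a (b 1) (b 2) * pl 2 3 x y) \<in> A"
    by (rule back_subst[of "\<lambda>f. f \<in> A"]) (auto simp: fun_eq_iff pl_def X_weyl algebra_simps)
  then have p: "a (b 0) (b 3) = - 2 * a (b 1) (b 2)" by (rule weight_minus2)
  have "a = form (- a (b 1) (b 2)) (- a (b 1) (b 3)) (- a (b 2) (b 3))"
  proof (intro ext)
    fix x y
    show "a x y = form (- a (b 1) (b 2)) (- a (b 1) (b 3)) (- a (b 2) (b 3)) x y"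
      unfolding alt_form_expand[OF alt, of x y] form_def 34 24 02 01 m z p
      by (simp add: algebra_simps)
  qed
  then show "a \<in> forms" unfolding forms_def by blast
qed

text \<open>A lies in a space spanned by three forms, so a form outside A would give four
  independent vectors there.\<close>

theorem A_eq_forms: "A = forms"
proof
  show "forms \<subseteq> A"
  proof (rule ccontr)
    assume "\<not> forms \<subseteq> A"
    then obtain f where f: "f \<in> forms" "f \<notin> A" by blast
    obtain B where B: "finite B" "card B = 3" "complex_vector.independent B" "cspan B = A"
      using subspace_finite_basis[OF A_subspace, of 2] A_dim by auto
    let ?S = "{form 1 0 0, form 0 1 0, form 0 0 1}"
    have eq: "form p q r = p *\<^sub>C form 1 0 0 + (q *\<^sub>C form 0 1 0 + r *\<^sub>C form 0 0 1)" for p q r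
      by (simp add: fun_eq_iff form_def)
    have "form p q r \<in> cspan ?S" for p q r
      unfolding eq[of p q r]
      by (intro complex_vector.span_add complex_vector.span_scale complex_vector.span_base) simp_all
    then have span: "forms \<subseteq> cspan ?S" by (auto simp: forms_def)
    have "complex_vector.independent (insert f B)"
      using B(3,4) f(2) complex_vector.span_base by (auto simp: complex_vector.independent_insert)
    moreover have "insert f B \<subseteq> cspan ?S"
      using f(1) span A_subset_forms B(4) complex_vector.span_superset[of B] by blast
    ultimately have "card (insert f B) \<le> card ?S"
      using complex_vector.independent_span_bound[of ?S "insert f B"] by simp
    also have "\<dots> \<le> 3" by (simp add: card_insert_if)
    moreover have "f \<notin> B" using f(2) B(4) complex_vector.span_base by blast
    ultimately show False using B(1,2) by simp
  qed
qed (rule A_subset_forms)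

end

section \<open>Coordinates on the fourth symmetric power\<close>

lemma plane_coordinates:
  assumes "cdim (UNIV :: 'w::complex_vector set) = 2"
  obtains e1 e2 :: "'w::complex_vector" and w1 w2 where "clinear w1" "clinear w2" "\<forall>w. w = w1 w *\<^sub>C e1 + w2 w *\<^sub>C e2"
    "w1 e1 = 1" "w1 e2 = 0" "w2 e1 = 0" "w2 e2 = 1"
proof -
  obtain B :: "'w set" where B: "finite B" "card B = 2" "complex_vector.independent B" "cspan B = UNIV"
    using subspace_finite_basis[of "UNIV :: 'w set" 1] assms by auto
  obtain e1 e2 where e: "B = {e1, e2}" "e1 \<noteq> e2" using B(2) by (auto simp: card_2_iff)
  let ?r = "\<lambda>w. complex_vector.representation B w"
  have lin: "clinear (\<lambda>w. ?r w e)" for e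
    using complex_vector.representation_add[OF B(3)] complex_vector.representation_scale[OF B(3)]
    by (intro clinearI) (simp_all add: B(4))
  have "w = ?r w e1 *\<^sub>C e1 + ?r w e2 *\<^sub>C e2" for w
    using complex_vector.sum_representation_eq[OF B(3) _ B(1) subset_refl, of w] e B(4) by simp
  moreover have "?r e1 e1 = 1" "?r e1 e2 = 0" "?r e2 e1 = 0" "?r e2 e2 = 1"
    using complex_vector.representation_basis[OF B(3)] e by auto
  ultimately show thesis using that[OF lin lin] by blast
qed

locale plane =
  fixes e1 e2 :: "'w::complex_vector" and w1 w2 :: "'w \<Rightarrow> complex"
  assumes w_linear: "clinear w1" "clinear w2"
    and w_expand: "\<And>w. w = w1 w *\<^sub>C e1 + w2 w *\<^sub>C e2"
    and w_e: "w1 e1 = 1" "w1 e2 = 0" "w2 e1 = 0" "w2 e2 = 1"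
begin

definition func :: "complex \<Rightarrow> complex \<Rightarrow> 'w \<Rightarrow> complex"
  where "func s t w = s * w1 w + t * w2 w"

lemma func_linear: "clinear (func s t)"
  using w_linear by (simp add: clinear_iff func_def algebra_simps)

lemma linear_func:
  assumes "clinear \<phi>" shows "\<phi> = func (\<phi> e1) (\<phi> e2)"
proof
  fix w
  have "\<phi> (w1 w *\<^sub>C e1 + w2 w *\<^sub>C e2) = func (\<phi> e1) (\<phi> e2) w"
    by (simp add: func_def clinear_add[OF assms] clinear_scale[OF assms])
  then show "\<phi> w = func (\<phi> e1) (\<phi> e2) w" using w_expand[of w] by simp
qed

definition ev :: "'w sym4 \<Rightarrow> complex \<Rightarrow> complex \<Rightarrow> complex"
  where "ev p s t = Rep_sym4 p (func s t)"

lemma ev_linear: "clinear (\<lambda>p. ev p s t)"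
  by (rule clinearI) (simp_all add: ev_def plus_sym4.rep_eq scaleC_sym4.rep_eq)

text \<open>The coefficients of \<open>ev p 1 t\<close>, a polynomial of degree 4 in \<open>t\<close>, by interpolation in
  \<open>0, \<infinity>, 1, -1, 2, -2\<close>; those of odd index are divided by 2.\<close>

definition coord :: "nat \<Rightarrow> 'w sym4 \<Rightarrow> complex"
  where "coord i p = [ev p 1 0,
    ((ev p 1 1 - ev p 1 (-1)) / 2 - ((ev p 1 2 - ev p 1 (-2)) / 4 - (ev p 1 1 - ev p 1 (-1)) / 2) / 3) / 2,
    (ev p 1 1 + ev p 1 (-1)) / 2 - ev p 1 0 - ev p 0 1,
    (((ev p 1 2 - ev p 1 (-2)) / 4 - (ev p 1 1 - ev p 1 (-1)) / 2) / 3) / 2,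
    ev p 0 1] ! i"

lemma coordI:
  assumes "\<And>s t. ev p s t = c0 * s ^ 4 + 2 * c1 * s ^ 3 * t + c2 * s\<^sup>2 * t\<^sup>2 + 2 * c3 * s * t ^ 3 + c4 * t ^ 4"
  shows "coord 0 p = c0" "coord 1 p = c1" "coord 2 p = c2" "coord 3 p = c3" "coord 4 p = c4"
  by (simp_all add: coord_def assms field_simps)

lemma coord_linear: "i < 5 \<Longrightarrow> clinear (coord i)"
  unfolding less5
  by (elim disjE; intro clinearI)
    (simp_all add: coord_def clinear_add[OF ev_linear] clinear_scale[OF ev_linear] field_simps)

lemma quartic_on_plane:
  assumes "q \<in> cspan {sym_prod ws | ws. length ws = 4}"
  shows "\<exists>c0 c1 c2 c3 c4. \<forall>s t. q (func s t) =
    c0 * s ^ 4 + 2 * c1 * s ^ 3 * t + c2 * s\<^sup>2 * t\<^sup>2 + 2 * c3 * s * t ^ 3 + c4 * t ^ 4"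
  using assms
proof (induction rule: complex_vector.span_induct_alt)
  case base
  show ?case by (intro exI[of _ 0]) simp
next
  case (step k p q)
  then obtain ws where ws: "p = sym_prod ws" "length ws = 4" by blast
  obtain a b c d where abcd: "ws = [a, b, c, d]"
    using ws(2) by (auto simp: numeral_eq_Suc length_Suc_conv)
  obtain c0 c1 c2 c3 c4 where q: "\<And>s t. q (func s t) =
    c0 * s ^ 4 + 2 * c1 * s ^ 3 * t + c2 * s\<^sup>2 * t\<^sup>2 + 2 * c3 * s * t ^ 3 + c4 * t ^ 4"
    using step.IH by blast
  have p: "p (func s t) = (s * w1 a + t * w2 a) * ((s * w1 b + t * w2 b) *
      ((s * w1 c + t * w2 c) * (s * w1 d + t * w2 d)))" for s t
    by (simp add: ws(1) sym_prod_def func_linear abcd) (simp add: func_def)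
  \<comment> \<open>Halved because the odd coordinates are half the coefficients of s^3 t and s
    t^3.\<close>
  define h1 where "h1 = (w2 a * w1 b * w1 c * w1 d + w1 a * w2 b * w1 c * w1 d +
    w1 a * w1 b * w2 c * w1 d + w1 a * w1 b * w1 c * w2 d) / 2"
  define h3 where "h3 = (w1 a * w2 b * w2 c * w2 d + w2 a * w1 b * w2 c * w2 d +
    w2 a * w2 b * w1 c * w2 d + w2 a * w2 b * w2 c * w1 d) / 2"
  have h: "2 * h1 = w2 a * w1 b * w1 c * w1 d + w1 a * w2 b * w1 c * w1 d +
      w1 a * w1 b * w2 c * w1 d + w1 a * w1 b * w1 c * w2 d"
    "2 * h3 = w1 a * w2 b * w2 c * w2 d + w2 a * w1 b * w2 c * w2 d +
      w2 a * w2 b * w1 c * w2 d + w2 a * w2 b * w2 c * w1 d"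
    by (simp_all add: h1_def h3_def)
  define h2 where "h2 = w2 a * w2 b * w1 c * w1 d + w2 a * w1 b * w2 c * w1 d + w2 a * w1 b * w1 c * w2 d +
    w1 a * w2 b * w2 c * w1 d + w1 a * w2 b * w1 c * w2 d + w1 a * w1 b * w2 c * w2 d"
  have "(k *\<^sub>C p + q) (func s t) = (k * (w1 a * w1 b * w1 c * w1 d) + c0) * s ^ 4 +
      2 * (k * h1 + c1) * s ^ 3 * t + (k * h2 + c2) * s\<^sup>2 * t\<^sup>2 +
      2 * (k * h3 + c3) * s * t ^ 3 + (k * (w2 a * w2 b * w2 c * w2 d) + c4) * t ^ 4" for s t
  proof -
    have "(k *\<^sub>C p + q) (func s t) = k * p (func s t) + q (func s t)" by simp
    then show ?thesis unfolding p q h2_def using h by algebra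
  qed
  then show ?case by blast
qed

lemma ev_coord: "ev p s t = coord 0 p * s ^ 4 + 2 * coord 1 p * s ^ 3 * t + coord 2 p * s\<^sup>2 * t\<^sup>2 +
    2 * coord 3 p * s * t ^ 3 + coord 4 p * t ^ 4"
proof -
  obtain c0 c1 c2 c3 c4 where c: "\<And>s t. ev p s t =
    c0 * s ^ 4 + 2 * c1 * s ^ 3 * t + c2 * s\<^sup>2 * t\<^sup>2 + 2 * c3 * s * t ^ 3 + c4 * t ^ 4"
    using quartic_on_plane[OF Rep_sym4[of p]] unfolding ev_def by blast
  show ?thesis unfolding coordI[OF c] by (rule c)
qed

text \<open>Elements of the symmetric power are functions of arbitrary maps, so extensionality also
  needs their values at nonlinear arguments.\<close>

lemma Rep_sym4_nonlinear:
  assumes "\<not> clinear \<phi>" shows "Rep_sym4 p \<phi> = 0"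
  using Rep_sym4[of p]
  by (induction rule: complex_vector.span_induct_alt) (auto simp: sym_prod_def assms)

lemma sym4_eqI:
  assumes "\<And>s t. ev p s t = ev q s t" shows "p = q"
proof -
  have "Rep_sym4 p \<phi> = Rep_sym4 q \<phi>" for \<phi>
  proof (cases "clinear \<phi>")
    case True
    then show ?thesis using assms[unfolded ev_def] linear_func[OF True] by metis
  qed (simp add: Rep_sym4_nonlinear)
  then show ?thesis by (metis Rep_sym4_inject ext)
qed

text \<open>The factors 2 make this family dual to \<open>coord\<close>.\<close>

definition basis :: "nat \<Rightarrow> 'w sym4"
  where "basis i = [Abs_sym4 (sym_prod [e1, e1, e1, e1]), 2 *\<^sub>C Abs_sym4 (sym_prod [e1, e1, e1, e2]),
    Abs_sym4 (sym_prod [e1, e1, e2, e2]), 2 *\<^sub>C Abs_sym4 (sym_prod [e1, e2, e2, e2]),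
    Abs_sym4 (sym_prod [e2, e2, e2, e2])] ! i"

lemma ev_prod: "ev (Abs_sym4 (sym_prod [a, b, c, d])) s t =
    func s t a * func s t b * func s t c * func s t d"
proof -
  have "Rep_sym4 (Abs_sym4 (sym_prod [a, b, c, d])) = sym_prod [a, b, c, d]"
    by (intro Abs_sym4_inverse complex_vector.span_base CollectI exI[of _ "[a, b, c, d]"]) simp
  then show ?thesis by (simp add: ev_def sym_prod_def func_linear mult.assoc)
qed

lemma ev_basis:
  "ev (basis 0) s t = s ^ 4" "ev (basis 1) s t = 2 * s ^ 3 * t" "ev (basis 2) s t = s\<^sup>2 * t\<^sup>2"
  "ev (basis 3) s t = 2 * s * t ^ 3" "ev (basis 4) s t = t ^ 4"
  by (simp_all add: basis_def clinear_scale[OF ev_linear] ev_prod func_def w_e power2_eq_square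
      power3_eq_cube power4_eq_xxxx)

sublocale coordinates5 coord basis
proof (rule coordinates5.intro)
  show "clinear (coord i)" if "i < 5" for i using that by (rule coord_linear)
  show "coord i (basis j) = (if i = j then 1 else 0)" if "i < 5" "j < 5" for i j
    using that unfolding less5
    by (elim disjE) (simp_all add: coord_def ev_basis)
  show "x = (\<Sum>k<5. coord k x *\<^sub>C basis k)" for x
    by (rule sym4_eqI)
      (simp add: sum5 clinear_add[OF ev_linear] clinear_scale[OF ev_linear] ev_basis ev_coord[of x])
qed

lemma ev_pt: "ev (pt x0 x1 x2 x3 x4) s t =
    x0 * s ^ 4 + 2 * x1 * s ^ 3 * t + x2 * s\<^sup>2 * t\<^sup>2 + 2 * x3 * s * t ^ 3 + x4 * t ^ 4"
  by (simp add: ev_coord)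

section \<open>Special linear maps in coordinates\<close>

lemma SL2I:
  assumes g: "clinear g" and det: "w1 (g e1) * w2 (g e2) - w2 (g e1) * w1 (g e2) = 1"
  shows "g \<in> SL2"
proof -
  have "\<omega> (g x) (g y) = \<omega> x y" if "\<omega> \<in> alt_forms" for \<omega> x y
  proof -
    note l = alt_formsD[OF that]
    \<comment> \<open>On a plane every alternating form is a multiple of the determinant, so
      invariance follows from its value at the basis.\<close>
    have area: "\<omega> x y = (w1 x * w2 y - w2 x * w1 y) * \<omega> e1 e2" for x y
    proof -
      have "\<omega> (w1 x *\<^sub>C e1 + w2 x *\<^sub>C e2) (w1 y *\<^sub>C e1 + w2 y *\<^sub>C e2) = (w1 x * w2 y - w2 x * w1 y) * \<omega> e1 e2"
        using l(4)[of e2 e1]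
        by (simp add: clinear_add[OF l(1)] clinear_add[OF l(2)] clinear_scale[OF l(1)]
            clinear_scale[OF l(2)] l(3) algebra_simps)
      then show ?thesis using w_expand[of x] w_expand[of y] by simp
    qed
    have e: "\<omega> (g e1) (g e2) = \<omega> e1 e2" unfolding area[of "g e1" "g e2"] det by simp
    have "\<omega> (g (w1 x *\<^sub>C e1 + w2 x *\<^sub>C e2)) (g (w1 y *\<^sub>C e1 + w2 y *\<^sub>C e2)) =
      (w1 x * w2 y - w2 x * w1 y) * \<omega> (g e1) (g e2)"
      using l(4)[of "g e2" "g e1"]
      by (simp add: clinear_add[OF g] clinear_scale[OF g] clinear_add[OF l(1)] clinear_add[OF l(2)]
          clinear_scale[OF l(1)] clinear_scale[OF l(2)] l(3) algebra_simps)
    then show ?thesis using w_expand[of x] w_expand[of y] area[of x y] e by simp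
  qed
  then show ?thesis using g by (simp add: SL2_def)
qed

definition mat :: "complex \<Rightarrow> complex \<Rightarrow> complex \<Rightarrow> complex \<Rightarrow> 'w \<Rightarrow> 'w"
  where "mat a b c d w = (a * w1 w + b * w2 w) *\<^sub>C e1 + (c * w1 w + d * w2 w) *\<^sub>C e2"

lemma mat_linear: "clinear (mat a b c d)"
  using w_linear
  by (intro clinearI)
    (simp_all add: mat_def clinear_iff scaleC_add_left scaleC_add_right scaleC_scaleC algebra_simps)

lemma w_mat: "w1 (mat a b c d w) = a * w1 w + b * w2 w" "w2 (mat a b c d w) = c * w1 w + d * w2 w"
  by (simp_all add: mat_def clinear_add[OF w_linear(1)] clinear_add[OF w_linear(2)]
      clinear_scale[OF w_linear(1)] clinear_scale[OF w_linear(2)] w_e)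

lemma mat_SL2: "a * d - b * c = 1 \<Longrightarrow> mat a b c d \<in> SL2"
  by (rule SL2I[OF mat_linear]) (simp add: w_mat w_e mult.commute)

text \<open>A map of W acts on functionals by composition, so the row vector (s, t) is multiplied by
  the matrix from the right.\<close>

lemma ev_mat: "ev (sym4_map (mat a b c d) p) s t = ev p (s * a + t * c) (s * b + t * d)"
proof -
  have "func s t \<circ> mat a b c d = func (s * a + t * c) (s * b + t * d)"
    by (simp add: fun_eq_iff func_def w_mat algebra_simps)
  then show ?thesis by (simp add: ev_def Rep_sym4_map[OF mat_linear] func_linear)
qed

lemma sym4_map_torus: "c \<noteq> 0 \<Longrightarrow> sym4_map (mat c 0 0 (1 / c)) p = torus c p"
proof (rule sym4_eqI)
  fix s t
  assume c: "c \<noteq> 0"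
  \<comment> \<open>With c * d = 1 in place of the quotient, the claim becomes a polynomial
    identity.\<close>
  define d where "d = 1 / c"
  have cd: "c * d = 1" using c by (simp add: d_def)
  have div: "x / c\<^sup>2 = d\<^sup>2 * x" "x / c ^ 4 = d ^ 4 * x" for x
    by (simp_all add: d_def power_divide)
  show "ev (sym4_map (mat c 0 0 (1 / c)) p) s t = ev (torus c p) s t"
    unfolding ev_mat ev_coord[of p] torus_def ev_pt div d_def[symmetric] using cd by algebra
qed

lemma sym4_map_unipotent: "sym4_map (mat 1 r 0 1) p = unipotent r p"
proof (rule sym4_eqI)
  show "ev (sym4_map (mat 1 r 0 1) p) s t = ev (unipotent r p) s t" for s t
    unfolding ev_mat ev_coord[of p] unipotent_def ev_pt by algebra
qed

lemma sym4_map_weyl: "sym4_map (mat 0 (- 1) 1 0) p = weyl p"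
proof (rule sym4_eqI)
  show "ev (sym4_map (mat 0 (- 1) 1 0) p) s t = ev (weyl p) s t" for s t
    unfolding ev_mat ev_coord[of p] weyl_def ev_pt by algebra
qed

theorem invariant_subspace_eq_forms:
  assumes "csubspace A" "A \<subseteq> alt_forms" "cdim A = 3"
    and inv: "\<And>g a. g \<in> SL2 \<Longrightarrow> a \<in> A \<Longrightarrow> (\<lambda>x y. a (sym4_map g x) (sym4_map g y)) \<in> A"
  shows "A = forms"
proof -
  interpret invariant_forms coord basis A
  proof (unfold_locales; (fact assms)?)
    show "(\<lambda>x y. a (torus c x) (torus c y)) \<in> A" if "a \<in> A" "c \<noteq> 0" for a c
      using inv[OF mat_SL2 that(1), of c "1 / c" 0 0] that(2) by (simp add: sym4_map_torus)
    show "(\<lambda>x y. a (unipotent r x) (unipotent r y)) \<in> A" if "a \<in> A" for a r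
      using inv[OF mat_SL2 that, of 1 1 r 0] by (simp add: sym4_map_unipotent)
    show "(\<lambda>x y. a (weyl x) (weyl y)) \<in> A" if "a \<in> A" for a
      using inv[OF mat_SL2 that, of 0 0 "- 1" 1] by (simp add: sym4_map_weyl)
  qed
  show ?thesis by (rule A_eq_forms)
qed

end

text \<open>Being a blow-up is a predicate, so the existence clause keeps the second clause from
  holding vacuously; the seven cubics provide the witness.\<close>

theorem proposition3p7:
  fixes A :: "('w::complex_vector sym4 \<Rightarrow> 'w sym4 \<Rightarrow> complex) set"
  assumes "cdim (UNIV :: 'w set) = 2"
    and "csubspace A" and "A \<subseteq> alt_forms" and "cdim A = 3"
    and "\<forall>g\<in>SL2. \<forall>a\<in>A. (\<lambda>x y. a (sym4_map g x) (sym4_map g y)) \<in> A"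
  shows "(\<exists>B. is_blowup (ker_form ` proj A) B) \<and>
    (\<forall>B. is_blowup (ker_form ` proj A) B \<longrightarrow>
      (\<exists>f. variety_iso (PU A) B f \<and> (\<forall>z\<in>PU A. fst (f z) = fst z)))"
proof -
  obtain e1 e2 :: 'w and w1 w2 where w: "clinear w1" "clinear w2" "\<forall>w. w = w1 w *\<^sub>C e1 + w2 w *\<^sub>C e2"
    "w1 e1 = 1" "w1 e2 = 0" "w2 e1 = 0" "w2 e2 = 1"
    by (rule plane_coordinates[OF assms(1)])
  interpret plane e1 e2 w1 w2
    by (rule plane.intro) (rule w spec[OF w(3)])+
  have A: "A = forms"
    using assms(2-5) by (intro invariant_subspace_eq_forms) blast+
  show ?thesis
    unfolding A ker_forms
    using generates_squares blowup_iso by (auto simp: is_blowup_def)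
qed

end
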